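(* Let $P=\prod_{a\in A}R_a$ be a product of integral domains. (1) If the index set $A$ is finite, $P^+$ exists (i.e. $P$ has an aic that is unique up to isomorphism of $P$-algebras), and it is the product $\prod_{a\in A}R_a^+$. (2) If $A$ is infinite, $P$ has a unique universal aic. (3) If $R$ is a subring of $P$ such that $P$ is integral and tight over $R$, then $R$ has a unique universal aic. It is the integral closure of $R$ in $\prod_{a\in A}R_a^+$.
   Context: All rings are commutative and unital. A ring extension $R\subseteq S$ is tight if every non-zero ideal of $S$ has non-zero intersection with $R$. A ring $S$ is absolutely integrally closed (ai closed) if every monic polynomial in $S[X]$ factorizes as a product of monic linear polynomials in $S[X]$ (uniqueness of the factorization is not required). An absolute integral closure (aic) of $R$ is an extension ring $S\supseteq R$ that is ai closed, integral over $R$ and tight over $R$. If all aics of $R$ are isomorphic as $R$-algebras, the unique aic is denoted $R^+$ and one says that $R^+$ exists. For an integral domain $D$, $D^+$ is the integral closure of $D$ in an algebraic closure of its field of fractions. A universal aic of $R$ is an aic of $R$ into which every aic of $R$ can be embedded as an $R$-algebra; uniqueness is meant up to isomorphism of $R$-algebras. *)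

theory Defs
  imports "HOL-Algebra.Algebra"
begin

section \<open>Ring extensions and absolute integral closures\<close>

text \<open>
  An extension ring \<open>S\<close> of \<open>R\<close> is a ring \<open>S\<close> with an injective structure map \<open>h\<close> from \<open>R\<close>;
  thus \<open>S\<close> may live on another type than \<open>R\<close>. For an actual subring, \<open>h\<close> is the identity.
\<close>

definition ring_extension ::
    "('r, 'm) ring_scheme \<Rightarrow> ('s, 'n) ring_scheme \<Rightarrow> ('r \<Rightarrow> 's) \<Rightarrow> bool" where
  "ring_extension R S h \<longleftrightarrow>
     cring R \<and> cring S \<and> h \<in> ring_hom R S \<and> inj_on h (carrier R)"

definition tight_extension ::
    "('r, 'm) ring_scheme \<Rightarrow> ('s, 'n) ring_scheme \<Rightarrow> ('r \<Rightarrow> 's) \<Rightarrow> bool" where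
  "tight_extension R S h \<longleftrightarrow>
     ring_extension R S h \<and>
     (\<forall>I. ideal I S \<and> I \<noteq> {\<zero>\<^bsub>S\<^esub>} \<longrightarrow> I \<inter> h ` carrier R \<noteq> {\<zero>\<^bsub>S\<^esub>})"

definition monic_poly :: "('r, 'm) ring_scheme \<Rightarrow> (nat \<Rightarrow> 'r) \<Rightarrow> bool" where
  "monic_poly R p \<longleftrightarrow> p \<in> carrier (UP R) \<and> coeff (UP R) p (deg R p) = \<one>\<^bsub>R\<^esub>"

definition integral_element ::
    "('r, 'm) ring_scheme \<Rightarrow> ('s, 'n) ring_scheme \<Rightarrow> ('r \<Rightarrow> 's) \<Rightarrow> 's \<Rightarrow> bool" where
  "integral_element R S h s \<longleftrightarrow> (\<exists>p. monic_poly R p \<and> eval R S h s p = \<zero>\<^bsub>S\<^esub>)"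

definition integral_extension ::
    "('r, 'm) ring_scheme \<Rightarrow> ('s, 'n) ring_scheme \<Rightarrow> ('r \<Rightarrow> 's) \<Rightarrow> bool" where
  "integral_extension R S h \<longleftrightarrow>
     ring_extension R S h \<and> (\<forall>s\<in>carrier S. integral_element R S h s)"

definition integral_closure ::
    "('r, 'm) ring_scheme \<Rightarrow> ('s, 'n) ring_scheme \<Rightarrow> ('r \<Rightarrow> 's) \<Rightarrow> ('s, 'n) ring_scheme" where
  "integral_closure R S h = S\<lparr>carrier := {s \<in> carrier S. integral_element R S h s}\<rparr>"

definition ai_closed :: "('s, 'n) ring_scheme \<Rightarrow> bool" where
  "ai_closed S \<longleftrightarrow>
     (\<forall>p. monic_poly S p \<longrightarrow>
       (\<exists>(n::nat) c. c \<in> {..<n} \<rightarrow> carrier S \<and>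
          p = (\<Otimes>\<^bsub>UP S\<^esub>i\<in>{..<n}. monom (UP S) \<one>\<^bsub>S\<^esub> 1 \<oplus>\<^bsub>UP S\<^esub> monom (UP S) (c i) 0)))"

definition aic ::
    "('r, 'm) ring_scheme \<Rightarrow> ('s, 'n) ring_scheme \<Rightarrow> ('r \<Rightarrow> 's) \<Rightarrow> bool" where
  "aic R S h \<longleftrightarrow> ai_closed S \<and> integral_extension R S h \<and> tight_extension R S h"

definition algebra_embeds ::
    "('r, 'm) ring_scheme \<Rightarrow> ('s, 'n) ring_scheme \<Rightarrow> ('r \<Rightarrow> 's) \<Rightarrow>
     ('t, 'k) ring_scheme \<Rightarrow> ('r \<Rightarrow> 't) \<Rightarrow> bool" where
  "algebra_embeds R S h T k \<longleftrightarrow>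
     (\<exists>f\<in>ring_hom S T. inj_on f (carrier S) \<and> (\<forall>r\<in>carrier R. f (h r) = k r))"

definition algebra_iso ::
    "('r, 'm) ring_scheme \<Rightarrow> ('s, 'n) ring_scheme \<Rightarrow> ('r \<Rightarrow> 's) \<Rightarrow>
     ('t, 'k) ring_scheme \<Rightarrow> ('r \<Rightarrow> 't) \<Rightarrow> bool" where
  "algebra_iso R S h T k \<longleftrightarrow>
     (\<exists>f\<in>ring_iso S T. \<forall>r\<in>carrier R. f (h r) = k r)"

text \<open>
  A formula cannot quantify over types. The type over which the competing rings range is therefore
  an explicit argument of the following notions; a theorem with that type left as a type variable
  speaks about rings on all types.
\<close>

definition unique_aic ::
    "'s itself \<Rightarrow> ('r, 'm) ring_scheme \<Rightarrow> ('u, 'n) ring_scheme \<Rightarrow> ('r \<Rightarrow> 'u) \<Rightarrow> bool" where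
  "unique_aic _ R U h \<longleftrightarrow>
     aic R U h \<and> (\<forall>(S :: 's ring) k. aic R S k \<longrightarrow> algebra_iso R U h S k)"

definition universal_aic ::
    "'s itself \<Rightarrow> ('r, 'm) ring_scheme \<Rightarrow> ('u, 'n) ring_scheme \<Rightarrow> ('r \<Rightarrow> 'u) \<Rightarrow> bool" where
  "universal_aic _ R U h \<longleftrightarrow>
     aic R U h \<and> (\<forall>(S :: 's ring) k. aic R S k \<longrightarrow> algebra_embeds R S k U h)"

text \<open>
  \<open>'s\<close> is the type of the aics that are embedded into \<open>U\<close>, and \<open>'v\<close> the type of the universal aics
  that are compared with \<open>U\<close>. Such a \<open>V\<close> is only assumed to be universal for aics on the type
  \<open>'u\<close> of \<open>U\<close>; this makes the uniqueness claim stronger. It also has the effect that rings \<open>U\<close> on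
  \<open>'u\<close> that satisfy this definition for various \<open>'s\<close> and \<open>'v\<close> are all isomorphic, so that their
  existence for each \<open>'s\<close> and \<open>'v\<close> yields a single ring that is universal for all types.
\<close>

definition unique_universal_aic ::
    "'s itself \<Rightarrow> 'v itself \<Rightarrow> ('r, 'm) ring_scheme \<Rightarrow> 'u ring \<Rightarrow> ('r \<Rightarrow> 'u) \<Rightarrow> bool" where
  "unique_universal_aic _ _ R U h \<longleftrightarrow>
     universal_aic TYPE('s) R U h \<and> universal_aic TYPE('u) R U h \<and>
     (\<forall>(V :: 'v ring) k. universal_aic TYPE('u) R V k \<longrightarrow> algebra_iso R U h V k)"


section \<open>The ring \<open>D\<^sup>+\<close> of an integral domain \<open>D\<close>\<close>

definition fraction :: "('a, 'm) ring_scheme \<Rightarrow> 'a \<Rightarrow> 'a \<Rightarrow> ('a \<times> 'a) set" where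
  "fraction D a b =
     {(c, d). c \<in> carrier D \<and> d \<in> carrier D - {\<zero>\<^bsub>D\<^esub>} \<and> a \<otimes>\<^bsub>D\<^esub> d = c \<otimes>\<^bsub>D\<^esub> b}"

text \<open>The unions below are unions of equal sets: they express independence of representatives.\<close>

definition fraction_field :: "('a, 'm) ring_scheme \<Rightarrow> ('a \<times> 'a) set ring" where
  "fraction_field D =
     \<lparr>carrier = {fraction D a b | a b. a \<in> carrier D \<and> b \<in> carrier D - {\<zero>\<^bsub>D\<^esub>}},
      monoid.mult = (\<lambda>M N. \<Union>p\<in>M. \<Union>q\<in>N.
               fraction D (fst p \<otimes>\<^bsub>D\<^esub> fst q) (snd p \<otimes>\<^bsub>D\<^esub> snd q)),
      monoid.one = fraction D \<one>\<^bsub>D\<^esub> \<one>\<^bsub>D\<^esub>,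
      ring.zero = fraction D \<zero>\<^bsub>D\<^esub> \<one>\<^bsub>D\<^esub>,
      ring.add = (\<lambda>M N. \<Union>p\<in>M. \<Union>q\<in>N.
               fraction D (fst p \<otimes>\<^bsub>D\<^esub> snd q \<oplus>\<^bsub>D\<^esub> fst q \<otimes>\<^bsub>D\<^esub> snd p)
                 (snd p \<otimes>\<^bsub>D\<^esub> snd q))\<rparr>"

type_synonym 'a plus_elem = "(('a \<times> 'a) set list \<times> nat) multiset \<Rightarrow> ('a \<times> 'a) set"

definition domain_plus_map :: "('a, 'm) ring_scheme \<Rightarrow> 'a \<Rightarrow> 'a plus_elem" where
  "domain_plus_map D x = ring.indexed_const (fraction_field D) (fraction D x \<one>\<^bsub>D\<^esub>)"

definition domain_plus :: "('a, 'm) ring_scheme \<Rightarrow> 'a plus_elem ring" where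
  "domain_plus D =
     integral_closure D (field.alg_closure (fraction_field D)) (domain_plus_map D)"


section \<open>Products of rings\<close>

definition product_ring :: "'i set \<Rightarrow> ('i \<Rightarrow> ('a, 'm) ring_scheme) \<Rightarrow> ('i \<Rightarrow> 'a) ring" where
  "product_ring A R =
     \<lparr>carrier = (\<Pi>\<^sub>E a\<in>A. carrier (R a)),
      monoid.mult = (\<lambda>x y. \<lambda>a\<in>A. x a \<otimes>\<^bsub>R a\<^esub> y a),
      monoid.one = (\<lambda>a\<in>A. \<one>\<^bsub>R a\<^esub>),
      ring.zero = (\<lambda>a\<in>A. \<zero>\<^bsub>R a\<^esub>),
      ring.add = (\<lambda>x y. \<lambda>a\<in>A. x a \<oplus>\<^bsub>R a\<^esub> y a)\<rparr>"

definition product_plus ::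
    "'i set \<Rightarrow> ('i \<Rightarrow> ('a, 'm) ring_scheme) \<Rightarrow> ('i \<Rightarrow> 'a plus_elem) ring" where
  "product_plus A R = product_ring A (\<lambda>a. domain_plus (R a))"

definition product_plus_map ::
    "'i set \<Rightarrow> ('i \<Rightarrow> ('a, 'm) ring_scheme) \<Rightarrow> ('i \<Rightarrow> 'a) \<Rightarrow> ('i \<Rightarrow> 'a plus_elem)" where
  "product_plus_map A R x = (\<lambda>a\<in>A. domain_plus_map (R a) (x a))"

end

theory Submission
  imports Defs
begin

text \<open>
  Embed every \<open>R a\<close> in an algebraically closed field \<open>K a\<close>. The universal aic is the ring \<open>U\<close> of those
  elements of the product of the \<open>K a\<close> that are integral over the given ring \<open>T\<close>: monic polynomials
  split coordinatewise, and a nonzero element of \<open>U\<close> has a nonzero multiple in the product of the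
  \<open>R a\<close>, hence in \<open>T\<close>. For an integral and tight extension \<open>S\<close> of \<open>T\<close>, each coordinate map
  \<open>T \<rightarrow> K a\<close> extends to \<open>S\<close>, since \<open>K a\<close> is algebraically closed; the extensions together form a map
  \<open>S \<rightarrow> U\<close> that is injective on \<open>T\<close>, and therefore injective by tightness. An injective
  endomorphism of \<open>U\<close> over \<open>T\<close> fixes the primitive idempotents and permutes the finitely many roots
  of a monic polynomial in every coordinate, so that it is surjective; this gives uniqueness. If
  the index set is finite, any aic of the whole product contains the idempotents and all roots in
  each coordinate, hence is all of \<open>U\<close>.
\<close>

section \<open>Integral elements\<close>

text \<open>The obstacle is that \<open>T\<close> can be much smaller than the product: it may
  contain none of the idempotents that separate the coordinates, and a homomorphism over
  \<open>T\<close> is not known beforehand to respect coordinates. Tightness repairs this. The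
  principal ideal of an element supported at one coordinate meets \<open>T\<close>, so
  \<open>T\<close> has nonzero elements supported at each single coordinate. They yield both the
  nonzero multiples in \<open>T\<close>, once the constant term of an equation of least degree has
  led from \<open>K a\<close> down to \<open>R a\<close>, and the fact that endomorphisms fix the
  idempotents. Infinite index sets do no harm to surjectivity, because one monic polynomial governs
  all coordinates at once and every choice of its roots is again integral; but building elements of
  \<open>U\<close> from elements supported at one coordinate takes finite sums. Integrality is
  treated inside one ring, through sets of values of polynomials of bounded degree. Coefficients may
  then come from a subring, a kernel or an arbitrary set, and a single elimination lemma serves both
  finite extensions and lying over.\<close>

context cring
begin

text \<open>
  This replaces the determinant in the Cayley--Hamilton argument: a step of fraction-free
  elimination multiplies diagonal entries (in \<open>D k\<close>) with each other and off-diagonal entries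
  (in \<open>L k\<close>) with each other, which doubles \<open>k\<close>.
\<close>

lemma elimination:
  fixes N k :: nat
  assumes D: "\<And>k. D k \<subseteq> carrier R" and L: "\<And>k. L k \<subseteq> carrier R"
    and DL: "\<And>k d d' l l'. \<lbrakk>d \<in> D k; d' \<in> D k; l \<in> L k; l' \<in> L k\<rbrakk> \<Longrightarrow> d \<otimes> d' \<ominus> l \<otimes> l' \<in> D (2 * k)"
    and LL: "\<And>k d l l' l''. \<lbrakk>d \<in> D k; l \<in> L k; l' \<in> L k; l'' \<in> L k\<rbrakk> \<Longrightarrow> d \<otimes> l \<ominus> l' \<otimes> l'' \<in> L (2 * k)"
    and m: "\<And>j. j \<le> N \<Longrightarrow> m j \<in> carrier R"
    and diag: "\<And>i. i \<le> N \<Longrightarrow> b i i \<in> D k"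
    and off: "\<And>i j. \<lbrakk>i \<le> N; j \<le> N; i \<noteq> j\<rbrakk> \<Longrightarrow> b i j \<in> L k"
    and rel: "\<And>i. i \<le> N \<Longrightarrow> (\<Oplus>j\<in>{..N}. b i j \<otimes> m j) = \<zero>"
  shows "\<exists>k. \<exists>d\<in>D k. d \<otimes> m 0 = \<zero>"
  using m diag off rel
proof (induction N arbitrary: k b)
  case 0
  have "b 0 0 \<in> D k" "m 0 \<in> carrier R" using 0 by auto
  then have "b 0 0 \<otimes> m 0 = (\<Oplus>j\<in>{..0}. b 0 j \<otimes> m j)"
    using D by (subst finsum_0) auto
  then have "b 0 0 \<otimes> m 0 = \<zero>" using 0(4)[of 0] by (metis le_refl)
  then show ?case using \<open>b 0 0 \<in> D k\<close> by auto
next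
  case (Suc N)
  let ?n = "Suc N"
  have bc: "b i j \<in> carrier R" if "i \<le> ?n" "j \<le> ?n" for i j
    using that Suc.prems(2)[of i] Suc.prems(3)[of i j] D L by (cases "i = j") auto
  \<comment> \<open>Row \<open>i\<close> times the pivot, minus \<open>b i ?n\<close> times the last
    row: the term in \<open>m ?n\<close> cancels and nothing is divided.\<close>
  define b' where "b' i j = b ?n ?n \<otimes> b i j \<ominus> b i ?n \<otimes> b ?n j" for i j
  have row: "(\<Oplus>j\<in>{..N}. b i j \<otimes> m j) = \<ominus> (b i ?n \<otimes> m ?n)" if "i \<le> ?n" for i
  proof -
    have "(\<Oplus>j\<in>{..?n}. b i j \<otimes> m j) = b i ?n \<otimes> m ?n \<oplus> (\<Oplus>j\<in>{..N}. b i j \<otimes> m j)"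
      using that bc Suc.prems(1) by (subst finsum_Suc) auto
    then have "b i ?n \<otimes> m ?n \<oplus> (\<Oplus>j\<in>{..N}. b i j \<otimes> m j) = \<zero>"
      using Suc.prems(4)[OF that] by simp
    moreover have "b i ?n \<otimes> m ?n \<in> carrier R" "(\<Oplus>j\<in>{..N}. b i j \<otimes> m j) \<in> carrier R"
      using that bc Suc.prems(1) by auto
    ultimately show ?thesis using sum_zero_eq_neg local.add.m_comm by metis
  qed
  have "(\<Oplus>j\<in>{..N}. b' i j \<otimes> m j) = \<zero>" if i: "i \<le> N" for i
  proof -
    have c: "b ?n ?n \<in> carrier R" "b i ?n \<in> carrier R" "m ?n \<in> carrier R" using bc i Suc.prems(1) by auto
    have cj: "b i j \<in> carrier R" "b ?n j \<in> carrier R" "m j \<in> carrier R" if "j \<le> N" for j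
      using bc i Suc.prems(1) that by auto
    have "(\<Oplus>j\<in>{..N}. b' i j \<otimes> m j)
        = (\<Oplus>j\<in>{..N}. b ?n ?n \<otimes> (b i j \<otimes> m j) \<oplus> (\<ominus> b i ?n) \<otimes> (b ?n j \<otimes> m j))"
      unfolding b'_def using c cj by (intro finsum_cong') (auto, algebra)
    also have "\<dots> = (\<Oplus>j\<in>{..N}. b ?n ?n \<otimes> (b i j \<otimes> m j)) \<oplus> (\<Oplus>j\<in>{..N}. (\<ominus> b i ?n) \<otimes> (b ?n j \<otimes> m j))"
      using c cj by (intro finsum_addf) auto
    also have "\<dots> = b ?n ?n \<otimes> (\<Oplus>j\<in>{..N}. b i j \<otimes> m j) \<oplus> (\<ominus> b i ?n) \<otimes> (\<Oplus>j\<in>{..N}. b ?n j \<otimes> m j)"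
      using c cj by (subst (1 2) finsum_rdistr) auto
    also have "\<dots> = b ?n ?n \<otimes> (\<ominus> (b i ?n \<otimes> m ?n)) \<oplus> (\<ominus> b i ?n) \<otimes> (\<ominus> (b ?n ?n \<otimes> m ?n))"
      using row[of i] row[of ?n] i by simp
    also have "\<dots> = \<zero>" using c by algebra
    finally show ?thesis .
  qed
  moreover have "b' i i \<in> D (2 * k)" if "i \<le> N" for i
    unfolding b'_def using that Suc.prems by (intro DL) auto
  moreover have "b' i j \<in> L (2 * k)" if "i \<le> N" "j \<le> N" "i \<noteq> j" for i j
    unfolding b'_def using that Suc.prems by (intro LL) auto
  ultimately show ?case using Suc.IH[of b' "2 * k"] Suc.prems(1) by auto
qed

section \<open>Linear combinations of a finite list\<close>

text \<open>The coefficient set \<open>E\<close> is arbitrary: it is a base ring when finiteness of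
  an extension is shown, and the kernel of a partial homomorphism in the lying-over
  argument.\<close>

primrec lin_span :: "'a set \<Rightarrow> 'a list \<Rightarrow> 'a set" where
  "lin_span E [] = {\<zero>}"
| "lin_span E (g # gs) = {a \<otimes> g \<oplus> y | a y. a \<in> E \<and> y \<in> lin_span E gs}"

lemma lin_span_closed: "\<lbrakk>E \<subseteq> carrier R; set gs \<subseteq> carrier R\<rbrakk> \<Longrightarrow> lin_span E gs \<subseteq> carrier R"
  by (induction gs) auto

lemma lin_span_zero: "\<lbrakk>\<zero> \<in> E; set gs \<subseteq> carrier R\<rbrakk> \<Longrightarrow> \<zero> \<in> lin_span E gs"
proof (induction gs)
  case (Cons g gs)
  then have "\<zero> = \<zero> \<otimes> g \<oplus> \<zero>" by auto
  then show ?case using Cons by (auto intro!: exI)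
qed auto

lemma lin_span_append:
  assumes "E \<subseteq> carrier R" "set gs \<subseteq> carrier R" "set gs' \<subseteq> carrier R"
    and "y \<in> lin_span E gs" "z \<in> lin_span E gs'"
  shows "y \<oplus> z \<in> lin_span E (gs @ gs')"
  using assms
proof (induction gs arbitrary: y)
  case Nil
  then show ?case using lin_span_closed[of E gs'] by auto
next
  case (Cons g gs)
  then obtain a y' where y: "y = a \<otimes> g \<oplus> y'" "a \<in> E" "y' \<in> lin_span E gs" by auto
  then have "y' \<oplus> z \<in> lin_span E (gs @ gs')" using Cons by auto
  moreover have "y \<oplus> z = a \<otimes> g \<oplus> (y' \<oplus> z)"
    using y Cons.prems lin_span_closed[of E gs] lin_span_closed[of E gs'] by (auto simp: a_assoc subset_iff)
  ultimately show ?case using y by auto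
qed

lemma lin_span_mult:
  assumes "E \<subseteq> carrier R" "set gs \<subseteq> carrier R" "x \<in> carrier R" "y \<in> lin_span E gs"
  shows "x \<otimes> y \<in> lin_span E (map ((\<otimes>) x) gs)"
  using assms
proof (induction gs arbitrary: y)
  case (Cons g gs)
  then obtain a y' where y: "y = a \<otimes> g \<oplus> y'" "a \<in> E" "y' \<in> lin_span E gs" by auto
  have "a \<in> carrier R" "g \<in> carrier R" "y' \<in> carrier R"
    using y Cons.prems lin_span_closed[of E gs] by auto
  then have "x \<otimes> y = a \<otimes> (x \<otimes> g) \<oplus> x \<otimes> y'" using y(1) \<open>x \<in> carrier R\<close> by algebra
  moreover have "x \<otimes> y' \<in> lin_span E (map ((\<otimes>) x) gs)" using Cons y by auto
  ultimately show ?case using y by auto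
qed auto

text \<open>Turns the recursive span into an indexed sum, the form in which
  \<open>elimination\<close> takes the rows of a linear system.\<close>

lemma lin_span_coeffs:
  assumes "E \<subseteq> carrier R" "set gs \<subseteq> carrier R" "y \<in> lin_span E gs"
  shows "\<exists>a. (\<forall>j<length gs. a j \<in> E) \<and> y = (\<Oplus>j\<in>{..<length gs}. a j \<otimes> gs ! j)"
  using assms
proof (induction gs arbitrary: y)
  case (Cons g gs)
  then obtain b y' where y: "y = b \<otimes> g \<oplus> y'" "b \<in> E" "y' \<in> lin_span E gs" by auto
  then obtain a where a: "\<forall>j<length gs. a j \<in> E" "y' = (\<Oplus>j\<in>{..<length gs}. a j \<otimes> gs ! j)"
    using Cons by auto
  let ?a = "case_nat b a"
  have "?a \<in> {..length gs} \<rightarrow> E" using y a by (auto split: nat.splits)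
  moreover have nth: "(g # gs) ! j \<in> carrier R" if "j \<le> length gs" for j
    using that Cons.prems(2) nth_mem[of j "g # gs"] by auto
  ultimately have c: "(\<lambda>j. ?a j \<otimes> (g # gs) ! j) \<in> {..length gs} \<rightarrow> carrier R"
    using Cons.prems(1) by (auto simp: Pi_def subset_iff)
  have "(\<Oplus>j\<in>{..<length (g # gs)}. ?a j \<otimes> (g # gs) ! j) = y"
  proof (cases gs)
    case Nil
    have "{..<length (g # gs)} = {0}" using Nil by auto
    then have "(\<Oplus>j\<in>{..<length (g # gs)}. ?a j \<otimes> (g # gs) ! j) = ?a 0 \<otimes> (g # gs) ! 0"
      using finsum_0[of "\<lambda>j. ?a j \<otimes> (g # gs) ! j"] c Nil by auto
    moreover have "b \<otimes> g \<oplus> \<zero> = b \<otimes> g" using y Cons.prems by auto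
    ultimately show ?thesis using y Nil by simp
  next
    case Cons2: (Cons g' gs')
    have e: "{..<length (g # gs)} = {..Suc (length gs')}" using Cons2 by auto
    have e2: "{..<length gs} = {..length gs'}" using Cons2 by auto
    have "(\<Oplus>j\<in>{..Suc (length gs')}. ?a j \<otimes> (g # gs) ! j)
       = (\<Oplus>j\<in>{..length gs'}. ?a (Suc j) \<otimes> (g # gs) ! Suc j) \<oplus> ?a 0 \<otimes> (g # gs) ! 0"
      using c Cons2 by (intro finsum_Suc2) auto
    also have "\<dots> = y' \<oplus> b \<otimes> g" using a e2 by simp
    also have "\<dots> = y" using y Cons.prems lin_span_closed[of E gs] by (auto intro!: a_comm)
    finally show ?thesis using e by simp
  qed
  then show ?case using y a by (auto intro!: exI[of _ ?a] simp: less_Suc_eq_0_disj)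
qed auto

section \<open>Values of polynomials of bounded degree\<close>

text \<open>The values at \<open>x\<close> of the polynomials over \<open>B\<close> of degree less than \<open>n\<close>, by Horner's scheme.\<close>

primrec poly_values :: "'a set \<Rightarrow> 'a \<Rightarrow> nat \<Rightarrow> 'a set" where
  "poly_values B x 0 = {\<zero>}"
| "poly_values B x (Suc n) = {b \<oplus> x \<otimes> y | b y. b \<in> B \<and> y \<in> poly_values B x n}"

text \<open>Integrality as a property of elements of one ring: the monic equation is split into its
  top power and a value of lower degree. \<open>B\<close> may be any subset, so intermediate rings
  and mere sets of integral elements can serve as coefficients. \<open>integral_element_iff\<close>
  links this to the notion used in the theorem.\<close>

definition integral_over :: "'a set \<Rightarrow> 'a \<Rightarrow> bool" where
  "integral_over B x \<longleftrightarrow> x \<in> carrier R \<and> (\<exists>n. \<exists>y\<in>poly_values B x n. x [^] n \<oplus> y = \<zero>)"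

lemma poly_values_SucI: "\<lbrakk>b \<in> B; y \<in> poly_values B x n; z = b \<oplus> x \<otimes> y\<rbrakk> \<Longrightarrow> z \<in> poly_values B x (Suc n)"
  by auto

lemma poly_values_closed: "\<lbrakk>B \<subseteq> carrier R; x \<in> carrier R\<rbrakk> \<Longrightarrow> poly_values B x n \<subseteq> carrier R"
  by (induction n) auto

lemma poly_values_carrier: "\<lbrakk>B \<subseteq> carrier R; x \<in> carrier R; y \<in> poly_values B x n\<rbrakk> \<Longrightarrow> y \<in> carrier R"
  using poly_values_closed by blast

lemma poly_values_mono_set: "B \<subseteq> C \<Longrightarrow> poly_values B x n \<subseteq> poly_values C x n"
  by (induction n) auto

lemma poly_values_zero:
  assumes "\<zero> \<in> B" "x \<in> carrier R" shows "\<zero> \<in> poly_values B x n"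
proof (induction n)
  case (Suc n)
  then show ?case using assms by (intro poly_values_SucI[of \<zero> _ \<zero>]) auto
qed auto

lemma poly_values_mono:
  assumes "\<zero> \<in> B" "x \<in> carrier R" "n \<le> k" shows "poly_values B x n \<subseteq> poly_values B x k"
  using \<open>n \<le> k\<close>
proof (induction n arbitrary: k)
  case (Suc n)
  then obtain k' where "k = Suc k'" "n \<le> k'" by (cases k) auto
  then show ?case using Suc.IH by fastforce
qed (use assms poly_values_zero in auto)

lemma poly_values_const:
  assumes "\<zero> \<in> B" "x \<in> carrier R" "B \<subseteq> carrier R" "b \<in> B" shows "b \<in> poly_values B x (Suc n)"
proof -
  show ?thesis using poly_values_zero[of B x n] assms by (intro poly_values_SucI[of b _ \<zero>]) auto
qed

lemma poly_values_shift:
  assumes "\<zero> \<in> B" "x \<in> carrier R" "B \<subseteq> carrier R" "y \<in> poly_values B x n"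
  shows "x \<otimes> y \<in> poly_values B x (Suc n)"
proof -
  have "x \<otimes> y = \<zero> \<oplus> x \<otimes> y" using assms poly_values_carrier[of B x y n] by auto
  then show ?thesis using assms by auto
qed

lemma poly_values_shift_pow:
  assumes "\<zero> \<in> B" "x \<in> carrier R" "B \<subseteq> carrier R" "y \<in> poly_values B x n"
  shows "x [^] (k::nat) \<otimes> y \<in> poly_values B x (k + n)"
proof (induction k)
  case 0
  then show ?case using assms poly_values_carrier[of B x y n] by auto
next
  case (Suc k)
  have "x [^] Suc k \<otimes> y = x \<otimes> (x [^] k \<otimes> y)" using assms poly_values_carrier[of B x y n]
    by (simp add: m_ac)
  then show ?case using poly_values_shift[OF assms(1-3) Suc] by simp
qed

lemma poly_values_add:
  assumes B: "B \<subseteq> carrier R" and "\<And>a b. \<lbrakk>a \<in> B; b \<in> B\<rbrakk> \<Longrightarrow> a \<oplus> b \<in> B" "x \<in> carrier R"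
    "y \<in> poly_values B x n" "z \<in> poly_values B x n"
  shows "y \<oplus> z \<in> poly_values B x n"
  using assms(4,5)
proof (induction n arbitrary: y z)
  case (Suc n)
  then obtain a b y' z' where *: "y = a \<oplus> x \<otimes> y'" "z = b \<oplus> x \<otimes> z'" "a \<in> B" "b \<in> B"
    "y' \<in> poly_values B x n" "z' \<in> poly_values B x n" by auto
  then have "a \<in> carrier R" "b \<in> carrier R" "y' \<in> carrier R" "z' \<in> carrier R"
    using B poly_values_carrier[OF B \<open>x \<in> carrier R\<close>] by auto
  then have "y \<oplus> z = (a \<oplus> b) \<oplus> x \<otimes> (y' \<oplus> z')"
    unfolding *(1,2) using \<open>x \<in> carrier R\<close> by algebra
  then show ?case using * Suc.IH assms(2)
    by (intro poly_values_SucI[of "a \<oplus> b" _ "y' \<oplus> z'"]) auto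
qed auto

lemma poly_values_scale:
  assumes B: "B \<subseteq> carrier R" "C \<subseteq> carrier R" and "\<And>b. b \<in> B \<Longrightarrow> c \<otimes> b \<in> C" "x \<in> carrier R"
    "c \<in> carrier R" "y \<in> poly_values B x n"
  shows "c \<otimes> y \<in> poly_values C x n"
  using assms(6)
proof (induction n arbitrary: y)
  case (Suc n)
  then obtain b y' where *: "y = b \<oplus> x \<otimes> y'" "b \<in> B" "y' \<in> poly_values B x n" by auto
  then have "b \<in> carrier R" "y' \<in> carrier R"
    using B poly_values_carrier[OF B(1) \<open>x \<in> carrier R\<close>] by auto
  then have "c \<otimes> y = (c \<otimes> b) \<oplus> x \<otimes> (c \<otimes> y')"
    unfolding *(1) using \<open>x \<in> carrier R\<close> \<open>c \<in> carrier R\<close> by algebra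
  then show ?case using * Suc.IH assms(3)
    by (intro poly_values_SucI[of "c \<otimes> b" _ "c \<otimes> y'"]) auto
qed (use assms in auto)

lemma poly_values_mult:
  assumes E: "E \<subseteq> carrier R" "\<zero> \<in> E" and B: "B \<subseteq> carrier R" and x: "x \<in> carrier R"
    and add: "\<And>a b. \<lbrakk>a \<in> E; b \<in> E\<rbrakk> \<Longrightarrow> a \<oplus> b \<in> E"
    and mult: "\<And>b a. \<lbrakk>b \<in> B; a \<in> E\<rbrakk> \<Longrightarrow> b \<otimes> a \<in> E"
    and y: "y \<in> poly_values B x n" and z: "z \<in> poly_values E x k"
  shows "y \<otimes> z \<in> poly_values E x (n + k)"
  using y
proof (induction n arbitrary: y)
  case 0
  then show ?case using poly_values_zero[OF E(2) x] poly_values_carrier[OF E(1) x z] by auto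
next
  case (Suc n)
  then obtain b y' where *: "y = b \<oplus> x \<otimes> y'" "b \<in> B" "y' \<in> poly_values B x n" by auto
  then have c: "b \<in> carrier R" "y' \<in> carrier R" "z \<in> carrier R"
    using B poly_values_carrier[OF B x] poly_values_carrier[OF E(1) x z] by auto
  have "b \<otimes> z \<in> poly_values E x k" using poly_values_scale[OF E(1) E(1) _ x c(1) z] mult * by auto
  then have "b \<otimes> z \<in> poly_values E x (Suc n + k)" using poly_values_mono[OF E(2) x, of k "Suc n + k"] by auto
  moreover have "x \<otimes> (y' \<otimes> z) \<in> poly_values E x (Suc n + k)"
    using poly_values_shift[OF E(2) x E(1) Suc.IH[OF *(3)]] by simp
  moreover have "y \<otimes> z = b \<otimes> z \<oplus> x \<otimes> (y' \<otimes> z)" unfolding *(1) using c x by algebra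
  ultimately show ?case using poly_values_add[OF E(1) add x, of "b \<otimes> z" "Suc n + k"] by metis
qed

text \<open>Horner's recursion exposes the constant coefficient; reduction by a monic equation needs
  the leading one.\<close>

lemma poly_values_top:
  assumes B: "B \<subseteq> carrier R" "\<zero> \<in> B" and x: "x \<in> carrier R" and y: "y \<in> poly_values B x (Suc n)"
  shows "\<exists>z\<in>poly_values B x n. \<exists>b\<in>B. y = z \<oplus> b \<otimes> x [^] n"
  using y
proof (induction n arbitrary: y)
  case 0
  then obtain b where "y = b \<oplus> x \<otimes> \<zero>" "b \<in> B" by auto
  moreover from this have "y = \<zero> \<oplus> b \<otimes> x [^] (0::nat)" using B x by auto
  ultimately show ?case unfolding poly_values.simps(1) by blast
next
  case (Suc n)
  then obtain b y' where *: "y = b \<oplus> x \<otimes> y'" "b \<in> B" "y' \<in> poly_values B x (Suc n)"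
    by (auto simp del: poly_values.simps(2) simp: poly_values.simps(2)[of _ _ "Suc n"])
  then obtain z c where zc: "z \<in> poly_values B x n" "c \<in> B" "y' = z \<oplus> c \<otimes> x [^] n" using Suc.IH by blast
  then have c: "b \<in> carrier R" "z \<in> carrier R" "c \<in> carrier R" "x [^] n \<in> carrier R"
    using * B poly_values_carrier[OF B(1) x] x by auto
  have "y = (b \<oplus> x \<otimes> z) \<oplus> c \<otimes> (x [^] n \<otimes> x)" unfolding *(1) zc(3) using c x by algebra
  then show ?case using * zc by (intro bexI[of _ "b \<oplus> x \<otimes> z"] bexI[of _ c] poly_values_SucI) auto
qed

lemma subring_cl:
  assumes "subring B R"
  shows "B \<subseteq> carrier R" "\<zero> \<in> B" "\<one> \<in> B" "\<And>a b. \<lbrakk>a \<in> B; b \<in> B\<rbrakk> \<Longrightarrow> a \<oplus> b \<in> B"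
    "\<And>a b. \<lbrakk>a \<in> B; b \<in> B\<rbrakk> \<Longrightarrow> a \<otimes> b \<in> B" "\<And>a. a \<in> B \<Longrightarrow> \<ominus> a \<in> B"
    "\<And>a b. \<lbrakk>a \<in> B; b \<in> B\<rbrakk> \<Longrightarrow> a \<ominus> b \<in> B"
  using subringE[OF assms] by (auto simp: a_minus_def)

lemma poly_values_minus:
  assumes "subring B R" "x \<in> carrier R" "y \<in> poly_values B x n"
  shows "\<ominus> y \<in> poly_values B x n"
proof -
  note s = subring_cl[OF assms(1)]
  have "\<ominus> \<one> \<otimes> y \<in> poly_values B x n"
    using s assms by (intro poly_values_scale[of B B]) auto
  then show ?thesis using poly_values_carrier[OF s(1) assms(2,3)] by (simp add: l_minus)
qed

text \<open>Division with remainder by the monic equation of \<open>x\<close>, for coefficients in a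
  \<open>C\<close>-module \<open>E\<close>. The case \<open>E = C\<close> makes \<open>C[x]\<close>
  finite over \<open>C\<close>; the case of a kernel is used for lying over. The equation is first
  multiplied by \<open>x\<close>, so that the bound is \<open>Suc n\<close> and constants are
  covered without treating \<open>n = 0\<close> separately.\<close>

lemma poly_values_reduce:
  assumes C: "subring C R" and E: "E \<subseteq> carrier R" "\<zero> \<in> E"
    and add: "\<And>a b. \<lbrakk>a \<in> E; b \<in> E\<rbrakk> \<Longrightarrow> a \<oplus> b \<in> E"
    and mult: "\<And>a b. \<lbrakk>a \<in> E; b \<in> C\<rbrakk> \<Longrightarrow> a \<otimes> b \<in> E"
    and x: "x \<in> carrier R" and y: "y \<in> poly_values C x n" "x [^] n \<oplus> y = \<zero>"
  shows "poly_values E x k \<subseteq> poly_values E x (Suc n)"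
proof (induction k)
  case 0
  then show ?case using poly_values_zero E x by (auto simp del: poly_values.simps(2))
next
  case (Suc k)
  note sC = subring_cl[OF C]
  have yc: "y \<in> carrier R" using poly_values_carrier[OF sC(1) x y(1)] .
  have top: "x [^] Suc n = \<ominus> (x \<otimes> y)"
  proof -
    have p: "x [^] n \<in> carrier R" using x by auto
    have "x [^] Suc n = x \<otimes> (x [^] n \<oplus> y) \<ominus> x \<otimes> y" unfolding nat_pow_Suc using p x yc by algebra
    also have "\<dots> = \<ominus> (x \<otimes> y)" unfolding y(2) using x yc by algebra
    finally show ?thesis .
  qed
  have "x [^] Suc n \<in> poly_values C x (Suc n)"
    unfolding top using poly_values_minus[OF C x poly_values_shift[OF sC(2) x sC(1) y(1)]] .
  then have scale: "b \<otimes> x [^] Suc n \<in> poly_values E x (Suc n)" if "b \<in> E" for b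
    using poly_values_scale[of C E b x] sC E mult that x by (auto simp del: poly_values.simps(2))
  show ?case
  proof
    fix z assume "z \<in> poly_values E x (Suc k)"
    then obtain c z' where z: "z = c \<oplus> x \<otimes> z'" "c \<in> E" "z' \<in> poly_values E x k" by auto
    then have "x \<otimes> z' \<in> poly_values E x (Suc (Suc n))"
      using Suc by (intro poly_values_shift E x) auto
    then obtain w b where w: "w \<in> poly_values E x (Suc n)" "b \<in> E" "x \<otimes> z' = w \<oplus> b \<otimes> x [^] Suc n"
      using poly_values_top[OF E x] by blast
    then have "x \<otimes> z' \<in> poly_values E x (Suc n)"
      using poly_values_add[OF E(1) add x w(1) scale[OF w(2)]] by simp
    moreover have "c \<in> poly_values E x (Suc n)" using poly_values_const[OF E(2) x E(1) z(2)] .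
    ultimately show "z \<in> poly_values E x (Suc n)"
      unfolding z(1) using poly_values_add[OF E(1) add x, of c "Suc n" "x \<otimes> z'"] by simp
  qed
qed

lemma poly_values_subset_lin_span:
  assumes "B \<subseteq> carrier R" "x \<in> carrier R"
  shows "poly_values B x n \<subseteq> lin_span B (map (\<lambda>i. x [^] i) [0..<n])"
proof (induction n)
  case (Suc n)
  have e: "map (\<lambda>i. x [^] i) [0..<Suc n] = \<one> # map ((\<otimes>) x) (map (\<lambda>i. x [^] i) [0..<n])"
    using assms(2) by (simp add: map_upt_Suc m_comm del: upt_Suc)
  show ?case
  proof
    fix z assume "z \<in> poly_values B x (Suc n)"
    then obtain c z' where z: "z = c \<oplus> x \<otimes> z'" "c \<in> B" "z' \<in> poly_values B x n" by auto
    then have "x \<otimes> z' \<in> lin_span B (map ((\<otimes>) x) (map (\<lambda>i. x [^] i) [0..<n]))"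
      using Suc assms by (intro lin_span_mult) auto
    moreover have "z = c \<otimes> \<one> \<oplus> x \<otimes> z'" using z assms by auto
    ultimately show "z \<in> lin_span B (map (\<lambda>i. x [^] i) [0..<Suc n])" unfolding e using z(2) by auto
  qed
qed auto

text \<open>Bridge to polynomials: the left side suits inductions, the right side is what evaluation
  in \<open>UP\<close> produces.\<close>

lemma poly_values_iff_finsum:
  assumes "B \<subseteq> carrier R" "x \<in> carrier R"
  shows "y \<in> poly_values B x n \<longleftrightarrow> (\<exists>c. (\<forall>i<n. c i \<in> B) \<and> y = (\<Oplus>i\<in>{..<n}. c i \<otimes> x [^] i))"
proof
  assume "y \<in> poly_values B x n"
  then have "y \<in> lin_span B (map (\<lambda>i. x [^] i) [0..<n])" using poly_values_subset_lin_span assms by blast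
  then obtain c where c: "\<forall>i<n. c i \<in> B" "y = (\<Oplus>i\<in>{..<n}. c i \<otimes> map (\<lambda>i. x [^] i) [0..<n] ! i)"
    using lin_span_coeffs[of B "map (\<lambda>i. x [^] i) [0..<n]" y] assms by auto
  moreover have "(\<Oplus>i\<in>{..<n}. c i \<otimes> map (\<lambda>i. x [^] i) [0..<n] ! i) = (\<Oplus>i\<in>{..<n}. c i \<otimes> x [^] i)"
    using c(1) assms by (intro finsum_cong') (auto simp: subset_iff)
  ultimately show "\<exists>c. (\<forall>i<n. c i \<in> B) \<and> y = (\<Oplus>i\<in>{..<n}. c i \<otimes> x [^] i)" by metis
next
  assume "\<exists>c. (\<forall>i<n. c i \<in> B) \<and> y = (\<Oplus>i\<in>{..<n}. c i \<otimes> x [^] i)"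
  then obtain c where "\<forall>i<n. c i \<in> B" "y = (\<Oplus>i\<in>{..<n}. c i \<otimes> x [^] i)" by auto
  then show "y \<in> poly_values B x n"
  proof (induction n arbitrary: c y)
    case (Suc n)
    have c: "c i \<otimes> x [^] i \<in> carrier R" if "i \<le> n" for i using Suc.prems assms that by (auto simp: subset_iff)
    have "y = c 0 \<oplus> x \<otimes> (\<Oplus>i\<in>{..<n}. c (Suc i) \<otimes> x [^] i)"
    proof (cases n)
      case 0
      have "y = (\<Oplus>i\<in>{..0}. c i \<otimes> x [^] i)" using Suc.prems(2) 0 by (simp add: lessThan_Suc_atMost)
      also have "\<dots> = c 0 \<otimes> x [^] (0::nat)" 
        by (rule finsum_0) (use Suc.prems(1) assms in \<open>simp add: Pi_def subset_iff\<close>)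
      finally show ?thesis using 0 c[of 0] Suc.prems assms by auto
    next
      case m: (Suc m)
      have cs: "c (Suc i) \<in> carrier R" if "i \<le> m" for i using Suc.prems(1) m assms that by (auto simp: subset_iff)
      have "y = (\<Oplus>i\<in>{..Suc m}. c i \<otimes> x [^] i)" using Suc.prems(2) m by (simp add: lessThan_Suc_atMost)
      also have "\<dots> = (\<Oplus>i\<in>{..m}. c (Suc i) \<otimes> x [^] Suc i) \<oplus> c 0 \<otimes> x [^] (0::nat)"
        by (rule finsum_Suc2) (use c m in auto)
      also have "(\<Oplus>i\<in>{..m}. c (Suc i) \<otimes> x [^] Suc i) = (\<Oplus>i\<in>{..m}. x \<otimes> (c (Suc i) \<otimes> x [^] i))"
        using cs assms by (intro finsum_cong') (auto simp: m_ac)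
      also have "\<dots> = x \<otimes> (\<Oplus>i\<in>{..m}. c (Suc i) \<otimes> x [^] i)"
        using cs assms by (intro finsum_rdistr[symmetric]) auto
      also have "c 0 \<otimes> x [^] (0::nat) = c 0" using Suc.prems(1) assms by auto
      moreover have "(\<Oplus>i\<in>{..m}. c (Suc i) \<otimes> x [^] i) \<in> carrier R" using cs assms by auto
      ultimately show ?thesis using m assms Suc.prems(1) by (auto simp: lessThan_Suc_atMost a_comm subset_iff)
    qed
    then show ?case using Suc by (intro poly_values_SucI[of "c 0"]) auto
  qed auto
qed

section \<open>Finite extensions and transitivity of integrality\<close>

text \<open>Finite generation as a module, with \<open>\<one>\<close> forced to be generator 0: an
  element that annihilates generator 0, as provided by \<open>elimination\<close>, is then itself
  zero.\<close>

definition finite_over :: "'a set \<Rightarrow> 'a set \<Rightarrow> bool" where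
  "finite_over B C \<longleftrightarrow> (\<exists>gs. set gs \<subseteq> C \<and> C \<subseteq> lin_span B (\<one> # gs))"

lemma finite_over_refl:
  assumes "subring B R" shows "finite_over B B"
proof -
  note s = subring_cl[OF assms]
  have "b \<in> lin_span B [\<one>]" if "b \<in> B" for b
  proof -
    have "b = b \<otimes> \<one> \<oplus> \<zero>" using s that by auto
    then show ?thesis using that by auto
  qed
  then show ?thesis unfolding finite_over_def by (intro exI[of _ "[]"]) auto
qed

text \<open>
  Integrality of finite extensions is the case where \<open>D k\<close> consists of the values of monic
  polynomials of degree \<open>k\<close>; lying over is the case where \<open>D k\<close> is the complement of a prime ideal.
\<close>

lemma annihilator_of_lin_span:
  fixes D L :: "nat \<Rightarrow> 'a set"
  assumes s: "set gs \<subseteq> carrier R" and x: "x \<in> carrier R"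
    and D: "\<And>k. D k \<subseteq> carrier R" and L: "\<And>k. L k \<subseteq> carrier R"
    and DL: "\<And>k d d' l l'. \<lbrakk>d \<in> D k; d' \<in> D k; l \<in> L k; l' \<in> L k\<rbrakk> \<Longrightarrow> d \<otimes> d' \<ominus> l \<otimes> l' \<in> D (2 * k)"
    and LL: "\<And>k d l l' l''. \<lbrakk>d \<in> D k; l \<in> L k; l' \<in> L k; l'' \<in> L k\<rbrakk> \<Longrightarrow> d \<otimes> l \<ominus> l' \<otimes> l'' \<in> L (2 * k)"
    and E: "E \<subseteq> carrier R" and DE: "\<And>a. a \<in> E \<Longrightarrow> x \<ominus> a \<in> D 1" and LE: "\<And>a. a \<in> E \<Longrightarrow> \<ominus> a \<in> L 1"
    and stable: "\<And>g. g \<in> set (\<one> # gs) \<Longrightarrow> x \<otimes> g \<in> lin_span E (\<one> # gs)"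
  shows "\<exists>k. \<zero> \<in> D k"
proof -
  define N where "N = length gs"
  define m where "m j = (\<one> # gs) ! j" for j
  have e: "{..<length (\<one> # gs)} = {..N}" by (auto simp: N_def)
  have m: "m j \<in> set (\<one> # gs)" if "j \<le> N" for j
    unfolding m_def using that by (intro nth_mem) (auto simp: N_def)
  then have mc: "m j \<in> carrier R" if "j \<le> N" for j using s that by fastforce
  have row: "\<exists>a. (\<forall>j\<le>N. a j \<in> E) \<and> x \<otimes> m i = (\<Oplus>j\<in>{..N}. a j \<otimes> m j)" if i: "i \<le> N" for i
  proof -
    have "set (\<one> # gs) \<subseteq> carrier R" using s by simp
    from lin_span_coeffs[OF E this stable[OF m[OF i]]]
    obtain a where a: "\<forall>j<length (\<one> # gs). a j \<in> E"
      "x \<otimes> m i = (\<Oplus>j\<in>{..<length (\<one> # gs)}. a j \<otimes> (\<one> # gs) ! j)"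
      by blast
    have "\<forall>j\<le>N. a j \<in> E" using a(1) by (simp add: N_def)
    then show ?thesis using a(2) unfolding e m_def[symmetric] by blast
  qed
  define a where "a i = (SOME a. (\<forall>j\<le>N. a j \<in> E) \<and> x \<otimes> m i = (\<Oplus>j\<in>{..N}. a j \<otimes> m j))" for i
  have aE: "a i j \<in> E" if "i \<le> N" "j \<le> N" for i j
    using someI_ex[OF row[OF that(1)]] that(2) unfolding a_def by blast
  have am: "x \<otimes> m i = (\<Oplus>j\<in>{..N}. a i j \<otimes> m j)" if "i \<le> N" for i
    using someI_ex[OF row[OF that]] unfolding a_def by blast
  have ac: "a i j \<in> carrier R" if "i \<le> N" "j \<le> N" for i j using aE that E by auto
  \<comment> \<open>The matrix of \<open>x\<close> minus \<open>a\<close>. It kills the vector of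
    generators, since \<open>x\<close> times generator \<open>i\<close> is row \<open>i\<close> of
    \<open>a\<close> applied to them.\<close>
  define b where "b i j = (if i = j then x \<ominus> a i j else \<ominus> a i j)" for i j
  have "(\<Oplus>j\<in>{..N}. b i j \<otimes> m j) = \<zero>" if i: "i \<le> N" for i
  proof -
    have "(\<Oplus>j\<in>{..N}. b i j \<otimes> m j)
        = (\<Oplus>j\<in>{..N}. (if i = j then x \<otimes> m j else \<zero>) \<oplus> (\<ominus> \<one>) \<otimes> (a i j \<otimes> m j))"
    proof (intro finsum_cong')
      fix j assume "j \<in> {..N}"
      then have c: "a i j \<in> carrier R" "m j \<in> carrier R" using ac[OF i] mc by auto
      show "b i j \<otimes> m j = (if i = j then x \<otimes> m j else \<zero>) \<oplus> (\<ominus> \<one>) \<otimes> (a i j \<otimes> m j)"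
      proof (cases "i = j")
        case True
        have "(x \<ominus> a i j) \<otimes> m j = x \<otimes> m j \<oplus> (\<ominus> \<one>) \<otimes> (a i j \<otimes> m j)" using c x by algebra
        then show ?thesis using True by (simp add: b_def)
      next
        case False
        have "\<ominus> a i j \<otimes> m j = \<zero> \<oplus> (\<ominus> \<one>) \<otimes> (a i j \<otimes> m j)" using c x by algebra
        then show ?thesis using False by (simp add: b_def)
      qed
    qed (use x mc ac[OF i] in auto)
    also have "\<dots> = (\<Oplus>j\<in>{..N}. (if i = j then x \<otimes> m j else \<zero>)) \<oplus> (\<Oplus>j\<in>{..N}. (\<ominus> \<one>) \<otimes> (a i j \<otimes> m j))"
      by (rule finsum_addf) (use x mc ac[OF i] in auto)
    also have "(\<Oplus>j\<in>{..N}. (if i = j then x \<otimes> m j else \<zero>)) = x \<otimes> m i"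
      by (rule finsum_singleton) (use i x mc in auto)
    also have "(\<Oplus>j\<in>{..N}. (\<ominus> \<one>) \<otimes> (a i j \<otimes> m j)) = (\<ominus> \<one>) \<otimes> (x \<otimes> m i)"
      unfolding am[OF i] by (rule finsum_rdistr[symmetric]) (use mc ac[OF i] in auto)
    also have "x \<otimes> m i \<oplus> (\<ominus> \<one>) \<otimes> (x \<otimes> m i) = \<zero>" using x mc[OF i] by algebra
    finally show ?thesis .
  qed
  moreover have "b i i \<in> D 1" if "i \<le> N" for i unfolding b_def using DE aE that by auto
  moreover have "b i j \<in> L 1" if "i \<le> N" "j \<le> N" "i \<noteq> j" for i j unfolding b_def using LE aE that by auto
  ultimately obtain k d where "d \<in> D k" "d \<otimes> m 0 = \<zero>"
    using elimination[where D = D and L = L and m = m and N = N and b = b and k = 1, OF D L DL LL mc]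
    by blast
  moreover have "m 0 = \<one>" by (simp add: m_def)
  moreover from \<open>d \<in> D k\<close> have "d \<in> carrier R" using D by blast
  ultimately have "\<zero> \<in> D k" by simp
  then show ?thesis by blast
qed

lemma finite_over_imp_integral:
  assumes B: "subring B R" and C: "subring C R" and fin: "finite_over B C" and x: "x \<in> C"
  shows "integral_over B x"
proof -
  note sB = subring_cl[OF B] and sC = subring_cl[OF C]
  have xc: "x \<in> carrier R" using x sC by auto
  obtain gs where gs: "set gs \<subseteq> C" "C \<subseteq> lin_span B (\<one> # gs)" using fin unfolding finite_over_def by blast
  define L where "L k = poly_values B x k" for k
  \<comment> \<open>With this choice \<open>\<zero> \<in> D k\<close> is exactly a monic equation of
    degree \<open>k\<close> for \<open>x\<close> over \<open>B\<close>; products of two members of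
    \<open>L k\<close> have too low a degree to disturb the leading term
    \<open>x [^] (2 * k)\<close>.\<close>
  define D where "D k = {x [^] k \<oplus> y | y. y \<in> L k}" for k
  have Lc: "L k \<subseteq> carrier R" for k unfolding L_def using poly_values_closed sB xc by auto
  have Dc: "D k \<subseteq> carrier R" for k unfolding D_def using Lc xc by auto
  have Ladd: "y \<oplus> z \<in> L k" if "y \<in> L k" "z \<in> L k" for y z k
    using that poly_values_add[OF sB(1) sB(4) xc] unfolding L_def by simp
  have Lneg: "\<ominus> y \<in> L k" if "y \<in> L k" for y k
    using that poly_values_minus[OF B xc] unfolding L_def by simp
  have Lsub: "y \<ominus> z \<in> L k" if "y \<in> L k" "z \<in> L k" for y z k
    using that Ladd Lneg unfolding a_minus_def by auto
  have Lmult: "y \<otimes> z \<in> L (2 * k)" if "y \<in> L k" "z \<in> L k" for y z k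
    using poly_values_mult[OF sB(1,2,1) xc sB(4,5), of y k z k] that unfolding L_def by (simp add: mult_2)
  have Lpow: "x [^] k \<otimes> y \<in> L (2 * k)" if "y \<in> L k" for y k
    using poly_values_shift_pow[OF sB(2) xc sB(1), of y k k] that unfolding L_def by (simp add: mult_2)
  have "\<exists>k. \<zero> \<in> D k"
  proof (rule annihilator_of_lin_span[where gs = gs and x = x and L = L and E = B])
    show "set gs \<subseteq> carrier R" using gs sC by auto
  next
    fix k d d' l l' assume h: "d \<in> D k" "d' \<in> D k" "l \<in> L k" "l' \<in> L k"
    then obtain y y' where y: "d = x [^] k \<oplus> y" "d' = x [^] k \<oplus> y'" "y \<in> L k" "y' \<in> L k"
      unfolding D_def by auto
    have c: "x [^] k \<in> carrier R" "y \<in> carrier R" "y' \<in> carrier R" "l \<in> carrier R" "l' \<in> carrier R"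
      using h y Lc xc by auto
    have "d \<otimes> d' \<ominus> l \<otimes> l' = x [^] k \<otimes> x [^] k \<oplus> (x [^] k \<otimes> y \<oplus> (x [^] k \<otimes> y' \<oplus> (y \<otimes> y' \<ominus> l \<otimes> l')))"
      unfolding y(1,2) using c by algebra
    also have "x [^] k \<otimes> x [^] k = x [^] (2 * k)" using xc by (simp add: nat_pow_mult mult_2)
    finally have "d \<otimes> d' \<ominus> l \<otimes> l' = x [^] (2 * k) \<oplus> (x [^] k \<otimes> y \<oplus> (x [^] k \<otimes> y' \<oplus> (y \<otimes> y' \<ominus> l \<otimes> l')))" .
    moreover have "x [^] k \<otimes> y \<oplus> (x [^] k \<otimes> y' \<oplus> (y \<otimes> y' \<ominus> l \<otimes> l')) \<in> L (2 * k)"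
      by (intro Ladd Lpow Lsub Lmult h y)
    ultimately show "d \<otimes> d' \<ominus> l \<otimes> l' \<in> D (2 * k)" unfolding D_def by blast
  next
    fix k d l l' l'' assume h: "d \<in> D k" "l \<in> L k" "l' \<in> L k" "l'' \<in> L k"
    then obtain y where y: "d = x [^] k \<oplus> y" "y \<in> L k" unfolding D_def by auto
    have c: "x [^] k \<in> carrier R" "y \<in> carrier R" "l \<in> carrier R" "l' \<in> carrier R" "l'' \<in> carrier R"
      using h y Lc xc by auto
    have "d \<otimes> l \<ominus> l' \<otimes> l'' = x [^] k \<otimes> l \<oplus> (y \<otimes> l \<ominus> l' \<otimes> l'')"
      unfolding y(1) using c by algebra
    moreover have "x [^] k \<otimes> l \<oplus> (y \<otimes> l \<ominus> l' \<otimes> l'') \<in> L (2 * k)"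
      by (intro Ladd Lpow Lsub Lmult h y)
    ultimately show "d \<otimes> l \<ominus> l' \<otimes> l'' \<in> L (2 * k)" by simp
  next
    fix a assume a: "a \<in> B"
    have L1: "b \<in> L 1" if "b \<in> B" for b
      unfolding L_def One_nat_def using sB xc that by (intro poly_values_const) auto
    then show "\<ominus> a \<in> L 1" using sB a by auto
    then show "x \<ominus> a \<in> D 1" unfolding D_def a_minus_def using xc by (auto intro!: exI[of _ "\<ominus> a"])
  next
    fix g assume "g \<in> set (\<one> # gs)"
    then have "g \<in> C" using gs sC by auto
    then show "x \<otimes> g \<in> lin_span B (\<one> # gs)" using gs(2) sC(5)[OF x] by blast
  qed (use xc Dc Lc sB in auto)
  then show ?thesis unfolding integral_over_def D_def L_def using xc by fastforce
qed

lemma integral_over_mono: "\<lbrakk>B \<subseteq> C; integral_over B x\<rbrakk> \<Longrightarrow> integral_over C x"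
  unfolding integral_over_def using poly_values_mono_set by blast

text \<open>The ring \<open>C'\<close> is \<open>C[x]\<close>: by the monic equation, values of
  degree at most \<open>n\<close> are all the values there are. Generators over \<open>B\<close> are
  collected by induction on the degree, which takes the place of the tower law for finite
  modules.\<close>

lemma adjoin_integral:
  assumes B: "subring B R" and C: "subring C R" and BC: "B \<subseteq> C"
    and fin: "finite_over B C" and x: "integral_over C x"
  shows "\<exists>C'. subring C' R \<and> C \<subseteq> C' \<and> x \<in> C' \<and> finite_over B C'"
proof -
  note sB = subring_cl[OF B] and sC = subring_cl[OF C]
  obtain n y where xc: "x \<in> carrier R" and y: "y \<in> poly_values C x n" "x [^] n \<oplus> y = \<zero>"
    using x unfolding integral_over_def by auto
  define C' where "C' = poly_values C x (Suc n)"
  note pv = sC(1) xc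
  have C'c: "C' \<subseteq> carrier R" unfolding C'_def using poly_values_closed[OF pv, of "Suc n"] .
  have add: "a \<oplus> b \<in> C'" if "a \<in> C'" "b \<in> C'" for a b
    unfolding C'_def by (rule poly_values_add[OF sC(1) sC(4) xc that[unfolded C'_def]])
  have shrink: "poly_values C x k \<subseteq> C'" for k
    unfolding C'_def by (rule poly_values_reduce[OF C sC(1,2) _ _ xc y]) (use sC in auto)
  have mult: "a \<otimes> b \<in> C'" if "a \<in> C'" "b \<in> C'" for a b
    by (rule subsetD[OF shrink poly_values_mult[OF sC(1,2,1) xc sC(4,5) that[unfolded C'_def]]])
  have CC': "C \<subseteq> C'" unfolding C'_def by (rule subsetI, rule poly_values_const[OF sC(2) xc sC(1)])
  have sub: "subring C' R"
  proof (rule subringI)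
    show "\<ominus> h \<in> C'" if "h \<in> C'" for h
      unfolding C'_def by (rule poly_values_minus[OF C xc that[unfolded C'_def]])
    show "\<one> \<in> C'" using sC(3) CC' by blast
  qed (fact C'c mult add)+
  have "x = x \<otimes> \<one>" using xc by simp
  also have "\<dots> \<in> poly_values C x (Suc (Suc 0))"
    using poly_values_shift[OF sC(2) xc sC(1) poly_values_const[OF sC(2) xc sC(1) sC(3)]] .
  finally have xC': "x \<in> C'" using shrink by blast
  obtain gs where gs: "set gs \<subseteq> C" "C \<subseteq> lin_span B (\<one> # gs)" using fin unfolding finite_over_def by blast
  \<comment> \<open>Horner's scheme on generators: if \<open>\<one> # hs\<close> spans the values
    with \<open>k\<close> coefficients, then the generators of \<open>C\<close> together with
    \<open>x\<close> times \<open>\<one> # hs\<close> span those with one coefficient more.\<close>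
  have "\<exists>hs. set hs \<subseteq> C' \<and> poly_values C x k \<subseteq> lin_span B (\<one> # hs)" for k
  proof (induction k)
    case 0
    have "\<zero> \<in> lin_span B [\<one>]" using sB by (intro lin_span_zero) auto
    then have "poly_values C x 0 \<subseteq> lin_span B [\<one>]" by (simp del: lin_span.simps)
    then show ?case by (intro exI[of _ "[]"]) (simp del: lin_span.simps)
  next
    case (Suc k)
    then obtain hs where hs: "set hs \<subseteq> C'" "poly_values C x k \<subseteq> lin_span B (\<one> # hs)" by blast
    have hsc: "set (\<one> # hs) \<subseteq> carrier R" "set (\<one> # gs) \<subseteq> carrier R" using hs(1) gs(1) C'c sC by auto
    then have xhs: "set (map ((\<otimes>) x) (\<one> # hs)) \<subseteq> carrier R" using xc by auto
    let ?hs = "gs @ map ((\<otimes>) x) (\<one> # hs)"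
    have "x \<otimes> h \<in> C'" if "h \<in> set (\<one> # hs)" for h using that hs(1) mult[OF xC'] CC' sC(3) by auto
    then have "set ?hs \<subseteq> C'" using gs(1) CC' by auto
    moreover have "poly_values C x (Suc k) \<subseteq> lin_span B (\<one> # ?hs)"
    proof
      fix z assume "z \<in> poly_values C x (Suc k)"
      then obtain c z' where z: "z = c \<oplus> x \<otimes> z'" "c \<in> C" "z' \<in> poly_values C x k" by auto
      have "z' \<in> lin_span B (\<one> # hs)" using z(3) hs(2) by blast
      then have "x \<otimes> z' \<in> lin_span B (map ((\<otimes>) x) (\<one> # hs))"
        by (rule lin_span_mult[OF sB(1) hsc(1) xc])
      moreover have "c \<in> lin_span B (\<one> # gs)" using z(2) gs(2) by blast
      ultimately have "z \<in> lin_span B ((\<one> # gs) @ map ((\<otimes>) x) (\<one> # hs))"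
        unfolding z(1) using lin_span_append[OF sB(1) hsc(2) xhs] by blast
      then show "z \<in> lin_span B (\<one> # ?hs)" by (simp del: lin_span.simps)
    qed
    ultimately show ?case by blast
  qed
  then have "finite_over B C'" unfolding finite_over_def C'_def by blast
  then show ?thesis using sub CC' xC' by (intro exI[of _ C'] conjI)
qed

text \<open>Only the finitely many coefficients of \<open>y\<close> matter. They are adjoined one at
  a time, so \<open>E\<close> can be any set of integral elements.\<close>

lemma finite_subring_of_values:
  assumes B: "subring B R" and E: "\<And>e. e \<in> E \<Longrightarrow> integral_over B e" and x: "x \<in> carrier R"
    and y: "y \<in> poly_values E x n"
  shows "\<exists>C. subring C R \<and> B \<subseteq> C \<and> finite_over B C \<and> y \<in> poly_values C x n"
  using y
proof (induction n arbitrary: y)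
  case 0
  then show ?case using B finite_over_refl by auto
next
  case (Suc n)
  then obtain e y' where y: "y = e \<oplus> x \<otimes> y'" "e \<in> E" "y' \<in> poly_values E x n" by auto
  then obtain C where C: "subring C R" "B \<subseteq> C" "finite_over B C" "y' \<in> poly_values C x n"
    using Suc.IH by blast
  obtain C' where C': "subring C' R" "C \<subseteq> C'" "e \<in> C'" "finite_over B C'"
    using adjoin_integral[OF B C(1,2,3)] integral_over_mono[OF C(2) E[OF y(2)]] by blast
  then have "y \<in> poly_values C' x (Suc n)"
    using y C poly_values_mono_set[OF C'(2), of x n] by (intro poly_values_SucI[of e _ y']) auto
  then show ?case using C C' by blast
qed

text \<open>The coefficients of one equation of \<open>x\<close> lie in a finite extension of
  \<open>B\<close>; adjoining \<open>x\<close> keeps it finite, and elements of finite extensions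
  are integral.\<close>

lemma integral_over_trans:
  assumes B: "subring B R" and E: "\<And>e. e \<in> E \<Longrightarrow> integral_over B e" and x: "integral_over E x"
  shows "integral_over B x"
proof -
  obtain n y where xc: "x \<in> carrier R" and y: "y \<in> poly_values E x n" "x [^] n \<oplus> y = \<zero>"
    using x unfolding integral_over_def by auto
  then obtain C where C: "subring C R" "B \<subseteq> C" "finite_over B C" "y \<in> poly_values C x n"
    using finite_subring_of_values[OF B E xc] by blast
  then have "integral_over C x" unfolding integral_over_def using xc y by blast
  then show ?thesis using adjoin_integral[OF B C(1-3)] finite_over_imp_integral[OF B] by blast
qed

lemma integral_over_self:
  assumes "subring B R" "b \<in> B" shows "integral_over B b"
  using finite_over_imp_integral[OF assms(1,1) finite_over_refl[OF assms(1)] assms(2)] .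

text \<open>Two integral elements, adjoined in turn, lie in a common finite extension of
  \<open>B\<close>, and so do their sum and product.\<close>

lemma integral_elements_subring:
  assumes B: "subring B R" shows "subring {x \<in> carrier R. integral_over B x} R"
proof -
  have two: "\<exists>C. subring C R \<and> x \<in> C \<and> y \<in> C \<and> (\<forall>z\<in>C. integral_over B z)"
    if xy: "integral_over B x" "integral_over B y" for x y
  proof -
    obtain C where C: "subring C R" "B \<subseteq> C" "x \<in> C" "finite_over B C"
      using adjoin_integral[OF B B subset_refl finite_over_refl[OF B] xy(1)] by metis
    obtain C' where C': "subring C' R" "C \<subseteq> C'" "y \<in> C'" "finite_over B C'"
      using adjoin_integral[OF B C(1,2,4) integral_over_mono[OF C(2) xy(2)]] by metis
    then have "\<forall>z\<in>C'. integral_over B z" using finite_over_imp_integral[OF B C'(1,4)] by metis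
    then show ?thesis using C' C(3) by (intro exI[of _ C'] conjI) auto
  qed
  have I: "x \<in> {x \<in> carrier R. integral_over B x} \<longleftrightarrow> integral_over B x" for x
    by (auto simp: integral_over_def)
  show ?thesis
  proof (rule subringI)
    show "{x \<in> carrier R. integral_over B x} \<subseteq> carrier R" by (rule Collect_restrict)
    show "\<one> \<in> {x \<in> carrier R. integral_over B x}"
      by (rule I[THEN iffD2], rule integral_over_self[OF B subring_cl(3)[OF B]])
  next
    fix x assume "x \<in> {x \<in> carrier R. integral_over B x}"
    then have x: "integral_over B x" by (rule I[THEN iffD1])
    from two[OF x x] obtain C where C: "subring C R" "x \<in> C" "\<forall>z\<in>C. integral_over B z" by (elim exE conjE)
    show "\<ominus> x \<in> {x \<in> carrier R. integral_over B x}"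
      by (rule I[THEN iffD2], rule bspec[OF C(3) subring_cl(6)[OF C(1,2)]])
  next
    fix x y assume xy: "x \<in> {x \<in> carrier R. integral_over B x}" "y \<in> {x \<in> carrier R. integral_over B x}"
    from two[OF xy[THEN I[THEN iffD1]]] obtain C
      where C: "subring C R" "x \<in> C" "y \<in> C" "\<forall>z\<in>C. integral_over B z" by (elim exE conjE)
    show "x \<otimes> y \<in> {x \<in> carrier R. integral_over B x}"
      by (rule I[THEN iffD2], rule bspec[OF C(4) subring_cl(5)[OF C(1-3)]])
    show "x \<oplus> y \<in> {x \<in> carrier R. integral_over B x}"
      by (rule I[THEN iffD2], rule bspec[OF C(4) subring_cl(4)[OF C(1-3)]])
  qed
qed

end

text \<open>In an equation of least degree the constant term \<open>b\<close> is nonzero, since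
  otherwise \<open>x\<close> could be cancelled. The remaining terms factor as \<open>x\<close>
  times a polynomial in \<open>x\<close>, and the negative of that polynomial is the multiplier
  \<open>z\<close> with \<open>z \<otimes> x = b\<close>. This carries tightness from the
  \<open>R a\<close> to their integral closures.\<close>

lemma (in "domain") integral_multiple_in_subring:
  assumes B: "subring B R" and x: "integral_over B x" "x \<noteq> \<zero>"
  shows "\<exists>z. integral_over B z \<and> z \<otimes> x \<in> B - {\<zero>}"
proof -
  note B_cl = subring_cl[OF B]
  have xc: "x \<in> carrier R" using x(1) by (simp add: integral_over_def)
  define rel where "rel n \<longleftrightarrow> (\<exists>y\<in>poly_values B x n. x [^] n \<oplus> y = \<zero>)" for n
  have "\<exists>n. rel n" using x(1) unfolding integral_over_def rel_def by blast
  then obtain n where n: "rel n" "\<And>k. rel k \<Longrightarrow> n \<le> k" by (metis LeastI Least_le)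
  have "n \<noteq> 0"
  proof
    assume "n = 0"
    then show False using n(1) one_not_zero by (simp add: rel_def)
  qed
  then obtain m where m: "n = Suc m" by (cases n) auto
  obtain b y where b: "b \<in> B" and y: "y \<in> poly_values B x m"
    and r: "x [^] Suc m \<oplus> (b \<oplus> x \<otimes> y) = \<zero>"
    using n(1) unfolding m rel_def by auto
  have yc: "y \<in> carrier R" by (rule poly_values_carrier[OF B_cl(1) xc y])
  have bc: "b \<in> carrier R" using b B_cl(1) by blast
  have pc: "x [^] m \<in> carrier R" using xc by simp
  define z where "z = \<ominus> (x [^] m \<oplus> y)"
  have zc: "z \<in> carrier R" unfolding z_def using pc yc by simp
  have "z \<otimes> x = b \<ominus> (x [^] Suc m \<oplus> (b \<oplus> x \<otimes> y))"
    unfolding z_def nat_pow_Suc using pc yc bc xc by algebra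
  then have zx: "z \<otimes> x = b" unfolding r using bc by (simp add: a_minus_def)
  have "b \<noteq> \<zero>"
  proof
    assume "b = \<zero>"
    then have "z = \<zero>" using integral[OF _ zc xc] zx x(2) by auto
    then have "x [^] m \<oplus> y = \<zero>" unfolding z_def using pc yc by simp
    then have "rel m" unfolding rel_def using y by blast
    then show False using n(2)[of m] m by simp
  qed
  have I: "subring {x \<in> carrier R. integral_over B x} R" (is "subring ?I _")
    by (rule integral_elements_subring[OF B])
  note I_cl = subring_cl[OF I]
  have xI: "x \<in> ?I" using xc x(1) by simp
  have BI: "B \<subseteq> ?I" using B_cl(1) integral_over_self[OF B] by blast
  have valI: "w \<in> ?I" if "w \<in> poly_values B x k" for w k
    using that
  proof (induction k arbitrary: w)
    case 0
    then show ?case using I_cl(2) by simp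
  next
    case (Suc k)
    then obtain c w' where w: "w = c \<oplus> x \<otimes> w'" "c \<in> B" "w' \<in> poly_values B x k" by auto
    show ?case unfolding w(1) by (rule I_cl(4)[OF subsetD[OF BI w(2)] I_cl(5)[OF xI Suc.IH[OF w(3)]]])
  qed
  have powI: "x [^] k \<in> ?I" for k :: nat
  proof (induction k)
    case 0
    then show ?case using I_cl(3) by simp
  next
    case (Suc k)
    then show ?case unfolding nat_pow_Suc by (rule I_cl(5)[OF _ xI])
  qed
  have "z \<in> ?I" unfolding z_def by (rule I_cl(6)[OF I_cl(4)[OF powI valI[OF y]]])
  then show ?thesis using zx b \<open>b \<noteq> \<zero>\<close> by (intro exI[of _ z]) simp
qed

section \<open>Evaluation of polynomials\<close>

text \<open>A polynomial in \<open>UP R\<close> is its own coefficient function. Hence coefficients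
  are written \<open>p i\<close> below, and applying \<open>h\<close> to all of them is the
  composition \<open>h \<circ> p\<close>.\<close>

lemma coeff_UP: "p \<in> carrier (UP R) \<Longrightarrow> coeff (UP R) p i = p i"
  by (simp add: UP_def)

lemma carrier_UP_iff:
  "p \<in> carrier (UP R) \<longleftrightarrow> (\<forall>i. p i \<in> carrier R) \<and> (\<exists>n. \<forall>i>n. p i = \<zero>\<^bsub>R\<^esub>)"
  by (auto simp: UP_def up_def bound_def)

lemma UP_cring_of: "cring R \<Longrightarrow> UP_cring R"
  by (simp add: UP_cring_def)

lemma UP_is_cring: "cring R \<Longrightarrow> cring (UP R)"
  using UP_cring.UP_cring[OF UP_cring_of] .

lemma UP_above_deg:
  assumes "cring R" "p \<in> carrier (UP R)" "deg R p < i" shows "p i = \<zero>\<^bsub>R\<^esub>"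
proof -
  interpret UP_cring R "UP R" using UP_cring_of[OF assms(1)] .
  show ?thesis using deg_aboveD[OF assms(3,2)] coeff_UP[OF assms(2)] by simp
qed

lemma UP_deg_le:
  assumes "cring R" "p \<in> carrier (UP R)" "\<And>i. n < i \<Longrightarrow> p i = \<zero>\<^bsub>R\<^esub>" shows "deg R p \<le> n"
proof -
  interpret UP_cring R "UP R" using UP_cring_of[OF assms(1)] .
  show ?thesis using assms coeff_UP[OF assms(2)] by (intro deg_aboveI) auto
qed

lemma UP_le_deg:
  assumes "cring R" "p \<in> carrier (UP R)" "p n \<noteq> \<zero>\<^bsub>R\<^esub>" shows "n \<le> deg R p"
proof -
  interpret UP_cring R "UP R" using UP_cring_of[OF assms(1)] .
  show ?thesis using assms coeff_UP[OF assms(2)] by (intro deg_belowI) auto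
qed

lemma UP_lead_coeff_nonzero:
  assumes "cring R" "p \<in> carrier (UP R)" "p n \<noteq> \<zero>\<^bsub>R\<^esub>" shows "p (deg R p) \<noteq> \<zero>\<^bsub>R\<^esub>"
proof -
  interpret UP_cring R "UP R" using UP_cring_of[OF assms(1)] .
  have "p \<noteq> \<zero>\<^bsub>UP R\<^esub>" using assms(3) by (auto simp: UP_def)
  then show ?thesis using lcoeff_nonzero[OF _ assms(2)] coeff_UP[OF assms(2)] by simp
qed

text \<open>Any bound \<open>N\<close> may replace the degree: the same sum is then available for
  \<open>p\<close> and for \<open>h \<circ> p\<close>, whose degree can drop.\<close>

lemma eval_eq_finsum:
  assumes R: "cring R" and S: "cring S" and h: "h \<in> ring_hom R S" and s: "s \<in> carrier S"
    and p: "p \<in> carrier (UP R)" and N: "\<And>i. N < i \<Longrightarrow> p i = \<zero>\<^bsub>R\<^esub>"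
  shows "eval R S h s p = (\<Oplus>\<^bsub>S\<^esub>i\<in>{..N}. h (p i) \<otimes>\<^bsub>S\<^esub> s [^]\<^bsub>S\<^esub> i)"
proof -
  interpret R: cring R by fact
  interpret S: cring S by fact
  have pc: "p i \<in> carrier R" for i using p carrier_UP_iff by blast
  have h0: "h \<zero>\<^bsub>R\<^esub> = \<zero>\<^bsub>S\<^esub>" using ring_hom_zero[OF h R.ring_axioms S.ring_axioms] .
  have "eval R S h s p = (\<Oplus>\<^bsub>S\<^esub>i\<in>{..deg R p}. h (p i) \<otimes>\<^bsub>S\<^esub> s [^]\<^bsub>S\<^esub> i)"
    unfolding eval_def using p coeff_UP[OF p] by simp
  also have "\<dots> = (\<Oplus>\<^bsub>S\<^esub>i\<in>{..N}. h (p i) \<otimes>\<^bsub>S\<^esub> s [^]\<^bsub>S\<^esub> i)"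
    using UP_deg_le[OF R p N] UP_above_deg[OF R p] h0 s ring_hom_closed[OF h pc]
    by (intro S.add.finprod_mono_neutral_cong_left) auto
  finally show ?thesis .
qed

lemma eval_hom:
  assumes "cring R" "cring S" "h \<in> ring_hom R S" "s \<in> carrier S"
  shows "eval R S h s \<in> ring_hom (UP R) S"
  using UP_pre_univ_prop.eval_ring_hom[OF UP_pre_univ_propI[OF assms(1-3)] assms(4)] .

lemma eval_monom':
  assumes "cring R" "cring S" "h \<in> ring_hom R S" "s \<in> carrier S" "r \<in> carrier R"
  shows "eval R S h s (monom (UP R) r n) = h r \<otimes>\<^bsub>S\<^esub> s [^]\<^bsub>S\<^esub> n"
  using UP_pre_univ_prop.eval_monom[OF UP_pre_univ_propI[OF assms(1-3)] assms(5,4)] .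

lemma map_UP_closed:
  assumes "cring R" "cring S" "h \<in> ring_hom R S" "p \<in> carrier (UP R)"
  shows "h \<circ> p \<in> carrier (UP S)"
  using assms ring_hom_zero[OF assms(3)] ring_hom_closed[OF assms(3)]
  unfolding carrier_UP_iff by (metis comp_apply cring.axioms(1))

lemma eval_comp:
  assumes "cring R" "cring S" "cring Q" "h \<in> ring_hom R S" "k \<in> ring_hom S Q" "t \<in> carrier Q"
    "p \<in> carrier (UP R)"
  shows "eval R Q (k \<circ> h) t p = eval S Q k t (h \<circ> p)"
proof -
  have a: "p i = \<zero>\<^bsub>R\<^esub>" if "deg R p < i" for i using UP_above_deg assms that by blast
  moreover have "(h \<circ> p) i = \<zero>\<^bsub>S\<^esub>" if "deg R p < i" for i
    using a[OF that] ring_hom_zero[OF assms(4) assms(1,2)[THEN cring.axioms(1)]] by simp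
  ultimately show ?thesis
    using eval_eq_finsum[OF assms(1,3) ring_hom_trans[OF assms(4,5)] assms(6,7), of "deg R p"]
      eval_eq_finsum[OF assms(2,3,5,6) map_UP_closed[OF assms(1,2,4,7)], of "deg R p"] by simp
qed

lemma map_UP_hom:
  assumes R: "cring R" and S: "cring S" and h: "h \<in> ring_hom R S"
  shows "(\<lambda>p. h \<circ> p) \<in> ring_hom (UP R) (UP S)"
proof -
  interpret R: UP_cring R "UP R" using UP_cring_of[OF R] .
  interpret S: UP_cring S "UP S" using UP_cring_of[OF S] .
  interpret h: ring_hom_cring R S h
    using R S h by (simp add: ring_hom_cring_def ring_hom_cring_axioms_def)
  note cl = map_UP_closed[OF R S h]
  show ?thesis
  proof (rule ring_hom_memI)
    fix p q assume pq: "p \<in> carrier (UP R)" "q \<in> carrier (UP R)"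
    have pc: "p i \<in> carrier R" "q i \<in> carrier R" for i using pq carrier_UP_iff by blast+
    have "coeff (UP S) (h \<circ> (p \<otimes>\<^bsub>UP R\<^esub> q)) n = coeff (UP S) ((h \<circ> p) \<otimes>\<^bsub>UP S\<^esub> (h \<circ> q)) n" for n
    proof -
      have "coeff (UP S) (h \<circ> (p \<otimes>\<^bsub>UP R\<^esub> q)) n = h (coeff (UP R) (p \<otimes>\<^bsub>UP R\<^esub> q) n)"
        using pq cl by (simp add: coeff_UP)
      also have "\<dots> = (\<Oplus>\<^bsub>S\<^esub>i\<in>{..n}. h (p i) \<otimes>\<^bsub>S\<^esub> h (q (n - i)))"
        unfolding R.coeff_mult[OF pq] using pq pc by (simp add: coeff_UP Pi_def o_def)
      also have "\<dots> = coeff (UP S) ((h \<circ> p) \<otimes>\<^bsub>UP S\<^esub> (h \<circ> q)) n"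
        unfolding S.coeff_mult[OF cl[OF pq(1)] cl[OF pq(2)]] using pq cl by (simp add: coeff_UP)
      finally show ?thesis .
    qed
    then show "h \<circ> (p \<otimes>\<^bsub>UP R\<^esub> q) = (h \<circ> p) \<otimes>\<^bsub>UP S\<^esub> (h \<circ> q)"
      using pq cl by (intro S.up_eqI) auto
    have "coeff (UP S) (h \<circ> (p \<oplus>\<^bsub>UP R\<^esub> q)) n = coeff (UP S) ((h \<circ> p) \<oplus>\<^bsub>UP S\<^esub> (h \<circ> q)) n" for n
    proof -
      have "coeff (UP S) (h \<circ> (p \<oplus>\<^bsub>UP R\<^esub> q)) n = h (coeff (UP R) (p \<oplus>\<^bsub>UP R\<^esub> q) n)"
        using pq cl by (simp add: coeff_UP)
      also have "\<dots> = coeff (UP S) ((h \<circ> p) \<oplus>\<^bsub>UP S\<^esub> (h \<circ> q)) n"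
        unfolding R.coeff_add[OF pq] S.coeff_add[OF cl[OF pq(1)] cl[OF pq(2)]]
        using pq cl pc by (simp add: coeff_UP)
      finally show ?thesis .
    qed
    then show "h \<circ> (p \<oplus>\<^bsub>UP R\<^esub> q) = (h \<circ> p) \<oplus>\<^bsub>UP S\<^esub> (h \<circ> q)"
      using pq cl by (intro S.up_eqI) auto
  next
    show "h \<circ> \<one>\<^bsub>UP R\<^esub> = \<one>\<^bsub>UP S\<^esub>" by (auto simp: UP_def)
  qed (use cl in auto)
qed

section \<open>Monic polynomials and the two forms of integrality\<close>

lemma monic_polyD:
  assumes "monic_poly R p" shows "p \<in> carrier (UP R)" "p (deg R p) = \<one>\<^bsub>R\<^esub>"
  using assms coeff_UP unfolding monic_poly_def by metis+

text \<open>In a nontrivial ring \<open>n\<close> is the degree. In the trivial ring, which occurs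
  as the empty product, it need not be, but there every coefficient equals
  \<open>\<one>\<close>.\<close>

lemma monic_polyI:
  assumes R: "cring R" and p: "p \<in> carrier (UP R)" "p n = \<one>\<^bsub>R\<^esub>" "\<And>i. n < i \<Longrightarrow> p i = \<zero>\<^bsub>R\<^esub>"
  shows "monic_poly R p"
proof -
  interpret R: cring R by fact
  show ?thesis
  proof (cases "\<one>\<^bsub>R\<^esub> = \<zero>\<^bsub>R\<^esub>")
    case True
    have pc: "p (deg R p) \<in> carrier R" using p(1) carrier_UP_iff by blast
    have "carrier R = {\<zero>\<^bsub>R\<^esub>}" using R.one_zeroD[OF True] .
    then show ?thesis unfolding monic_poly_def using p(1) pc True by (simp add: coeff_UP)
  next
    case False
    then have "deg R p = n"
      using UP_le_deg[OF R p(1), of n] UP_deg_le[OF R p(1), of n] p(2,3) by (simp add: le_antisym)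
    then show ?thesis unfolding monic_poly_def using p by (simp add: coeff_UP)
  qed
qed

text \<open>Passes from polynomials over \<open>R\<close> to coefficients in the image of
  \<open>R\<close> inside \<open>S\<close>, where all finiteness arguments take place.\<close>

lemma integral_element_iff:
  assumes R: "cring R" and S: "cring S" and h: "h \<in> ring_hom R S" and s: "s \<in> carrier S"
  shows "integral_element R S h s \<longleftrightarrow> cring.integral_over S (h ` carrier R) s"
proof -
  interpret R: cring R by fact
  interpret S: cring S by fact
  have h0: "h \<zero>\<^bsub>R\<^esub> = \<zero>\<^bsub>S\<^esub>" using ring_hom_zero[OF h R.ring_axioms S.ring_axioms] .
  have h1: "h \<one>\<^bsub>R\<^esub> = \<one>\<^bsub>S\<^esub>" using ring_hom_one[OF h] .
  have im: "h ` carrier R \<subseteq> carrier S" using ring_hom_closed[OF h] by auto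
  have split: "(\<Oplus>\<^bsub>S\<^esub>i\<in>{..n}. h (p i) \<otimes>\<^bsub>S\<^esub> s [^]\<^bsub>S\<^esub> i)
      = s [^]\<^bsub>S\<^esub> n \<oplus>\<^bsub>S\<^esub> (\<Oplus>\<^bsub>S\<^esub>i\<in>{..<n}. h (p i) \<otimes>\<^bsub>S\<^esub> s [^]\<^bsub>S\<^esub> i)"
    if "\<And>i. i \<le> n \<Longrightarrow> p i \<in> carrier R" "p n = \<one>\<^bsub>R\<^esub>" for p and n :: nat
  proof -
    have "{..n} = insert n {..<n}" by auto
    then show ?thesis using that h1 s ring_hom_closed[OF h] by (simp add: S.finsum_insert Pi_def)
  qed
  show ?thesis
  proof
    assume "integral_element R S h s"
    then obtain p where p: "monic_poly R p" "eval R S h s p = \<zero>\<^bsub>S\<^esub>" unfolding integral_element_def by auto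
    note mp = monic_polyD[OF p(1)]
    have pc: "p i \<in> carrier R" for i using mp carrier_UP_iff by blast
    let ?n = "deg R p"
    have "s [^]\<^bsub>S\<^esub> ?n \<oplus>\<^bsub>S\<^esub> (\<Oplus>\<^bsub>S\<^esub>i\<in>{..<?n}. h (p i) \<otimes>\<^bsub>S\<^esub> s [^]\<^bsub>S\<^esub> i) = \<zero>\<^bsub>S\<^esub>"
      using p(2) eval_eq_finsum[OF R S h s mp(1) UP_above_deg[OF R mp(1)]] split[of ?n p] pc mp by auto
    moreover have "(\<Oplus>\<^bsub>S\<^esub>i\<in>{..<?n}. h (p i) \<otimes>\<^bsub>S\<^esub> s [^]\<^bsub>S\<^esub> i) \<in> S.poly_values (h ` carrier R) s ?n"
      unfolding S.poly_values_iff_finsum[OF im s] using pc by (intro exI[of _ "\<lambda>i. h (p i)"]) auto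
    ultimately show "S.integral_over (h ` carrier R) s" unfolding S.integral_over_def using s by blast
  next
    assume "S.integral_over (h ` carrier R) s"
    then obtain n y where y: "y \<in> S.poly_values (h ` carrier R) s n" "s [^]\<^bsub>S\<^esub> n \<oplus>\<^bsub>S\<^esub> y = \<zero>\<^bsub>S\<^esub>"
      unfolding S.integral_over_def by auto
    then obtain c where c: "\<forall>i<n. c i \<in> h ` carrier R" "y = (\<Oplus>\<^bsub>S\<^esub>i\<in>{..<n}. c i \<otimes>\<^bsub>S\<^esub> s [^]\<^bsub>S\<^esub> i)"
      unfolding S.poly_values_iff_finsum[OF im s] by auto
    then have "\<forall>i. \<exists>b. i < n \<longrightarrow> b \<in> carrier R \<and> c i = h b" by blast
    then obtain b where b: "\<And>i. i < n \<Longrightarrow> b i \<in> carrier R" "\<And>i. i < n \<Longrightarrow> c i = h (b i)" by metis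
    define p where "p i = (if i < n then b i else if i = n then \<one>\<^bsub>R\<^esub> else \<zero>\<^bsub>R\<^esub>)" for i
    have p: "p \<in> carrier (UP R)" unfolding carrier_UP_iff p_def using b by (auto intro!: exI[of _ n])
    have pc: "p i \<in> carrier R" for i using p carrier_UP_iff by blast
    have "eval R S h s p = (\<Oplus>\<^bsub>S\<^esub>i\<in>{..n}. h (p i) \<otimes>\<^bsub>S\<^esub> s [^]\<^bsub>S\<^esub> i)"
      by (rule eval_eq_finsum[OF R S h s p]) (auto simp: p_def)
    also have "\<dots> = s [^]\<^bsub>S\<^esub> n \<oplus>\<^bsub>S\<^esub> (\<Oplus>\<^bsub>S\<^esub>i\<in>{..<n}. h (p i) \<otimes>\<^bsub>S\<^esub> s [^]\<^bsub>S\<^esub> i)"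
      using pc by (intro split) (auto simp: p_def)
    also have "(\<Oplus>\<^bsub>S\<^esub>i\<in>{..<n}. h (p i) \<otimes>\<^bsub>S\<^esub> s [^]\<^bsub>S\<^esub> i) = y"
      unfolding c(2) using b s ring_hom_closed[OF h]
      by (intro S.finsum_cong') (auto simp: p_def)
    finally have ev: "eval R S h s p = \<zero>\<^bsub>S\<^esub>" using y(2) by simp
    have "monic_poly R p" by (rule monic_polyI[OF R p, of n]) (simp_all add: p_def)
    then show "integral_element R S h s" unfolding integral_element_def using ev by blast
  qed
qed

section \<open>Extending homomorphisms along integral extensions\<close>

lemma RDirProd_simps [simp]:
  "carrier (RDirProd R S) = carrier R \<times> carrier S"
  "x \<otimes>\<^bsub>RDirProd R S\<^esub> y = (fst x \<otimes>\<^bsub>R\<^esub> fst y, snd x \<otimes>\<^bsub>S\<^esub> snd y)"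
  "x \<oplus>\<^bsub>RDirProd R S\<^esub> y = (fst x \<oplus>\<^bsub>R\<^esub> fst y, snd x \<oplus>\<^bsub>S\<^esub> snd y)"
  "\<one>\<^bsub>RDirProd R S\<^esub> = (\<one>\<^bsub>R\<^esub>, \<one>\<^bsub>S\<^esub>)" "\<zero>\<^bsub>RDirProd R S\<^esub> = (\<zero>\<^bsub>R\<^esub>, \<zero>\<^bsub>S\<^esub>)"
  by (auto simp: RDirProd_def DirProd_def monoid.defs split: prod.splits)

lemma RDirProd_cring:
  assumes "cring R" "cring S" shows "cring (RDirProd R S)"
proof -
  interpret R: cring R by fact
  interpret S: cring S by fact
  interpret ring "RDirProd R S" by (rule RDirProd_ring) unfold_locales
  show ?thesis by unfold_locales (auto simp: R.m_comm S.m_comm)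
qed

lemma RDirProd_a_inv:
  assumes "cring R" "cring S" "x \<in> carrier R" "y \<in> carrier S"
  shows "\<ominus>\<^bsub>RDirProd R S\<^esub> (x, y) = (\<ominus>\<^bsub>R\<^esub> x, \<ominus>\<^bsub>S\<^esub> y)"
proof -
  interpret R: cring R by fact
  interpret S: cring S by fact
  interpret cring "RDirProd R S" using RDirProd_cring[OF assms(1,2)] .
  show ?thesis using assms by (intro minus_equality) (auto simp: R.l_neg S.l_neg)
qed

text \<open>Algebraic closedness for \<open>UP\<close> polynomials. The predicate
  \<open>algebraically_closed\<close> speaks about polynomials as coefficient lists;
  \<open>algebraically_closed_has_roots\<close> translates.\<close>

definition has_roots :: "('a, 'm) ring_scheme \<Rightarrow> bool" where
  "has_roots K \<longleftrightarrow> (\<forall>p\<in>carrier (UP K). UnivPoly.deg K p > 0 \<longrightarrow> (\<exists>x\<in>carrier K. UnivPoly.eval K K id x p = \<zero>\<^bsub>K\<^esub>))"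

lemma subring_is_cring: "cring R \<Longrightarrow> subring B R \<Longrightarrow> cring (R\<lparr>carrier := B\<rparr>)"
  using ring.subcring_iff[OF cring.axioms(1), of R B] cring.subcringI'[of R B] subringE(1)[of B R] by blast

section \<open>Partial homomorphisms and one extension step\<close>

text \<open>Partial homomorphisms from \<open>S\<close> to \<open>K\<close> are represented by their graphs, subrings of the product.\<close>

definition graph_hom :: "('a, 'm) ring_scheme \<Rightarrow> ('b, 'n) ring_scheme \<Rightarrow> ('a \<times> 'b) set \<Rightarrow> bool" where
  "graph_hom S K G \<longleftrightarrow> subring G (RDirProd S K) \<and> (\<forall>y. (\<zero>\<^bsub>S\<^esub>, y) \<in> G \<longrightarrow> y = \<zero>\<^bsub>K\<^esub>)"

text \<open>The setting of a single step: a partial homomorphism with graph \<open>G\<close>, and an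
  element \<open>s\<close> integral over its domain that is to be added to the domain.\<close>

locale integral_graph_hom =
  S: cring S + K: field K for S (structure) and K (structure) and G and s +
  assumes graph: "graph_hom S K G" and s: "s \<in> carrier S" and int: "S.integral_over (fst ` G) s"
begin

text \<open>The graph as coefficient ring: its two projections stand for the inclusion of the domain
  into \<open>S\<close> and for the partial homomorphism itself, and both are total ring
  homomorphisms.\<close>

definition Gr where "Gr = (RDirProd S K)\<lparr>carrier := G\<rparr>"

lemma cring_K: "cring K" by unfold_locales

lemma cring_W: "cring (RDirProd S K)" using RDirProd_cring S.is_cring cring_K by blast

lemma graph_subring: "subring G (RDirProd S K)" using graph by (simp add: graph_hom_def)

lemma graph_single_valued: "(\<zero>, y) \<in> G \<Longrightarrow> y = \<zero>\<^bsub>K\<^esub>" using graph by (simp add: graph_hom_def)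

lemma G_closed: "g \<in> G \<Longrightarrow> fst g \<in> carrier S" "g \<in> G \<Longrightarrow> snd g \<in> carrier K"
  using subringE(1)[OF graph_subring] by auto

lemma G_ops:
  "(\<zero>, \<zero>\<^bsub>K\<^esub>) \<in> G" "(\<one>, \<one>\<^bsub>K\<^esub>) \<in> G"
  "\<lbrakk>(a, x) \<in> G; (b, y) \<in> G\<rbrakk> \<Longrightarrow> (a \<oplus> b, x \<oplus>\<^bsub>K\<^esub> y) \<in> G"
  "\<lbrakk>(a, x) \<in> G; (b, y) \<in> G\<rbrakk> \<Longrightarrow> (a \<otimes> b, x \<otimes>\<^bsub>K\<^esub> y) \<in> G"
  "(a, x) \<in> G \<Longrightarrow> (\<ominus> a, \<ominus>\<^bsub>K\<^esub> x) \<in> G"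
  "\<lbrakk>(a, x) \<in> G; (b, y) \<in> G\<rbrakk> \<Longrightarrow> (a \<ominus> b, x \<ominus>\<^bsub>K\<^esub> y) \<in> G"
proof -
  show neg: "(\<ominus> a, \<ominus>\<^bsub>K\<^esub> x) \<in> G" if "(a, x) \<in> G" for a x
    using subringE(5)[OF graph_subring that] G_closed[OF that] RDirProd_a_inv[OF S.is_cring cring_K] by simp
  show add: "(a \<oplus> b, x \<oplus>\<^bsub>K\<^esub> y) \<in> G" if "(a, x) \<in> G" "(b, y) \<in> G" for a b x y
    using subringE(7)[OF graph_subring that] by simp
  show "(a \<ominus> b, x \<ominus>\<^bsub>K\<^esub> y) \<in> G" if "(a, x) \<in> G" "(b, y) \<in> G" for a b x y
    unfolding a_minus_def by (rule add[OF that(1) neg[OF that(2)]])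
  show "(a \<otimes> b, x \<otimes>\<^bsub>K\<^esub> y) \<in> G" if "(a, x) \<in> G" "(b, y) \<in> G" for a b x y
    using subringE(6)[OF graph_subring that] by simp
qed (use subringE(2,3)[OF graph_subring] in simp_all)

sublocale Gr: cring Gr
  unfolding Gr_def by (rule subring_is_cring[OF cring_W graph_subring])

lemma Gr_simps: "carrier Gr = G" "x \<otimes>\<^bsub>Gr\<^esub> y = (fst x \<otimes> fst y, snd x \<otimes>\<^bsub>K\<^esub> snd y)"
  "x \<oplus>\<^bsub>Gr\<^esub> y = (fst x \<oplus> fst y, snd x \<oplus>\<^bsub>K\<^esub> snd y)"
  "\<one>\<^bsub>Gr\<^esub> = (\<one>, \<one>\<^bsub>K\<^esub>)" "\<zero>\<^bsub>Gr\<^esub> = (\<zero>, \<zero>\<^bsub>K\<^esub>)"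
  by (auto simp: Gr_def)

lemma fst_hom: "fst \<in> ring_hom Gr S"
  by (rule ring_hom_memI) (auto simp: Gr_simps G_closed)

lemma snd_hom: "snd \<in> ring_hom Gr K"
  by (rule ring_hom_memI) (auto simp: Gr_simps G_closed)

lemma UP_coeff_G: "p \<in> carrier (UP Gr) \<Longrightarrow> p i \<in> G"
  using carrier_UP_iff Gr_simps(1) by blast

text \<open>The relations satisfied by \<open>s\<close>. Sending \<open>s\<close> to
  \<open>\<alpha>\<close> is consistent exactly when \<open>\<alpha>\<close> is a root of the images
  under \<open>snd\<close> of all of them.\<close>

abbreviation "I \<equiv> {p \<in> carrier (UP Gr). UnivPoly.eval Gr S fst s p = \<zero>}"

definition "Ker = {q. (q, \<zero>\<^bsub>K\<^esub>) \<in> G}"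

lemma Ker:
  "Ker \<subseteq> carrier S" "\<zero> \<in> Ker" "\<lbrakk>a \<in> Ker; b \<in> Ker\<rbrakk> \<Longrightarrow> a \<oplus> b \<in> Ker"
  "\<lbrakk>b \<in> fst ` G; a \<in> Ker\<rbrakk> \<Longrightarrow> b \<otimes> a \<in> Ker" "a \<in> Ker \<Longrightarrow> \<ominus> a \<in> Ker"
proof -
  show "Ker \<subseteq> carrier S" using G_closed by (auto simp: Ker_def)
  show "\<zero> \<in> Ker" using G_ops(1) by (simp add: Ker_def)
  show "a \<oplus> b \<in> Ker" if "a \<in> Ker" "b \<in> Ker" for a b
    using G_ops(3)[of a "\<zero>\<^bsub>K\<^esub>" b "\<zero>\<^bsub>K\<^esub>"] that by (simp add: Ker_def)
  show "\<ominus> a \<in> Ker" if "a \<in> Ker" for a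
    using G_ops(5)[of a "\<zero>\<^bsub>K\<^esub>"] that by (simp add: Ker_def)
  show "b \<otimes> a \<in> Ker" if b: "b \<in> fst ` G" and a: "a \<in> Ker" for a b
  proof -
    obtain y where y: "(b, y) \<in> G" using b by auto
    then show ?thesis using G_ops(4)[OF y, of a "\<zero>\<^bsub>K\<^esub>"] a G_closed[OF y] by (simp add: Ker_def)
  qed
qed

lemma fst_G_subring: "subring (fst ` G) S"
proof (rule S.subringI)
  fix h assume "h \<in> fst ` G"
  then obtain y where "(h, y) \<in> G" by auto
  from G_ops(5)[OF this] show "\<ominus> h \<in> fst ` G" by force
next
  fix h k assume "h \<in> fst ` G" "k \<in> fst ` G"
  then obtain y z where "(h, y) \<in> G" "(k, z) \<in> G" by auto
  from G_ops(4)[OF this] G_ops(3)[OF this]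
  show "h \<otimes> k \<in> fst ` G" "h \<oplus> k \<in> fst ` G" by force+
next
  show "\<one> \<in> fst ` G" using G_ops(2) by force
qed (use G_closed in auto)

text \<open>This is the lying-over part of the extension theorem: an integral extension cannot make an
  element outside the kernel fall into the ideal generated by the kernel.\<close>

lemma not_in_kernel_ideal:
  assumes b: "(b, y) \<in> G" and y: "y \<noteq> \<zero>\<^bsub>K\<^esub>" and bv: "b \<in> S.poly_values Ker s m"
  shows False
proof -
  note sB = S.subring_cl[OF fst_G_subring]
  obtain n z where z: "z \<in> S.poly_values (fst ` G) s n" "s [^] n \<oplus> z = \<zero>"
    using int unfolding S.integral_over_def by blast
  have mult: "a \<otimes> c \<in> Ker" if "a \<in> Ker" "c \<in> fst ` G" for a c
    using Ker(4)[OF that(2,1)] S.m_comm[OF subsetD[OF Ker(1) that(1)] subsetD[OF sB(1) that(2)]] by simp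
  have red: "S.poly_values Ker s k \<subseteq> S.poly_values Ker s (Suc n)" for k
    by (rule S.poly_values_reduce[OF fst_G_subring Ker(1-3) mult s z])
  have bc: "b \<in> carrier S" using G_closed[OF b] by simp
  let ?pw = "map (\<lambda>i. s [^] i) [0..<Suc n]"
  let ?gs = "map (\<lambda>i. s [^] Suc i) [0..<n]"
  have pw: "?pw = \<one> # ?gs" by (simp add: map_upt_Suc del: upt_Suc)
  \<comment> \<open>Multiplication by \<open>b\<close> maps the powers
    \<open>\<one>, s, ..., s^n\<close> into their span with coefficients in \<open>Ker\<close>: the
    situation of the determinant trick.\<close>
  have pow: "b \<otimes> s [^] (i::nat) \<in> S.lin_span Ker (\<one> # ?gs)" for i
  proof -
    have "s [^] i \<otimes> b \<in> S.poly_values Ker s (Suc n)"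
      by (rule subsetD[OF red S.poly_values_shift_pow[OF Ker(2) s Ker(1) bv]])
    then have "s [^] i \<otimes> b \<in> S.lin_span Ker ?pw"
      by (rule subsetD[OF S.poly_values_subset_lin_span[OF Ker(1) s]])
    then show ?thesis unfolding pw using S.m_comm[OF bc S.nat_pow_closed[OF s]] by simp
  qed
  \<comment> \<open>The domain elements outside \<open>Ker\<close>. They are closed under products
    because \<open>K\<close> is a field, the terms from \<open>Ker\<close> do not change the image
    in \<open>K\<close>, and \<open>\<zero> \<in> D k\<close> would violate
    single-valuedness.\<close>
  define D where "D k = {a. \<exists>x. x \<noteq> \<zero>\<^bsub>K\<^esub> \<and> (a, x) \<in> G}" for k :: nat
  define L where "L k = Ker" for k :: nat
  have "\<exists>k. \<zero> \<in> D k"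
  proof (rule S.annihilator_of_lin_span[where gs = ?gs and x = b and D = D and L = L and E = Ker])
    fix k d d' l l' assume "d \<in> D k" "d' \<in> D k" "l \<in> L k" "l' \<in> L k"
    then obtain x x' where x: "x \<noteq> \<zero>\<^bsub>K\<^esub>" "(d, x) \<in> G" "x' \<noteq> \<zero>\<^bsub>K\<^esub>" "(d', x') \<in> G"
      and l: "(l, \<zero>\<^bsub>K\<^esub>) \<in> G" "(l', \<zero>\<^bsub>K\<^esub>) \<in> G" unfolding D_def L_def Ker_def by auto
    have c: "x \<in> carrier K" "x' \<in> carrier K" using x G_closed by force+
    have "(d \<otimes> d' \<ominus> l \<otimes> l', x \<otimes>\<^bsub>K\<^esub> x' \<ominus>\<^bsub>K\<^esub> \<zero>\<^bsub>K\<^esub> \<otimes>\<^bsub>K\<^esub> \<zero>\<^bsub>K\<^esub>) \<in> G"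
      by (intro G_ops x l)
    moreover have "x \<otimes>\<^bsub>K\<^esub> x' \<ominus>\<^bsub>K\<^esub> \<zero>\<^bsub>K\<^esub> \<otimes>\<^bsub>K\<^esub> \<zero>\<^bsub>K\<^esub> = x \<otimes>\<^bsub>K\<^esub> x'" using c by (simp add: a_minus_def)
    moreover have "x \<otimes>\<^bsub>K\<^esub> x' \<noteq> \<zero>\<^bsub>K\<^esub>" using c x K.integral by blast
    ultimately show "d \<otimes> d' \<ominus> l \<otimes> l' \<in> D (2 * k)" unfolding D_def by auto
  next
    fix k d l l' l'' assume "d \<in> D k" "l \<in> L k" "l' \<in> L k" "l'' \<in> L k"
    then obtain x where x: "(d, x) \<in> G"
      and l: "(l, \<zero>\<^bsub>K\<^esub>) \<in> G" "(l', \<zero>\<^bsub>K\<^esub>) \<in> G" "(l'', \<zero>\<^bsub>K\<^esub>) \<in> G" unfolding D_def L_def Ker_def by auto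
    have c: "x \<in> carrier K" using x G_closed by force
    have "(d \<otimes> l \<ominus> l' \<otimes> l'', x \<otimes>\<^bsub>K\<^esub> \<zero>\<^bsub>K\<^esub> \<ominus>\<^bsub>K\<^esub> \<zero>\<^bsub>K\<^esub> \<otimes>\<^bsub>K\<^esub> \<zero>\<^bsub>K\<^esub>) \<in> G"
      by (intro G_ops x l)
    moreover have "x \<otimes>\<^bsub>K\<^esub> \<zero>\<^bsub>K\<^esub> \<ominus>\<^bsub>K\<^esub> \<zero>\<^bsub>K\<^esub> \<otimes>\<^bsub>K\<^esub> \<zero>\<^bsub>K\<^esub> = \<zero>\<^bsub>K\<^esub>" using c by (simp add: a_minus_def)
    ultimately show "d \<otimes> l \<ominus> l' \<otimes> l'' \<in> L (2 * k)" unfolding L_def Ker_def by auto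
  next
    fix a assume a: "a \<in> Ker"
    then show "\<ominus> a \<in> L 1" unfolding L_def by (rule Ker(5))
    have "(b \<ominus> a, y \<ominus>\<^bsub>K\<^esub> \<zero>\<^bsub>K\<^esub>) \<in> G" using a b unfolding Ker_def by (intro G_ops) auto
    moreover have "y \<ominus>\<^bsub>K\<^esub> \<zero>\<^bsub>K\<^esub> = y" using G_closed[OF b] by (simp add: a_minus_def)
    ultimately show "b \<ominus> a \<in> D 1" unfolding D_def using y by auto
  next
    fix g assume "g \<in> set (\<one> # ?gs)"
    then obtain i :: nat where "g = s [^] i" unfolding pw[symmetric] by auto
    then show "b \<otimes> g \<in> S.lin_span Ker (\<one> # ?gs)" using pow by simp
  next
    show "D k \<subseteq> carrier S" for k using G_closed by (auto simp: D_def)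
  qed (use bc Ker(1) s in \<open>auto simp: L_def\<close>)
  then show False unfolding D_def using graph_single_valued by auto
qed

text \<open>All nonconstant coefficients of \<open>p\<close> lie in \<open>Ker\<close>, so the
  relation \<open>p\<close> expresses the constant coefficient through \<open>Ker\<close> and powers
  of \<open>s\<close>. By \<open>not_in_kernel_ideal\<close> its image cannot be nonzero.\<close>

lemma constant_image:
  assumes p: "p \<in> I" and z: "\<And>i. i > 0 \<Longrightarrow> snd (p i) = \<zero>\<^bsub>K\<^esub>"
  shows "snd (p 0) = \<zero>\<^bsub>K\<^esub>"
proof (rule ccontr)
  assume nz: "snd (p 0) \<noteq> \<zero>\<^bsub>K\<^esub>"
  have pc: "p \<in> carrier (UP Gr)" using p by simp
  let ?N = "UnivPoly.deg Gr p"
  have fc: "fst (p i) \<in> carrier S" for i using UP_coeff_G[OF pc] G_closed by blast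
  define c where "c i = (if i = 0 then \<zero> else fst (p i))" for i
  have cK: "c i \<in> Ker" for i
  proof (cases "i = 0")
    case False
    then have "(fst (p i), \<zero>\<^bsub>K\<^esub>) = p i" using z[of i] by (simp add: prod_eq_iff)
    then show ?thesis using UP_coeff_G[OF pc, of i] False by (simp add: c_def Ker_def)
  qed (simp add: c_def Ker)
  have cc: "c i \<in> carrier S" for i using cK Ker(1) by auto
  define y where "y = (\<Oplus>i\<in>{..<Suc ?N}. c i \<otimes> s [^] i)"
  have yv: "y \<in> S.poly_values Ker s (Suc ?N)"
    unfolding S.poly_values_iff_finsum[OF Ker(1) s] y_def by (intro exI[of _ c]) (simp add: cK)
  have yc: "y \<in> carrier S" unfolding y_def using cc s by auto
  have "UnivPoly.eval Gr S fst s p = (\<Oplus>i\<in>{..?N}. fst (p i) \<otimes> s [^] i)"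
    by (rule eval_eq_finsum[OF Gr.is_cring S.is_cring fst_hom s pc UP_above_deg[OF Gr.is_cring pc]])
  also have "\<dots> = (\<Oplus>i\<in>{..?N}. (if 0 = i then fst (p i) else \<zero>) \<oplus> c i \<otimes> s [^] i)"
    by (intro S.finsum_cong') (use fc cc s in \<open>auto simp: c_def\<close>)
  also have "\<dots> = (\<Oplus>i\<in>{..?N}. (if 0 = i then fst (p i) else \<zero>)) \<oplus> (\<Oplus>i\<in>{..?N}. c i \<otimes> s [^] i)"
    by (rule S.finsum_addf) (use fc cc s in auto)
  also have "(\<Oplus>i\<in>{..?N}. (if 0 = i then fst (p i) else \<zero>)) = fst (p 0)"
    by (rule S.finsum_singleton) (use fc in auto)
  also have "(\<Oplus>i\<in>{..?N}. c i \<otimes> s [^] i) = y" by (simp add: y_def lessThan_Suc_atMost)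
  finally have "fst (p 0) \<oplus> y = \<zero>" using p by simp
  then have "fst (p 0) = \<ominus> y" using S.sum_zero_eq_neg[OF fc yc] by simp
  also have "\<dots> = (\<ominus> \<one>) \<otimes> y" using yc by (simp add: S.l_minus)
  also have "\<dots> \<in> S.poly_values Ker s (Suc ?N)"
    by (rule S.poly_values_scale[OF Ker(1,1) _ s _ yv])
      (use Ker(1,5) in \<open>auto simp: S.l_minus subset_iff\<close>)
  finally have "fst (p 0) \<in> S.poly_values Ker s (Suc ?N)" .
  moreover have "(fst (p 0), snd (p 0)) \<in> G" using UP_coeff_G[OF pc, of 0] by simp
  ultimately show False using not_in_kernel_ideal nz by blast
qed

text \<open>
  A polynomial \<open>f\<close> in \<open>I\<close> whose image over \<open>K\<close> has least degree is not constant there, and by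
  pseudo-division its roots are roots of the images of all of \<open>I\<close>.
\<close>

lemma exists_common_root:
  assumes "has_roots K"
  shows "\<exists>\<alpha>\<in>carrier K. \<forall>p\<in>I. UnivPoly.eval Gr K snd \<alpha> p = \<zero>\<^bsub>K\<^esub>"
proof -
  interpret UP_cring Gr "UP Gr" using UP_cring_of[OF Gr.is_cring] .
  interpret evS: ring_hom_cring "UP Gr" S "UnivPoly.eval Gr S fst s"
    using eval_hom[OF Gr.is_cring S.is_cring fst_hom s] by unfold_locales
  have sp: "snd \<circ> p \<in> carrier (UP K)" if "p \<in> I" for p
    using that map_UP_closed[OF Gr.is_cring cring_K snd_hom] by simp
  have snd_zero: "snd (p i) = \<zero>\<^bsub>K\<^esub>" if "p \<in> I" "UnivPoly.deg K (snd \<circ> p) < i" for p i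
    using UP_above_deg[OF cring_K sp[OF that(1)] that(2)] by simp
  define NZ where "NZ p \<longleftrightarrow> p \<in> I \<and> (\<exists>i. snd (p i) \<noteq> \<zero>\<^bsub>K\<^esub>)" for p
  have lead: "snd (p (UnivPoly.deg K (snd \<circ> p))) \<noteq> \<zero>\<^bsub>K\<^esub>" if "NZ p" for p
    using that UP_lead_coeff_nonzero[OF cring_K sp] unfolding NZ_def by force
  have "integral_element Gr S fst s"
    using int integral_element_iff[OF Gr.is_cring S.is_cring fst_hom s] by (simp add: Gr_simps)
  then obtain p where p: "monic_poly Gr p" "UnivPoly.eval Gr S fst s p = \<zero>" unfolding integral_element_def by blast
  have "snd (p (UnivPoly.deg Gr p)) = \<one>\<^bsub>K\<^esub>" using monic_polyD(2)[OF p(1)] by (simp add: Gr_simps)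
  then have "NZ p" unfolding NZ_def using monic_polyD(1)[OF p(1)] p(2) K.one_not_zero by (auto intro: exI[of _ "UnivPoly.deg Gr p"])
  then obtain f where f: "NZ f" "\<And>g. NZ g \<Longrightarrow> UnivPoly.deg K (snd \<circ> f) \<le> UnivPoly.deg K (snd \<circ> g)"
    using ex_has_least_nat[of NZ p "\<lambda>p. UnivPoly.deg K (snd \<circ> p)"] by blast
  define n where "n = UnivPoly.deg K (snd \<circ> f)"
  have fI: "f \<in> I" using f(1) by (simp add: NZ_def)
  have "n > 0"
  proof (rule ccontr)
    assume "\<not> n > 0"
    then have "snd (f 0) = \<zero>\<^bsub>K\<^esub>" using constant_image[OF fI] snd_zero[OF fI] by (simp add: n_def)
    then show False using lead[OF f(1)] \<open>\<not> n > 0\<close> by (simp add: n_def)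
  qed
  then obtain \<alpha> where \<alpha>: "\<alpha> \<in> carrier K" "UnivPoly.eval K K id \<alpha> (snd \<circ> f) = \<zero>\<^bsub>K\<^esub>"
    using assms sp[OF fI] unfolding has_roots_def n_def by blast
  interpret evK: ring_hom_cring "UP Gr" K "UnivPoly.eval Gr K snd \<alpha>"
    using eval_hom[OF Gr.is_cring cring_K snd_hom \<alpha>(1)] by unfold_locales
  have f0: "UnivPoly.eval Gr K snd \<alpha> f = \<zero>\<^bsub>K\<^esub>"
    using eval_comp[OF Gr.is_cring cring_K cring_K snd_hom id_ring_hom \<alpha>(1), of f] fI \<alpha>(2) by simp
  have "UnivPoly.eval Gr K snd \<alpha> g = \<zero>\<^bsub>K\<^esub>" if "g \<in> I" for g
    using that
  proof (induction "UnivPoly.deg K (snd \<circ> g)" arbitrary: g rule: less_induct)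
    case less
    note gI = less.prems
    show ?case
    proof (cases "NZ g")
      case False
      then have z: "snd (g i) = \<zero>\<^bsub>K\<^esub>" for i using gI by (simp add: NZ_def)
      have gc: "g \<in> carrier (UP Gr)" using gI by simp
      have "UnivPoly.eval Gr K snd \<alpha> g = (\<Oplus>\<^bsub>K\<^esub>i\<in>{..UnivPoly.deg Gr g}. snd (g i) \<otimes>\<^bsub>K\<^esub> \<alpha> [^]\<^bsub>K\<^esub> i)"
        by (rule eval_eq_finsum[OF Gr.is_cring cring_K snd_hom \<alpha>(1) gc UP_above_deg[OF Gr.is_cring gc]])
      also have "\<dots> = \<zero>\<^bsub>K\<^esub>" using z \<alpha>(1) by simp
      finally show ?thesis .
    next
      case True
      define m where "m = UnivPoly.deg K (snd \<circ> g)"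
      have nm: "n \<le> m" using f(2)[OF True] by (simp add: n_def m_def)
      have fc: "f \<in> carrier (UP Gr)" and gc: "g \<in> carrier (UP Gr)" using fI gI by auto
      have cf: "f n \<in> carrier Gr" and cg: "g m \<in> carrier Gr"
        using UP_coeff_G[OF fc] UP_coeff_G[OF gc] by (simp_all add: Gr_simps)
      \<comment> \<open>Pseudo-division cancels the top terms without inverting \<open>f n\<close>,
        which is possible only in \<open>K\<close>. Here \<open>n\<close> and \<open>m\<close> are
        the degrees of the images: higher coefficients may survive in \<open>Gr\<close>, but they
        vanish in \<open>K\<close>. At the end the nonzero image of \<open>f n\<close> is
        cancelled.\<close>
      let ?a = "up_ring.monom (UP Gr) (f n) 0 \<otimes>\<^bsub>UP Gr\<^esub> g" and ?b = "up_ring.monom (UP Gr) (g m) (m - n) \<otimes>\<^bsub>UP Gr\<^esub> f"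
      define g' where "g' = ?a \<ominus>\<^bsub>UP Gr\<^esub> ?b"
      have ac: "?a \<in> carrier (UP Gr)" "?b \<in> carrier (UP Gr)" using fc gc cf cg by auto
      have g'c: "g' \<in> carrier (UP Gr)" unfolding g'_def using ac by simp
      have "UnivPoly.eval Gr S fst s g' = UnivPoly.eval Gr S fst s ?a \<ominus> UnivPoly.eval Gr S fst s ?b"
        unfolding g'_def a_minus_def using ac by simp
      also have "\<dots> = \<zero>" using fI gI cf cg by (simp add: a_minus_def)
      finally have g'I: "g' \<in> I" using g'c by simp
      have coeff: "g' i = (f n \<otimes>\<^bsub>Gr\<^esub> g i) \<ominus>\<^bsub>Gr\<^esub> (g m \<otimes>\<^bsub>Gr\<^esub> f (i - (m - n)))" if i: "m \<le> i" for i
      proof -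
        have "up_ring.coeff (UP Gr) g' i = up_ring.coeff (UP Gr) ?a i \<ominus>\<^bsub>Gr\<^esub> up_ring.coeff (UP Gr) ?b i"
          unfolding g'_def using ac by simp
        also have "up_ring.coeff (UP Gr) ?a i = f n \<otimes>\<^bsub>Gr\<^esub> g i"
          using coeff_monom_mult[OF cf gc, of 0 i] by (simp add: coeff_UP[OF gc])
        also have "up_ring.coeff (UP Gr) ?b i = g m \<otimes>\<^bsub>Gr\<^esub> f (i - (m - n))"
          using coeff_monom_mult[OF cg fc, of "m - n" "i - (m - n)"] i nm by (simp add: coeff_UP[OF fc])
        finally show ?thesis by (simp add: coeff_UP[OF g'c])
      qed
      have snd_coeff: "snd (g' i) = snd (f n) \<otimes>\<^bsub>K\<^esub> snd (g i) \<ominus>\<^bsub>K\<^esub> snd (g m) \<otimes>\<^bsub>K\<^esub> snd (f (i - (m - n)))" if "m \<le> i" for i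
      proof -
        interpret sh: ring_hom_cring Gr K snd using snd_hom by unfold_locales
        have "g i \<in> carrier Gr" "f (i - (m - n)) \<in> carrier Gr" using UP_coeff_G[OF fc] UP_coeff_G[OF gc] by (simp_all add: Gr_simps(1))
        then show ?thesis unfolding coeff[OF that] a_minus_def using cf cg by (simp del: Gr_simps)
      qed
      have K: "snd (f i) \<in> carrier K" "snd (g i) \<in> carrier K" for i
        using UP_coeff_G[OF fc] UP_coeff_G[OF gc] G_closed(2) by blast+
      have "snd (g' i) = \<zero>\<^bsub>K\<^esub>" if i: "m \<le> i" for i
      proof (cases "i = m")
        case True
        then show ?thesis using snd_coeff[OF i] nm K K.m_comm[of "snd (f n)" "snd (g m)"] by (simp add: a_minus_def K.r_neg)
      next
        case False
        then have "m < i" using i by simp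
        then show ?thesis
          using snd_coeff[OF i] nm K snd_zero[OF gI, of i] snd_zero[OF fI, of "i - (m - n)"]
          by (simp add: a_minus_def m_def[symmetric] n_def[symmetric])
      qed
      then have "UnivPoly.deg K (snd \<circ> g') \<le> m - 1"
        using sp[OF g'I] by (intro UP_deg_le[OF cring_K]) auto
      then have "UnivPoly.deg K (snd \<circ> g') < UnivPoly.deg K (snd \<circ> g)" using \<open>n > 0\<close> nm by (simp add: m_def)
      then have "UnivPoly.eval Gr K snd \<alpha> g' = \<zero>\<^bsub>K\<^esub>" using less.hyps g'I by blast
      moreover have "UnivPoly.eval Gr K snd \<alpha> g' = UnivPoly.eval Gr K snd \<alpha> ?a \<ominus>\<^bsub>K\<^esub> UnivPoly.eval Gr K snd \<alpha> ?b"
        unfolding g'_def a_minus_def using ac by simp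
      moreover have "UnivPoly.eval Gr K snd \<alpha> ?b = \<zero>\<^bsub>K\<^esub>" using f0 fc cg by simp
      moreover have "UnivPoly.eval Gr K snd \<alpha> ?a = snd (f n) \<otimes>\<^bsub>K\<^esub> UnivPoly.eval Gr K snd \<alpha> g"
        using cf gc eval_monom'[OF Gr.is_cring cring_K snd_hom \<alpha>(1) cf, of 0] K by simp
      ultimately have "snd (f n) \<otimes>\<^bsub>K\<^esub> UnivPoly.eval Gr K snd \<alpha> g = \<zero>\<^bsub>K\<^esub>"
        using K gc by (simp add: a_minus_def)
      moreover have "snd (f n) \<noteq> \<zero>\<^bsub>K\<^esub>" using lead[OF f(1)] by (simp add: n_def)
      ultimately show ?thesis using K.integral[of "snd (f n)" "UnivPoly.eval Gr K snd \<alpha> g"] K gc evK.hom_closed by blast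
    qed
  qed
  then show ?thesis using \<alpha>(1) by blast
qed

text \<open>The new graph consists of the pairs of values at \<open>s\<close> and at the common root
  \<open>\<alpha>\<close> of all polynomials over \<open>Gr\<close>. Constants give back
  \<open>G\<close>, the indeterminate gives \<open>s\<close>, and single-valuedness is the common
  root property.\<close>

lemma extend_graph:
  assumes "has_roots K"
  shows "\<exists>G'. graph_hom S K G' \<and> G \<subseteq> G' \<and> s \<in> fst ` G'"
proof -
  interpret UP_cring Gr "UP Gr" using UP_cring_of[OF Gr.is_cring] .
  interpret W: cring "RDirProd S K" by (rule cring_W)
  obtain \<alpha> where \<alpha>: "\<alpha> \<in> carrier K" and root: "\<And>p. p \<in> I \<Longrightarrow> UnivPoly.eval Gr K snd \<alpha> p = \<zero>\<^bsub>K\<^esub>"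
    using exists_common_root[OF assms] by blast
  interpret evS: ring_hom_cring "UP Gr" S "UnivPoly.eval Gr S fst s"
    using eval_hom[OF Gr.is_cring S.is_cring fst_hom s] by unfold_locales
  interpret evK: ring_hom_cring "UP Gr" K "UnivPoly.eval Gr K snd \<alpha>"
    using eval_hom[OF Gr.is_cring cring_K snd_hom \<alpha>] by unfold_locales
  define e where "e p = (UnivPoly.eval Gr S fst s p, UnivPoly.eval Gr K snd \<alpha> p)" for p
  define G' where "G' = e ` carrier (UP Gr)"
  have "subring G' (RDirProd S K)"
  proof (rule W.subringI)
    fix x assume "x \<in> G'"
    then obtain p where p: "p \<in> carrier (UP Gr)" "x = e p" unfolding G'_def by blast
    then have "\<ominus>\<^bsub>RDirProd S K\<^esub> x = e (\<ominus>\<^bsub>UP Gr\<^esub> p)"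
      using RDirProd_a_inv[OF S.is_cring cring_K] by (simp add: e_def)
    then show "\<ominus>\<^bsub>RDirProd S K\<^esub> x \<in> G'" unfolding G'_def using p by simp
  next
    fix x y assume "x \<in> G'" "y \<in> G'"
    then obtain p q where p: "p \<in> carrier (UP Gr)" "x = e p" "q \<in> carrier (UP Gr)" "y = e q"
      unfolding G'_def by blast
    then have "x \<otimes>\<^bsub>RDirProd S K\<^esub> y = e (p \<otimes>\<^bsub>UP Gr\<^esub> q)" "x \<oplus>\<^bsub>RDirProd S K\<^esub> y = e (p \<oplus>\<^bsub>UP Gr\<^esub> q)"
      by (simp_all add: e_def)
    then show "x \<otimes>\<^bsub>RDirProd S K\<^esub> y \<in> G'" "x \<oplus>\<^bsub>RDirProd S K\<^esub> y \<in> G'" unfolding G'_def using p by simp_all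
  next
    have "\<one>\<^bsub>RDirProd S K\<^esub> = e \<one>\<^bsub>UP Gr\<^esub>" by (simp add: e_def)
    then show "\<one>\<^bsub>RDirProd S K\<^esub> \<in> G'" unfolding G'_def by simp
  qed (auto simp: G'_def e_def)
  moreover have "y = \<zero>\<^bsub>K\<^esub>" if "(\<zero>, y) \<in> G'" for y
    using that root unfolding G'_def e_def by auto
  moreover have "G \<subseteq> G'"
  proof
    fix g assume "g \<in> G"
    then have g: "g \<in> carrier Gr" by (simp add: Gr_simps(1))
    then have "e (up_ring.monom (UP Gr) g 0) = g"
      using eval_monom'[OF Gr.is_cring S.is_cring fst_hom s g, of 0]
        eval_monom'[OF Gr.is_cring cring_K snd_hom \<alpha> g, of 0] G_closed[OF \<open>g \<in> G\<close>]
      by (simp add: e_def)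
    moreover have "up_ring.monom (UP Gr) g 0 \<in> carrier (UP Gr)" using g by simp
    ultimately show "g \<in> G'" unfolding G'_def by force
  qed
  moreover have "s \<in> fst ` G'"
  proof -
    have "fst (e (up_ring.monom (UP Gr) \<one>\<^bsub>Gr\<^esub> 1)) = s"
      using eval_monom'[OF Gr.is_cring S.is_cring fst_hom s Gr.one_closed, of 1] s by (simp add: e_def Gr_simps)
    moreover have "up_ring.monom (UP Gr) \<one>\<^bsub>Gr\<^esub> 1 \<in> carrier (UP Gr)" by simp
    ultimately show ?thesis unfolding G'_def by force
  qed
  ultimately show ?thesis unfolding graph_hom_def by blast
qed

end

section \<open>The extension theorem\<close>

text \<open>Zorn's lemma for graphs containing that of \<open>\<phi>\<close>: the domain of a
  maximal one contains every \<open>s\<close>, since \<open>extend_graph\<close> would enlarge it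
  otherwise.\<close>

theorem integral_extension_hom_extends:
  assumes S: "cring S" and K: "field K" and roots: "has_roots K" and B: "subring B S"
    and int: "\<And>s. s \<in> carrier S \<Longrightarrow> cring.integral_over S B s"
    and \<phi>: "\<phi> \<in> ring_hom (S\<lparr>carrier := B\<rparr>) K"
  shows "\<exists>\<psi>\<in>ring_hom S K. \<forall>b\<in>B. \<psi> b = \<phi> b"
proof -
  interpret S: cring S by fact
  interpret K: field K by fact
  interpret W: cring "RDirProd S K" using RDirProd_cring[OF S] K.is_cring by blast
  interpret B: cring "S\<lparr>carrier := B\<rparr>" using subring_is_cring[OF S B] .
  interpret \<phi>: ring_hom_cring "S\<lparr>carrier := B\<rparr>" K \<phi> using \<phi> by unfold_locales
  note sB = S.subring_cl[OF B]
  define G0 where "G0 = (\<lambda>b. (b, \<phi> b)) ` B"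
  define \<A> where "\<A> = {G. graph_hom S K G \<and> G0 \<subseteq> G}"
  have \<phi>B: "\<phi> b \<in> carrier K" if "b \<in> B" for b using \<phi>.hom_closed that by simp
  have "subring G0 (RDirProd S K)"
  proof (rule W.subringI)
    fix x assume "x \<in> G0"
    then obtain b where b: "b \<in> B" "x = (b, \<phi> b)" unfolding G0_def by blast
    have "\<phi> b \<oplus>\<^bsub>K\<^esub> \<phi> (\<ominus>\<^bsub>S\<^esub> b) = \<phi> (b \<oplus>\<^bsub>S\<^esub> \<ominus>\<^bsub>S\<^esub> b)" using \<phi>.hom_add[of b "\<ominus>\<^bsub>S\<^esub> b"] b sB(6) by simp
    also have "\<dots> = \<zero>\<^bsub>K\<^esub>" using \<phi>.hom_zero b sB(1) S.r_neg[of b] by auto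
    finally have "\<phi> (\<ominus>\<^bsub>S\<^esub> b) = \<ominus>\<^bsub>K\<^esub> \<phi> b"
      using K.minus_equality[of "\<phi> (\<ominus>\<^bsub>S\<^esub> b)" "\<phi> b"] \<phi>B b(1) sB(6) K.a_comm by simp
    then have "\<ominus>\<^bsub>RDirProd S K\<^esub> x = (\<ominus>\<^bsub>S\<^esub> b, \<phi> (\<ominus>\<^bsub>S\<^esub> b))"
      using RDirProd_a_inv[OF S K.is_cring] b sB(1) \<phi>B by auto
    then show "\<ominus>\<^bsub>RDirProd S K\<^esub> x \<in> G0" unfolding G0_def using b(1) sB(6) by simp
  next
    fix x y assume "x \<in> G0" "y \<in> G0"
    then obtain b c where b: "b \<in> B" "x = (b, \<phi> b)" "c \<in> B" "y = (c, \<phi> c)" unfolding G0_def by blast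
    then show "x \<otimes>\<^bsub>RDirProd S K\<^esub> y \<in> G0" "x \<oplus>\<^bsub>RDirProd S K\<^esub> y \<in> G0"
      unfolding G0_def using \<phi>.hom_mult[of b c] \<phi>.hom_add[of b c] sB(4,5) by (simp_all add: image_iff)
  next
    show "\<one>\<^bsub>RDirProd S K\<^esub> \<in> G0" unfolding G0_def using \<phi>.hom_one sB(3) by (simp add: image_iff)
  qed (use sB(1) \<phi>B in \<open>auto simp: G0_def\<close>)
  then have "G0 \<in> \<A>" unfolding \<A>_def graph_hom_def using \<phi>.hom_zero by (auto simp: G0_def)
  have "\<Union>C \<in> \<A>" if C: "C \<noteq> {}" "subset.chain \<A> C" for C
  proof -
    have CA: "G \<in> C \<Longrightarrow> graph_hom S K G \<and> G0 \<subseteq> G" for G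
      using C(2) unfolding subset.chain_def \<A>_def by blast
    have sub: "subring G (RDirProd S K)" if "G \<in> C" for G using CA[OF that] by (simp add: graph_hom_def)
    have comp: "G \<subseteq> H \<or> H \<subseteq> G" if "G \<in> C" "H \<in> C" for G H
      using C(2) that unfolding subset.chain_def by auto
    have "subring (\<Union>C) (RDirProd S K)"
    proof (rule W.subringI)
      show "\<Union>C \<subseteq> carrier (RDirProd S K)" using subringE(1)[OF sub] by blast
      show "\<one>\<^bsub>RDirProd S K\<^esub> \<in> \<Union>C" using subringE(3)[OF sub] C(1) by blast
      show "\<ominus>\<^bsub>RDirProd S K\<^esub> x \<in> \<Union>C" if "x \<in> \<Union>C" for x using subringE(5)[OF sub] that by blast
      fix x y assume "x \<in> \<Union>C" "y \<in> \<Union>C"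
      then obtain G H where "G \<in> C" "x \<in> G" "H \<in> C" "y \<in> H" by blast
      then obtain G where G: "G \<in> C" "x \<in> G" "y \<in> G" using comp by blast
      show "x \<otimes>\<^bsub>RDirProd S K\<^esub> y \<in> \<Union>C" "x \<oplus>\<^bsub>RDirProd S K\<^esub> y \<in> \<Union>C"
        using subringE(6,7)[OF sub[OF G(1)] G(2,3)] G(1) by blast+
    qed
    moreover have "y = \<zero>\<^bsub>K\<^esub>" if "(\<zero>\<^bsub>S\<^esub>, y) \<in> \<Union>C" for y using that CA unfolding graph_hom_def by blast
    moreover have "G0 \<subseteq> \<Union>C" using CA C(1) by blast
    ultimately show ?thesis unfolding \<A>_def graph_hom_def by blast
  qed
  then obtain G where G: "G \<in> \<A>" and max: "\<And>H. H \<in> \<A> \<Longrightarrow> G \<subseteq> H \<Longrightarrow> H = G"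
    using subset_Zorn_nonempty[of \<A>] \<open>G0 \<in> \<A>\<close> by blast
  have gG: "graph_hom S K G" and G0: "G0 \<subseteq> G" using G by (auto simp: \<A>_def)
  have BG: "B \<subseteq> fst ` G" using G0 unfolding G0_def by force
  have full: "s \<in> fst ` G" if s: "s \<in> carrier S" for s
  proof -
    interpret integral_graph_hom S K G s
      using gG s S.integral_over_mono[OF BG int[OF s]] by unfold_locales
    obtain H where "graph_hom S K H" "G \<subseteq> H" "s \<in> fst ` H" using extend_graph[OF roots] by blast
    then show ?thesis using max[of H] G0 by (auto simp: \<A>_def)
  qed
  have sub: "subring G (RDirProd S K)" using gG by (simp add: graph_hom_def)
  have Gc: "(a, x) \<in> G \<Longrightarrow> a \<in> carrier S \<and> x \<in> carrier K" for a x using subringE(1)[OF sub] by auto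
  \<comment> \<open>Subtracting two pairs with the same first entry leads to a pair over zero, the
    only case that \<open>graph_hom\<close> mentions.\<close>
  have unique: "x = y" if "(a, x) \<in> G" "(a, y) \<in> G" for a x y
  proof -
    have c: "a \<in> carrier S" "x \<in> carrier K" "y \<in> carrier K" using Gc that by auto
    have "(a, x) \<oplus>\<^bsub>RDirProd S K\<^esub> \<ominus>\<^bsub>RDirProd S K\<^esub> (a, y) \<in> G"
      using subringE(7)[OF sub that(1) subringE(5)[OF sub that(2)]] .
    then have "(\<zero>\<^bsub>S\<^esub>, x \<ominus>\<^bsub>K\<^esub> y) \<in> G"
      using RDirProd_a_inv[OF S K.is_cring c(1,3)] c by (simp add: S.r_neg a_minus_def)
    then have "x \<ominus>\<^bsub>K\<^esub> y = \<zero>\<^bsub>K\<^esub>" using gG by (simp add: graph_hom_def)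
    then show ?thesis using c by simp
  qed
  define \<psi> where "\<psi> a = (THE x. (a, x) \<in> G)" for a
  have \<psi>: "\<psi> a = x" if "(a, x) \<in> G" for a x unfolding \<psi>_def using that unique by (intro the_equality) auto
  have \<psi>G: "(a, \<psi> a) \<in> G" if "a \<in> carrier S" for a using full[OF that] \<psi> by force
  have "\<psi> \<in> ring_hom S K"
  proof (rule ring_hom_memI)
    show "\<psi> a \<in> carrier K" if "a \<in> carrier S" for a using Gc \<psi>G[OF that] by blast
    show "\<psi> \<one>\<^bsub>S\<^esub> = \<one>\<^bsub>K\<^esub>" using subringE(3)[OF sub] by (intro \<psi>) simp
    fix a b assume "a \<in> carrier S" "b \<in> carrier S"
    note g = \<psi>G[OF this(1)] \<psi>G[OF this(2)]
    show "\<psi> (a \<otimes>\<^bsub>S\<^esub> b) = \<psi> a \<otimes>\<^bsub>K\<^esub> \<psi> b" using subringE(6)[OF sub g] by (intro \<psi>) simp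
    show "\<psi> (a \<oplus>\<^bsub>S\<^esub> b) = \<psi> a \<oplus>\<^bsub>K\<^esub> \<psi> b" using subringE(7)[OF sub g] by (intro \<psi>) simp
  qed
  moreover have "\<psi> b = \<phi> b" if "b \<in> B" for b using G0 that unfolding G0_def by (intro \<psi>) blast
  ultimately show ?thesis by blast
qed

section \<open>Splitting of monic polynomials\<close>

text \<open>The factor is \<open>X + c\<close>, with root \<open>\<ominus> c\<close>, as in the definition of \<^const>\<open>ai_closed\<close>.\<close>

definition linear_factor :: "('a, 'm) ring_scheme \<Rightarrow> 'a \<Rightarrow> nat \<Rightarrow> 'a" where
  "linear_factor R c = up_ring.monom (UP R) \<one>\<^bsub>R\<^esub> 1 \<oplus>\<^bsub>UP R\<^esub> up_ring.monom (UP R) c 0"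

lemma linear_factor_closed:
  assumes "cring R" "c \<in> carrier R" shows "linear_factor R c \<in> carrier (UP R)"
proof -
  interpret UP_cring R "UP R" using UP_cring_of[OF assms(1)] .
  show ?thesis using assms(2) by (simp add: linear_factor_def)
qed

lemma eval_linear_factor:
  assumes "cring R" "cring S" "h \<in> ring_hom R S" "s \<in> carrier S" "c \<in> carrier R"
  shows "UnivPoly.eval R S h s (linear_factor R c) = s \<oplus>\<^bsub>S\<^esub> h c"
proof -
  interpret R: UP_cring R "UP R" using UP_cring_of[OF assms(1)] .
  interpret S: cring S by fact
  have m: "up_ring.monom (UP R) \<one>\<^bsub>R\<^esub> 1 \<in> carrier (UP R)" "up_ring.monom (UP R) c 0 \<in> carrier (UP R)"
    using assms(5) by simp_all
  show ?thesis
    unfolding linear_factor_def ring_hom_add[OF eval_hom[OF assms(1-4)] m]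
    using eval_monom'[OF assms(1-4) R.R.one_closed, of 1] eval_monom'[OF assms(1-5), of 0]
      ring_hom_one[OF assms(3)] ring_hom_closed[OF assms(3,5)] assms(4) by simp
qed

lemma eval_prod_linear_factors:
  assumes R: "cring R" and S: "cring S" and h: "h \<in> ring_hom R S" and s: "s \<in> carrier S"
    and c: "c \<in> {..<n::nat} \<rightarrow> carrier R"
  shows "UnivPoly.eval R S h s (\<Otimes>\<^bsub>UP R\<^esub>i\<in>{..<n}. linear_factor R (c i)) = (\<Otimes>\<^bsub>S\<^esub>i\<in>{..<n}. s \<oplus>\<^bsub>S\<^esub> h (c i))"
proof -
  interpret P: cring "UP R" using UP_is_cring[OF R] .
  interpret S: cring S by fact
  interpret e: ring_hom_cring "UP R" S "UnivPoly.eval R S h s"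
    using eval_hom[OF R S h s] by unfold_locales
  have ci: "c i \<in> carrier R" if "i \<in> {..<n}" for i using c that by (rule funcset_mem)
  have "(\<lambda>i. linear_factor R (c i)) \<in> {..<n} \<rightarrow> carrier (UP R)"
    by (rule funcsetI) (rule linear_factor_closed[OF R ci])
  then have "UnivPoly.eval R S h s (\<Otimes>\<^bsub>UP R\<^esub>i\<in>{..<n}. linear_factor R (c i))
      = (\<Otimes>\<^bsub>S\<^esub>i\<in>{..<n}. (UnivPoly.eval R S h s \<circ> (\<lambda>i. linear_factor R (c i))) i)"
    by (rule e.hom_finprod)
  also have "\<dots> = (\<Otimes>\<^bsub>S\<^esub>i\<in>{..<n}. s \<oplus>\<^bsub>S\<^esub> h (c i))"
  proof (rule S.finprod_cong')
    fix i assume "i \<in> {..<n}"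
    then show "(UnivPoly.eval R S h s \<circ> (\<lambda>i. linear_factor R (c i))) i = s \<oplus>\<^bsub>S\<^esub> h (c i)"
      using eval_linear_factor[OF R S h s ci] by simp
  next
    show "(\<lambda>i. s \<oplus>\<^bsub>S\<^esub> h (c i)) \<in> {..<n} \<rightarrow> carrier S"
      by (rule funcsetI) (rule S.a_closed[OF s ring_hom_closed[OF h ci]])
  qed (rule refl)
  finally show ?thesis .
qed

lemma (in domain) finprod_zero_imp_factor:
  assumes "finite A" "f \<in> A \<rightarrow> carrier R" "(\<Otimes>i\<in>A. f i) = \<zero>" shows "\<exists>i\<in>A. f i = \<zero>"
  using assms
proof (induction A rule: finite_induct)
  case (insert a A)
  then have f: "f a \<in> carrier R" "f \<in> A \<rightarrow> carrier R" by auto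
  have "f a \<otimes> (\<Otimes>i\<in>A. f i) = \<zero>" using insert.prems(2) finprod_insert[OF insert.hyps f(2,1)] by simp
  from integral[OF this f(1) finprod_closed[OF f(2)]] show ?case
  proof
    assume "(\<Otimes>i\<in>A. f i) = \<zero>"
    from insert.IH[OF f(2) this] show ?case by (rule bexE) (rule bexI[OF _ insertI2])
  qed (rule bexI[OF _ insertI1])
qed (use one_not_zero in simp)

lemma root_of_prod_linear_factors:
  assumes R: "cring R" and S: "domain S" and h: "h \<in> ring_hom R S" and s: "s \<in> carrier S"
    and c: "c \<in> {..<n::nat} \<rightarrow> carrier R"
    and root: "UnivPoly.eval R S h s (\<Otimes>\<^bsub>UP R\<^esub>i\<in>{..<n}. linear_factor R (c i)) = \<zero>\<^bsub>S\<^esub>"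
  shows "\<exists>i<n. s = \<ominus>\<^bsub>S\<^esub> h (c i)"
proof -
  interpret S: domain S by fact
  have hc: "h (c i) \<in> carrier S" if "i < n" for i
    by (rule ring_hom_closed[OF h funcset_mem[OF c]]) (use that in simp)
  have "(\<Otimes>\<^bsub>S\<^esub>i\<in>{..<n}. s \<oplus>\<^bsub>S\<^esub> h (c i)) = \<zero>\<^bsub>S\<^esub>"
    using root eval_prod_linear_factors[OF R S.is_cring h s c] by simp
  then obtain i where "i < n" "s \<oplus>\<^bsub>S\<^esub> h (c i) = \<zero>\<^bsub>S\<^esub>"
    using S.finprod_zero_imp_factor[of "{..<n}" "\<lambda>i. s \<oplus>\<^bsub>S\<^esub> h (c i)"] s hc by auto
  then show ?thesis using S.sum_zero_eq_neg[OF s hc] by blast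
qed

lemma prod_linear_factors_root:
  assumes R: "cring R" and S: "cring S" and h: "h \<in> ring_hom R S"
    and c: "c \<in> {..<n::nat} \<rightarrow> carrier R" and i: "i < n"
  shows "UnivPoly.eval R S h (\<ominus>\<^bsub>S\<^esub> h (c i)) (\<Otimes>\<^bsub>UP R\<^esub>i\<in>{..<n}. linear_factor R (c i)) = \<zero>\<^bsub>S\<^esub>"
proof -
  interpret S: cring S by fact
  have hc: "h (c i) \<in> carrier S" if "i < n" for i
    by (rule ring_hom_closed[OF h funcset_mem[OF c]]) (use that in simp)
  let ?f = "\<lambda>j. \<ominus>\<^bsub>S\<^esub> h (c i) \<oplus>\<^bsub>S\<^esub> h (c j)"
  have fc: "?f \<in> {..<n} - {i} \<rightarrow> carrier S"
    by (rule funcsetI, rule S.a_closed[OF S.a_inv_closed[OF hc[OF i]] hc]) simp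
  have f0: "?f i = \<zero>\<^bsub>S\<^esub>" by (rule S.l_neg[OF hc[OF i]])
  have e: "insert i ({..<n} - {i}) = {..<n}" using i by auto
  have "(\<Otimes>\<^bsub>S\<^esub>j\<in>insert i ({..<n} - {i}). ?f j) = ?f i \<otimes>\<^bsub>S\<^esub> (\<Otimes>\<^bsub>S\<^esub>j\<in>{..<n} - {i}. ?f j)"
    by (rule S.finprod_insert[OF _ _ fc]) (simp_all add: f0)
  also have "\<dots> = \<zero>\<^bsub>S\<^esub>" unfolding f0 by (rule S.l_null[OF S.finprod_closed[OF fc]])
  finally show ?thesis
    unfolding e eval_prod_linear_factors[OF R S h S.a_inv_closed[OF hc[OF i]] c] .
qed

text \<open>Induction on \<open>n\<close>, splitting off a root by the remainder theorem. The number
  of factors is part of the statement because splittings in all coordinates of a product are later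
  combined factor by factor.\<close>

lemma monic_splits:
  assumes K: "field K" and roots: "has_roots K"
    and p: "p \<in> carrier (UP K)" "p n = \<one>\<^bsub>K\<^esub>" "\<And>i. n < i \<Longrightarrow> p i = \<zero>\<^bsub>K\<^esub>"
  shows "\<exists>c. c \<in> {..<n} \<rightarrow> carrier K \<and> p = (\<Otimes>\<^bsub>UP K\<^esub>i\<in>{..<n}. linear_factor K (c i))"
  using p
proof (induction n arbitrary: p)
  case 0
  interpret field K by fact
  interpret P: cring "UP K" by (rule UP_is_cring[OF is_cring])
  have "p i = \<one>\<^bsub>UP K\<^esub> i" for i
    using 0(2) 0(3)[of i] by (cases i) (simp_all add: UP_def)
  then have "p = \<one>\<^bsub>UP K\<^esub>" by (rule ext)
  then have "p = (\<Otimes>\<^bsub>UP K\<^esub>i\<in>{..<0::nat}. linear_factor K (undefined i))"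
    unfolding lessThan_0 P.finprod_empty .
  then show ?case by (intro exI[of _ undefined] conjI) simp_all
next
  case (Suc n)
  interpret K: field K by fact
  have cK: "cring K" by unfold_locales
  interpret UP_domain K "UP K" by (simp add: UP_domain_def K.domain_axioms)
  have deg: "UnivPoly.deg K p = Suc n"
    using UP_deg_le[OF cK Suc.prems(1,3)] UP_le_deg[OF cK Suc.prems(1), of "Suc n"] Suc.prems(2)
    by (simp add: le_antisym)
  then obtain a where a: "a \<in> carrier K" "UnivPoly.eval K K id a p = \<zero>\<^bsub>K\<^esub>"
    using roots Suc.prems(1) unfolding has_roots_def by force
  have nt: "carrier K \<noteq> {\<zero>\<^bsub>K\<^esub>}" using K.one_not_zero K.one_closed by blast
  let ?g = "up_ring.monom (UP K) \<one>\<^bsub>K\<^esub> 1 \<ominus>\<^bsub>UP K\<^esub> up_ring.monom (UP K) a 0"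
  have g: "?g = linear_factor K (\<ominus>\<^bsub>K\<^esub> a)"
    unfolding linear_factor_def a_minus_def using a(1) by simp
  have gc: "?g \<in> carrier (UP K)" using a(1) by simp
  obtain q where q0: "q \<in> carrier (UP K)"
    "p = ?g \<otimes>\<^bsub>UP K\<^esub> q \<oplus>\<^bsub>UP K\<^esub> up_ring.monom (UP K) (UnivPoly.eval K K id a p) 0"
    using remainder_theorem[OF Suc.prems(1) a(1) nt] by blast
  have "p = ?g \<otimes>\<^bsub>UP K\<^esub> q" using q0(2) unfolding a(2) using gc q0(1) by simp
  note q = q0(1) this
  have qcl: "q i \<in> carrier K" for i using q carrier_UP_iff by blast
  \<comment> \<open>Comparing coefficients in \<open>p = (X - a) q\<close> shows that the quotient
    is monic again, so that the induction hypothesis applies.\<close>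
  have coeff: "p (Suc i) = q i \<ominus>\<^bsub>K\<^esub> a \<otimes>\<^bsub>K\<^esub> q (Suc i)" for i
  proof -
    let ?m1 = "up_ring.monom (UP K) \<one>\<^bsub>K\<^esub> 1" and ?ma = "up_ring.monom (UP K) (\<ominus>\<^bsub>K\<^esub> a) 0"
    have m: "?m1 \<in> carrier (UP K)" "?ma \<in> carrier (UP K)" using a by auto
    have "p = ?m1 \<otimes>\<^bsub>UP K\<^esub> q \<oplus>\<^bsub>UP K\<^esub> ?ma \<otimes>\<^bsub>UP K\<^esub> q"
      unfolding q(2) g linear_factor_def using m q(1) by (rule P.l_distr)
    then have "up_ring.coeff (UP K) p (Suc i)
        = up_ring.coeff (UP K) (?m1 \<otimes>\<^bsub>UP K\<^esub> q) (Suc i) \<oplus>\<^bsub>K\<^esub> up_ring.coeff (UP K) (?ma \<otimes>\<^bsub>UP K\<^esub> q) (Suc i)"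
      using m q(1) by simp
    also have "up_ring.coeff (UP K) (?m1 \<otimes>\<^bsub>UP K\<^esub> q) (Suc i) = q i"
      using coeff_monom_mult[OF K.one_closed q(1), of 1 i] qcl by (simp add: coeff_UP[OF q(1)])
    also have "up_ring.coeff (UP K) (?ma \<otimes>\<^bsub>UP K\<^esub> q) (Suc i) = \<ominus>\<^bsub>K\<^esub> a \<otimes>\<^bsub>K\<^esub> q (Suc i)"
      using coeff_monom_mult[OF K.a_inv_closed[OF a(1)] q(1), of 0 "Suc i"] by (simp add: coeff_UP[OF q(1)])
    finally show ?thesis using a(1) qcl by (simp add: coeff_UP[OF Suc.prems(1)] a_minus_def K.l_minus)
  qed
  have q0: "q \<noteq> \<zero>\<^bsub>UP K\<^esub>"
  proof
    assume "q = \<zero>\<^bsub>UP K\<^esub>"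
    then have "q i = \<zero>\<^bsub>K\<^esub>" for i by (simp add: UP_def)
    then show False using coeff[of n] Suc.prems(2) a(1) by (simp add: a_minus_def)
  qed
  have g1: "UnivPoly.deg K ?g = 1" using deg_minus_monom[OF a(1) nt] by simp
  have g0: "?g \<noteq> \<zero>\<^bsub>UP K\<^esub>" using g1 deg_zero by force
  have "UnivPoly.deg K q = n" using deg_mult[OF g0 q0 gc q(1)] q(2) deg g1 by simp
  then have qz: "q i = \<zero>\<^bsub>K\<^esub>" if "n < i" for i using UP_above_deg[OF cK q(1)] that by simp
  then have "q n = \<one>\<^bsub>K\<^esub>" using coeff[of n] Suc.prems(2) a(1) qcl[of n] by (simp add: a_minus_def)
  then obtain c where c: "c \<in> {..<n} \<rightarrow> carrier K" "q = (\<Otimes>\<^bsub>UP K\<^esub>i\<in>{..<n}. linear_factor K (c i))"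
    using Suc.IH[OF q(1) _ qz] by blast
  let ?c = "c(n := \<ominus>\<^bsub>K\<^esub> a)"
  have ci: "c i \<in> carrier K" if "i < n" for i using funcset_mem[OF c(1)] that by simp
  have lf: "linear_factor K (?c i) \<in> carrier (UP K)" if "i \<le> n" for i
    by (rule linear_factor_closed[OF cK]) (use ci[of i] a(1) that in auto)
  have "(\<Otimes>\<^bsub>UP K\<^esub>i\<in>insert n {..<n}. linear_factor K (?c i))
      = linear_factor K (?c n) \<otimes>\<^bsub>UP K\<^esub> (\<Otimes>\<^bsub>UP K\<^esub>i\<in>{..<n}. linear_factor K (?c i))"
    by (rule P.finprod_insert, simp, simp, rule funcsetI, rule lf, simp, rule lf, simp)
  also have "(\<Otimes>\<^bsub>UP K\<^esub>i\<in>{..<n}. linear_factor K (?c i)) = q"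
    unfolding c(2) by (rule P.finprod_cong') (use linear_factor_closed[OF cK ci] in auto)
  finally have "p = (\<Otimes>\<^bsub>UP K\<^esub>i\<in>{..<Suc n}. linear_factor K (?c i))"
    unfolding q(2) g by (simp add: lessThan_Suc)
  moreover have "?c \<in> {..<Suc n} \<rightarrow> carrier K" using c(1) a(1) by (auto simp: less_Suc_eq)
  ultimately show ?case by blast
qed

text \<open>Each root is \<open>\<ominus> c i\<close> for one of the \<open>n\<close> factors.
  Finiteness is what later makes an injective self-map of the roots surjective.\<close>

lemma finite_roots_monic:
  assumes K: "field K" and roots: "has_roots K"
    and p: "p \<in> carrier (UP K)" "p n = \<one>\<^bsub>K\<^esub>" "\<And>i. n < i \<Longrightarrow> p i = \<zero>\<^bsub>K\<^esub>"
  shows "finite {x \<in> carrier K. UnivPoly.eval K K id x p = \<zero>\<^bsub>K\<^esub>}"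
proof -
  interpret K: field K by fact
  obtain c where c: "c \<in> {..<n} \<rightarrow> carrier K" "p = (\<Otimes>\<^bsub>UP K\<^esub>i\<in>{..<n}. linear_factor K (c i))"
    using monic_splits[OF assms] by blast
  have "{x \<in> carrier K. UnivPoly.eval K K id x p = \<zero>\<^bsub>K\<^esub>} \<subseteq> (\<lambda>i. \<ominus>\<^bsub>K\<^esub> c i) ` {..<n}"
    using root_of_prod_linear_factors[OF K.is_cring K.domain_axioms id_ring_hom _ c(1)] c(2) by auto
  then show ?thesis using finite_subset by blast
qed

lemma algebraically_closed_has_roots:
  assumes "algebraically_closed K" shows "has_roots K"
  unfolding has_roots_def
proof (intro ballI impI)
  interpret algebraically_closed K by fact
  fix p assume p: "p \<in> carrier (UP K)" "UnivPoly.deg K p > 0"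
  define n where "n = UnivPoly.deg K p"
  have pc: "p i \<in> carrier K" for i using p carrier_UP_iff by blast
  have pn: "p n \<noteq> \<zero>\<^bsub>K\<^esub>"
    using UP_ring.lcoeff_nonzero_deg[of K p] p coeff_UP[OF p(1)] ring_axioms by (simp add: UP_ring_def n_def)
  \<comment> \<open>The coefficients up to index \<open>m\<close> from the highest down, the order
    used by list polynomials. Truncation at every \<open>m\<close> is allowed so that Horner
    evaluation can be unfolded by induction.\<close>
  define P where "P m = map p (rev [0..<Suc m])" for m
  have Psuc: "P (Suc m) = p (Suc m) # P m" for m by (simp add: P_def)
  have "hd (P n) = p n" by (simp add: P_def)
  then have P: "P n \<in> carrier (poly_ring K)"
    using pc pn unfolding univ_poly_carrier[symmetric] polynomial_def by (auto simp: P_def)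
  have dP: "length (P m) = Suc m" for m by (simp add: P_def)
  have "size (roots (P n)) = n" using roots_over_carrier[OF P] dP[of n] by (simp add: splitted_def)
  then obtain x where "x \<in># roots (P n)" using p(2) by (metis n_def multiset_nonemptyE nless_le size_empty)
  then have x: "x \<in> carrier K" "ring.eval K (P n) x = \<zero>\<^bsub>K\<^esub>"
    using roots_mem_iff_is_root[OF P] by (auto simp: is_root_def)
  have "ring.eval K (P m) x = (\<Oplus>\<^bsub>K\<^esub>i\<in>{..m}. p i \<otimes>\<^bsub>K\<^esub> x [^]\<^bsub>K\<^esub> i)" for m
  proof (induction m)
    case 0
    then show ?case using pc x by (simp add: P_def)
  next
    case (Suc m)
    have "ring.eval K (P (Suc m)) x = p (Suc m) \<otimes>\<^bsub>K\<^esub> x [^]\<^bsub>K\<^esub> (Suc m) \<oplus>\<^bsub>K\<^esub> ring.eval K (P m) x"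
      unfolding Psuc using dP[of m] by simp
    then show ?case unfolding Suc using pc x by (subst finsum_Suc) auto
  qed
  then have "(\<Oplus>\<^bsub>K\<^esub>i\<in>{..n}. p i \<otimes>\<^bsub>K\<^esub> x [^]\<^bsub>K\<^esub> i) = \<zero>\<^bsub>K\<^esub>" using x(2) by simp
  then have "UnivPoly.eval K K id x p = \<zero>\<^bsub>K\<^esub>"
    using eval_eq_finsum[OF is_cring is_cring id_ring_hom x(1) p(1) UP_above_deg[OF is_cring p(1)]]
    by (simp add: n_def)
  then show "\<exists>x\<in>carrier K. UnivPoly.eval K K id x p = \<zero>\<^bsub>K\<^esub>" using x(1) by blast
qed

section \<open>The field of fractions\<close>

context "domain"
begin

lemma fraction_eqI:
  assumes "a \<in> carrier R" "b \<in> carrier R - {\<zero>}" "c \<in> carrier R" "d \<in> carrier R - {\<zero>}"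
    and eq: "a \<otimes> d = c \<otimes> b"
  shows "fraction R a b = fraction R c d"
proof -
  have sub: "fraction R a b \<subseteq> fraction R c d"
    if h: "a \<in> carrier R" "b \<in> carrier R - {\<zero>}" "c \<in> carrier R" "d \<in> carrier R - {\<zero>}" "a \<otimes> d = c \<otimes> b" for a b c d
  proof
    fix z assume "z \<in> fraction R a b"
    then obtain x y where z: "z = (x, y)" "x \<in> carrier R" "y \<in> carrier R - {\<zero>}" "a \<otimes> y = x \<otimes> b"
      by (auto simp: fraction_def)
    have b: "b \<in> carrier R" "b \<noteq> \<zero>" "d \<in> carrier R" "y \<in> carrier R" using h z by auto
    have "b \<otimes> (c \<otimes> y) = (c \<otimes> b) \<otimes> y" using b(1,4) h(3) by (simp add: m_ac)
    also have "\<dots> = (a \<otimes> y) \<otimes> d" unfolding h(5)[symmetric] using b(3,4) h(1) by (simp add: m_ac)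
    also have "\<dots> = b \<otimes> (x \<otimes> d)" unfolding z(4) using b(1,3) z(2) by (simp add: m_ac)
    finally have "c \<otimes> y = x \<otimes> d" using m_lcancel[of b "c \<otimes> y" "x \<otimes> d"] b h z by auto
    then show "z \<in> fraction R c d" using z by (simp add: fraction_def)
  qed
  show ?thesis using sub[OF assms] sub[OF assms(3,4,1,2) eq[symmetric]] by blast
qed

lemma fraction_memI: "\<lbrakk>a \<in> carrier R; b \<in> carrier R - {\<zero>}\<rbrakk> \<Longrightarrow> (a, b) \<in> fraction R a b"
  by (simp add: fraction_def)

lemma fraction_eqD:
  assumes "a \<in> carrier R" "b \<in> carrier R - {\<zero>}" "fraction R a b = fraction R c d"
  shows "c \<otimes> b = a \<otimes> d"
  using fraction_memI[OF assms(1,2)] unfolding assms(3) by (simp add: fraction_def)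

lemma nonzero_mult: "\<lbrakk>b \<in> carrier R - {\<zero>}; d \<in> carrier R - {\<zero>}\<rbrakk> \<Longrightarrow> b \<otimes> d \<in> carrier R - {\<zero>}"
  using integral by auto

text \<open>Independence of representatives: all sets in the union that defines the product
  coincide, so the union collapses to any one of them.\<close>

lemma fraction_mult:
  assumes h: "a \<in> carrier R" "b \<in> carrier R - {\<zero>}" "c \<in> carrier R" "d \<in> carrier R - {\<zero>}"
  shows "fraction R a b \<otimes>\<^bsub>fraction_field R\<^esub> fraction R c d = fraction R (a \<otimes> c) (b \<otimes> d)"
proof -
  have "fraction R (fst p \<otimes> fst q) (snd p \<otimes> snd q) = fraction R (a \<otimes> c) (b \<otimes> d)"
    if "p \<in> fraction R a b" "q \<in> fraction R c d" for p q
  proof -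
    obtain x y x' y' where p: "p = (x, y)" "q = (x', y')" by (cases p; cases q) auto
    have e: "a \<otimes> y = x \<otimes> b" "c \<otimes> y' = x' \<otimes> d" using that p by (auto simp: fraction_def)
    have k: "x \<in> carrier R" "y \<in> carrier R - {\<zero>}" "x' \<in> carrier R" "y' \<in> carrier R - {\<zero>}"
      using that p by (auto simp: fraction_def)
    have k': "y \<in> carrier R" "y' \<in> carrier R" "b \<in> carrier R" "d \<in> carrier R" using k h by auto
    have "(x \<otimes> x') \<otimes> (b \<otimes> d) = (x \<otimes> b) \<otimes> (x' \<otimes> d)" using k(1,3) k' by (simp add: m_ac)
    also have "\<dots> = (a \<otimes> c) \<otimes> (y \<otimes> y')" unfolding e[symmetric] using k' h(1,3) by (simp add: m_ac)
    finally show ?thesis using fraction_eqI[of "x \<otimes> x'" "y \<otimes> y'" "a \<otimes> c" "b \<otimes> d"] p k h nonzero_mult by auto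
  qed
  moreover have "(a, b) \<in> fraction R a b" "(c, d) \<in> fraction R c d" using fraction_memI h by auto
  ultimately show ?thesis unfolding fraction_field_def by auto
qed

lemma fraction_add:
  assumes h: "a \<in> carrier R" "b \<in> carrier R - {\<zero>}" "c \<in> carrier R" "d \<in> carrier R - {\<zero>}"
  shows "fraction R a b \<oplus>\<^bsub>fraction_field R\<^esub> fraction R c d = fraction R (a \<otimes> d \<oplus> c \<otimes> b) (b \<otimes> d)"
proof -
  have "fraction R (fst p \<otimes> snd q \<oplus> fst q \<otimes> snd p) (snd p \<otimes> snd q) = fraction R (a \<otimes> d \<oplus> c \<otimes> b) (b \<otimes> d)"
    if "p \<in> fraction R a b" "q \<in> fraction R c d" for p q
  proof -
    obtain x y x' y' where p: "p = (x, y)" "q = (x', y')" by (cases p; cases q) auto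
    have e: "a \<otimes> y = x \<otimes> b" "c \<otimes> y' = x' \<otimes> d" using that p by (auto simp: fraction_def)
    have k: "x \<in> carrier R" "y \<in> carrier R - {\<zero>}" "x' \<in> carrier R" "y' \<in> carrier R - {\<zero>}"
      using that p by (auto simp: fraction_def)
    have k': "y \<in> carrier R" "y' \<in> carrier R" "b \<in> carrier R" "d \<in> carrier R" using k h by auto
    have "(x \<otimes> y' \<oplus> x' \<otimes> y) \<otimes> (b \<otimes> d) = (x \<otimes> b) \<otimes> (y' \<otimes> d) \<oplus> (x' \<otimes> d) \<otimes> (y \<otimes> b)"
      using k(1,3) k' by (simp add: m_ac l_distr r_distr)
    also have "\<dots> = (a \<otimes> d \<oplus> c \<otimes> b) \<otimes> (y \<otimes> y')"
      unfolding e[symmetric] using k' h(1,3) by (simp add: m_ac l_distr r_distr)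
    finally show ?thesis
      using fraction_eqI[of "x \<otimes> y' \<oplus> x' \<otimes> y" "y \<otimes> y'" "a \<otimes> d \<oplus> c \<otimes> b" "b \<otimes> d"] p k k' h nonzero_mult by auto
  qed
  moreover have "(a, b) \<in> fraction R a b" "(c, d) \<in> fraction R c d" using fraction_memI h by auto
  ultimately show ?thesis unfolding fraction_field_def by auto
qed

lemma fraction_field_simps:
  "\<one>\<^bsub>fraction_field R\<^esub> = fraction R \<one> \<one>" "\<zero>\<^bsub>fraction_field R\<^esub> = fraction R \<zero> \<one>"
  by (simp_all add: fraction_field_def)

lemma fraction_fieldI: "\<lbrakk>a \<in> carrier R; b \<in> carrier R - {\<zero>}\<rbrakk> \<Longrightarrow> fraction R a b \<in> carrier (fraction_field R)"
  by (auto simp: fraction_field_def)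

lemma fraction_fieldE:
  assumes "x \<in> carrier (fraction_field R)"
  obtains a b where "a \<in> carrier R" "b \<in> carrier R - {\<zero>}" "x = fraction R a b"
  using assms by (auto simp: fraction_field_def)

lemma one_nonzero: "\<one> \<in> carrier R - {\<zero>}" using one_not_zero by simp

lemma fraction_field_cring: "cring (fraction_field R)"
proof (rule cringI)
  note simps = fraction_mult fraction_add fraction_field_simps nonzero_mult one_nonzero
  show "abelian_group (fraction_field R)"
  proof (rule abelian_groupI)
    fix x y assume xyz: "x \<in> carrier (fraction_field R)" "y \<in> carrier (fraction_field R)"
    obtain a b where h1: "a \<in> carrier R" "b \<in> carrier R - {\<zero>}" "x = fraction R a b"
      using xyz(1) by (rule fraction_fieldE)
    obtain c d where h2: "c \<in> carrier R" "d \<in> carrier R - {\<zero>}" "y = fraction R c d"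
      using xyz(2) by (rule fraction_fieldE)
    note h = h1 h2
    have b: "b \<in> carrier R" "d \<in> carrier R" using h by auto
    show "x \<oplus>\<^bsub>fraction_field R\<^esub> y \<in> carrier (fraction_field R)"
      unfolding h fraction_add[OF h(1,2,4,5)] using h b nonzero_mult by (intro fraction_fieldI) auto
    have e: "a \<otimes> d \<oplus> c \<otimes> b = c \<otimes> b \<oplus> a \<otimes> d" "b \<otimes> d = d \<otimes> b" using h(1,4) b by (simp_all add: m_comm a_comm)
    show "x \<oplus>\<^bsub>fraction_field R\<^esub> y = y \<oplus>\<^bsub>fraction_field R\<^esub> x"
      unfolding h(3,6) fraction_add[OF h(1,2,4,5)] fraction_add[OF h(4,5,1,2)] e ..
  next
    fix x y z assume xyz: "x \<in> carrier (fraction_field R)" "y \<in> carrier (fraction_field R)" "z \<in> carrier (fraction_field R)"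
    obtain a b where h1: "a \<in> carrier R" "b \<in> carrier R - {\<zero>}" "x = fraction R a b"
      using xyz(1) by (rule fraction_fieldE)
    obtain c d where h2: "c \<in> carrier R" "d \<in> carrier R - {\<zero>}" "y = fraction R c d"
      using xyz(2) by (rule fraction_fieldE)
    obtain e f where h3: "e \<in> carrier R" "f \<in> carrier R - {\<zero>}" "z = fraction R e f"
      using xyz(3) by (rule fraction_fieldE)
    note h = h1 h2 h3
    have b: "b \<in> carrier R" "d \<in> carrier R" "f \<in> carrier R" using h by auto
    have s: "a \<otimes> d \<oplus> c \<otimes> b \<in> carrier R" "c \<otimes> f \<oplus> e \<otimes> d \<in> carrier R" using h(1,4,7) b by auto
    have e: "(a \<otimes> d \<oplus> c \<otimes> b) \<otimes> f \<oplus> e \<otimes> (b \<otimes> d) = a \<otimes> (d \<otimes> f) \<oplus> (c \<otimes> f \<oplus> e \<otimes> d) \<otimes> b"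
      "(b \<otimes> d) \<otimes> f = b \<otimes> (d \<otimes> f)" using h(1,4,7) b by (simp_all add: m_ac a_ac l_distr r_distr)
    show "(x \<oplus>\<^bsub>fraction_field R\<^esub> y) \<oplus>\<^bsub>fraction_field R\<^esub> z = x \<oplus>\<^bsub>fraction_field R\<^esub> (y \<oplus>\<^bsub>fraction_field R\<^esub> z)"
      unfolding h(3,6,9) fraction_add[OF h(1,2,4,5)] fraction_add[OF h(4,5,7,8)]
        fraction_add[OF s(1) nonzero_mult[OF h(2,5)] h(7,8)] fraction_add[OF h(1,2) s(2) nonzero_mult[OF h(5,8)]] e ..
  next
    show "\<zero>\<^bsub>fraction_field R\<^esub> \<in> carrier (fraction_field R)"
      unfolding fraction_field_simps by (intro fraction_fieldI one_nonzero) simp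
  next
    fix x assume "x \<in> carrier (fraction_field R)"
    then obtain a b where h: "a \<in> carrier R" "b \<in> carrier R - {\<zero>}" "x = fraction R a b" by (rule fraction_fieldE)
    have b: "b \<in> carrier R" using h by auto
    show "\<zero>\<^bsub>fraction_field R\<^esub> \<oplus>\<^bsub>fraction_field R\<^esub> x = x"
      unfolding fraction_field_simps h(3) fraction_add[OF zero_closed one_nonzero h(1,2)] using h(1) b by simp
    have "fraction R (\<ominus> a) b \<oplus>\<^bsub>fraction_field R\<^esub> x = fraction R (\<ominus> a \<otimes> b \<oplus> a \<otimes> b) (b \<otimes> b)"
      unfolding h(3) by (rule fraction_add) (use h in auto)
    also have "\<dots> = fraction R \<zero> \<one>"
      using h b nonzero_mult by (intro fraction_eqI one_nonzero) (auto simp: l_minus l_neg)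
    finally show "\<exists>y\<in>carrier (fraction_field R). y \<oplus>\<^bsub>fraction_field R\<^esub> x = \<zero>\<^bsub>fraction_field R\<^esub>"
      unfolding fraction_field_simps using h by (intro bexI[of _ "fraction R (\<ominus> a) b"] fraction_fieldI) auto
  qed
  show "comm_monoid (fraction_field R)"
  proof (rule comm_monoidI)
    fix x y assume xyz: "x \<in> carrier (fraction_field R)" "y \<in> carrier (fraction_field R)"
    obtain a b where h1: "a \<in> carrier R" "b \<in> carrier R - {\<zero>}" "x = fraction R a b"
      using xyz(1) by (rule fraction_fieldE)
    obtain c d where h2: "c \<in> carrier R" "d \<in> carrier R - {\<zero>}" "y = fraction R c d"
      using xyz(2) by (rule fraction_fieldE)
    note h = h1 h2
    have b: "b \<in> carrier R" "d \<in> carrier R" using h by auto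
    show "x \<otimes>\<^bsub>fraction_field R\<^esub> y \<in> carrier (fraction_field R)"
      unfolding h fraction_mult[OF h(1,2,4,5)] using h b nonzero_mult by (intro fraction_fieldI) auto
    show "x \<otimes>\<^bsub>fraction_field R\<^esub> y = y \<otimes>\<^bsub>fraction_field R\<^esub> x"
      unfolding h(3,6) fraction_mult[OF h(1,2,4,5)] fraction_mult[OF h(4,5,1,2)]
      using h(1,4) b by (simp add: m_comm)
  next
    fix x y z assume xyz: "x \<in> carrier (fraction_field R)" "y \<in> carrier (fraction_field R)" "z \<in> carrier (fraction_field R)"
    obtain a b where h1: "a \<in> carrier R" "b \<in> carrier R - {\<zero>}" "x = fraction R a b"
      using xyz(1) by (rule fraction_fieldE)
    obtain c d where h2: "c \<in> carrier R" "d \<in> carrier R - {\<zero>}" "y = fraction R c d"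
      using xyz(2) by (rule fraction_fieldE)
    obtain e f where h3: "e \<in> carrier R" "f \<in> carrier R - {\<zero>}" "z = fraction R e f"
      using xyz(3) by (rule fraction_fieldE)
    note h = h1 h2 h3
    have b: "b \<in> carrier R" "d \<in> carrier R" "f \<in> carrier R" using h by auto
    show "(x \<otimes>\<^bsub>fraction_field R\<^esub> y) \<otimes>\<^bsub>fraction_field R\<^esub> z = x \<otimes>\<^bsub>fraction_field R\<^esub> (y \<otimes>\<^bsub>fraction_field R\<^esub> z)"
      unfolding h(3,6,9) fraction_mult[OF h(1,2,4,5)] fraction_mult[OF h(4,5,7,8)]
        fraction_mult[OF m_closed[OF h(1,4)] nonzero_mult[OF h(2,5)] h(7,8)]
        fraction_mult[OF h(1,2) m_closed[OF h(4,7)] nonzero_mult[OF h(5,8)]]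
      using h(1,4,7) b by (simp add: m_assoc)
  next
    show "\<one>\<^bsub>fraction_field R\<^esub> \<in> carrier (fraction_field R)"
      unfolding fraction_field_simps by (intro fraction_fieldI one_nonzero) simp
  next
    fix x assume "x \<in> carrier (fraction_field R)"
    then obtain a b where h: "a \<in> carrier R" "b \<in> carrier R - {\<zero>}" "x = fraction R a b" by (rule fraction_fieldE)
    then show "\<one>\<^bsub>fraction_field R\<^esub> \<otimes>\<^bsub>fraction_field R\<^esub> x = x"
      unfolding fraction_field_simps h(3) fraction_mult[OF one_closed one_nonzero h(1,2)] by simp
  qed
next
  fix x y z assume xyz: "x \<in> carrier (fraction_field R)" "y \<in> carrier (fraction_field R)" "z \<in> carrier (fraction_field R)"
  obtain a b where h1: "a \<in> carrier R" "b \<in> carrier R - {\<zero>}" "x = fraction R a b"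
    using xyz(1) by (rule fraction_fieldE)
  obtain c d where h2: "c \<in> carrier R" "d \<in> carrier R - {\<zero>}" "y = fraction R c d"
    using xyz(2) by (rule fraction_fieldE)
  obtain e f where h3: "e \<in> carrier R" "f \<in> carrier R - {\<zero>}" "z = fraction R e f"
    using xyz(3) by (rule fraction_fieldE)
  note h = h1 h2 h3
  have b: "b \<in> carrier R" "d \<in> carrier R" "f \<in> carrier R" using h by auto
  have s: "a \<otimes> d \<oplus> c \<otimes> b \<in> carrier R" using h(1,4) b by auto
  have e: "((a \<otimes> d \<oplus> c \<otimes> b) \<otimes> e) \<otimes> ((b \<otimes> f) \<otimes> (d \<otimes> f))
     = ((a \<otimes> e) \<otimes> (d \<otimes> f) \<oplus> (c \<otimes> e) \<otimes> (b \<otimes> f)) \<otimes> ((b \<otimes> d) \<otimes> f)" using h(1,4,7) b by (simp add: m_ac l_distr r_distr)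
  show "(x \<oplus>\<^bsub>fraction_field R\<^esub> y) \<otimes>\<^bsub>fraction_field R\<^esub> z
     = x \<otimes>\<^bsub>fraction_field R\<^esub> z \<oplus>\<^bsub>fraction_field R\<^esub> y \<otimes>\<^bsub>fraction_field R\<^esub> z"
    unfolding h(3,6,9) fraction_add[OF h(1,2,4,5)] fraction_mult[OF h(1,2,7,8)] fraction_mult[OF h(4,5,7,8)]
      fraction_mult[OF s nonzero_mult[OF h(2,5)] h(7,8)]
      fraction_add[OF m_closed[OF h(1,7)] nonzero_mult[OF h(2,8)] m_closed[OF h(4,7)] nonzero_mult[OF h(5,8)]]
    by (intro fraction_eqI nonzero_mult h e) (use s h b in auto)
qed

lemma fraction_field_field: "field (fraction_field R)"
proof -
  interpret F: cring "fraction_field R" by (rule fraction_field_cring)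
  show ?thesis
  proof (rule F.cring_fieldI2)
    show "\<zero>\<^bsub>fraction_field R\<^esub> \<noteq> \<one>\<^bsub>fraction_field R\<^esub>"
      unfolding fraction_field_simps using fraction_eqD[OF zero_closed one_nonzero, of \<one> \<one>] one_not_zero by auto
    fix x assume x: "x \<in> carrier (fraction_field R)" "x \<noteq> \<zero>\<^bsub>fraction_field R\<^esub>"
    from x(1) obtain a b where h: "a \<in> carrier R" "b \<in> carrier R - {\<zero>}" "x = fraction R a b" by (rule fraction_fieldE)
    have b: "b \<in> carrier R" using h by auto
    have "a \<noteq> \<zero>"
    proof
      assume "a = \<zero>"
      then have "x = fraction R \<zero> \<one>" unfolding h(3) using b by (intro fraction_eqI h one_nonzero) auto
      then show False using x(2) by (simp add: fraction_field_simps)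
    qed
    then have a: "a \<in> carrier R - {\<zero>}" using h by auto
    have "x \<otimes>\<^bsub>fraction_field R\<^esub> fraction R b a = fraction R (a \<otimes> b) (b \<otimes> a)"
      unfolding h(3) by (rule fraction_mult[OF h(1,2) b a])
    also have "\<dots> = fraction R \<one> \<one>"
      using h b a nonzero_mult by (intro fraction_eqI one_nonzero) (auto simp: m_comm)
    finally show "\<exists>y\<in>carrier (fraction_field R). x \<otimes>\<^bsub>fraction_field R\<^esub> y = \<one>\<^bsub>fraction_field R\<^esub>"
      unfolding fraction_field_simps using a b by (intro bexI[of _ "fraction R b a"] fraction_fieldI) auto
  qed
qed

lemma fraction_hom: "(\<lambda>x. fraction R x \<one>) \<in> ring_hom R (fraction_field R)"
  by (rule ring_hom_memI)
    (use one_nonzero fraction_fieldI in \<open>auto simp: fraction_mult fraction_add fraction_field_simps\<close>)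

lemma fraction_inj: "inj_on (\<lambda>x. fraction R x \<one>) (carrier R)"
  by (rule inj_onI) (use fraction_eqD[OF _ one_nonzero] in fastforce)

text \<open>Supplies the fields and embeddings to which the abstract construction over
  \<open>K a\<close> and \<open>j a\<close> is finally applied.\<close>

lemma domain_plus_map_hom:
  "domain_plus_map R \<in> ring_hom R (field.alg_closure (fraction_field R))"
  "inj_on (domain_plus_map R) (carrier R)"
  "field (field.alg_closure (fraction_field R))" "has_roots (field.alg_closure (fraction_field R))"
proof -
  interpret F: field "fraction_field R" by (rule fraction_field_field)
  interpret C: algebraic_closure F.alg_closure "F.indexed_const ` carrier (fraction_field R)"
    by (rule F.alg_closureE(1))
  show "field F.alg_closure" by unfold_locales
  show "has_roots F.alg_closure" by (rule algebraically_closed_has_roots) unfold_locales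
  have e: "domain_plus_map R = F.indexed_const \<circ> (\<lambda>x. fraction R x \<one>)"
    by (auto simp: domain_plus_map_def)
  show "domain_plus_map R \<in> ring_hom R F.alg_closure"
    unfolding e by (rule ring_hom_trans[OF fraction_hom F.alg_closureE(2)])
  \<comment> \<open>The value at the empty monomial \<open>{#}\<close> recovers the
    constant.\<close>
  have "inj F.indexed_const" unfolding F.indexed_const_def by (rule injI) (drule fun_cong[of _ _ "{#}"], simp)
  then show "inj_on (domain_plus_map R) (carrier R)"
    unfolding e using comp_inj_on[OF fraction_inj] inj_on_subset by blast
qed

end

section \<open>Products of rings\<close>

text \<open>The first three conclusions have the shape of the premises of
  \<open>monic_splits\<close> and \<open>finite_roots_monic\<close>.\<close>

lemma monic_poly_map:
  assumes R: "cring R" and S: "cring S" and h: "h \<in> ring_hom R S" and p: "monic_poly R p"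
  shows "h \<circ> p \<in> carrier (UP S)" "(h \<circ> p) (deg R p) = \<one>\<^bsub>S\<^esub>" "deg R p < i \<Longrightarrow> (h \<circ> p) i = \<zero>\<^bsub>S\<^esub>"
    "monic_poly S (h \<circ> p)"
proof -
  note m = monic_polyD[OF p]
  show c: "h \<circ> p \<in> carrier (UP S)" by (rule map_UP_closed[OF R S h m(1)])
  show o: "(h \<circ> p) (deg R p) = \<one>\<^bsub>S\<^esub>" using m(2) ring_hom_one[OF h] by simp
  show z: "(h \<circ> p) i = \<zero>\<^bsub>S\<^esub>" if "deg R p < i" for i
    using UP_above_deg[OF R m(1) that] ring_hom_zero[OF h R[THEN cring.axioms(1)] S[THEN cring.axioms(1)]] by simp
  show "monic_poly S (h \<circ> p)" by (rule monic_polyI[OF S c o z])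
qed

lemma eval_cong:
  assumes "\<And>r. r \<in> carrier R \<Longrightarrow> h r = k r" "p \<in> carrier (UP R)"
  shows "UnivPoly.eval R S h s p = UnivPoly.eval R S k s p"
proof -
  have "p i \<in> carrier R" for i using assms(2) carrier_UP_iff by blast
  then show ?thesis using assms(1) unfolding UnivPoly.eval_def by (simp add: coeff_UP[OF assms(2)])
qed

text \<open>For a projection this computes evaluation in a product coordinate by coordinate; for the
  inclusion of a subring it shows that the value does not depend on the ambient ring.\<close>

lemma eval_image:
  assumes R: "cring R" and S: "cring S" and Q: "cring Q" and h: "h \<in> ring_hom R S" and k: "k \<in> ring_hom S Q"
    and s: "s \<in> carrier S" and p: "p \<in> carrier (UP R)"
  shows "k (UnivPoly.eval R S h s p) = UnivPoly.eval R Q (k \<circ> h) (k s) p"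
proof -
  interpret S: cring S by fact
  interpret Q: cring Q by fact
  interpret k: ring_hom_cring S Q k using k by unfold_locales
  note a = UP_above_deg[OF R p]
  have pc: "h (p i) \<in> carrier S" for i using p ring_hom_closed[OF h] carrier_UP_iff by blast
  have f: "(\<lambda>i. h (p i) \<otimes>\<^bsub>S\<^esub> s [^]\<^bsub>S\<^esub> i) \<in> {..deg R p} \<rightarrow> carrier S"
    by (rule funcsetI) (intro S.m_closed pc S.nat_pow_closed s)
  have "k (UnivPoly.eval R S h s p) = k (\<Oplus>\<^bsub>S\<^esub>i\<in>{..deg R p}. h (p i) \<otimes>\<^bsub>S\<^esub> s [^]\<^bsub>S\<^esub> i)"
    using eval_eq_finsum[OF R S h s p a] by simp
  also have "\<dots> = (\<Oplus>\<^bsub>Q\<^esub>i\<in>{..deg R p}. (k \<circ> (\<lambda>i. h (p i) \<otimes>\<^bsub>S\<^esub> s [^]\<^bsub>S\<^esub> i)) i)"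
    using k.hom_finsum[OF f] by (simp add: o_def)
  also have "\<dots> = (\<Oplus>\<^bsub>Q\<^esub>i\<in>{..deg R p}. (k \<circ> h) (p i) \<otimes>\<^bsub>Q\<^esub> (k s) [^]\<^bsub>Q\<^esub> i)"
    using pc s by (simp add: o_def)
  also have "\<dots> = UnivPoly.eval R Q (k \<circ> h) (k s) p"
    using eval_eq_finsum[OF R Q ring_hom_trans[OF h k] k.hom_closed[OF s] p a] by simp
  finally show ?thesis .
qed

lemma integral_element_image:
  assumes "cring R" "cring S" "cring Q" "h \<in> ring_hom R S" "k \<in> ring_hom S Q" "s \<in> carrier S"
    and g: "\<And>r. r \<in> carrier R \<Longrightarrow> k (h r) = g r" and int: "integral_element R S h s"
  shows "integral_element R Q g (k s)"
proof -
  obtain p where p: "monic_poly R p" "UnivPoly.eval R S h s p = \<zero>\<^bsub>S\<^esub>"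
    using int unfolding integral_element_def by blast
  note pc = monic_polyD(1)[OF p(1)]
  have "UnivPoly.eval R Q g (k s) p = UnivPoly.eval R Q (k \<circ> h) (k s) p"
    by (rule eval_cong[OF _ pc]) (simp add: g)
  also have "\<dots> = k \<zero>\<^bsub>S\<^esub>" using eval_image[OF assms(1-6) pc] p(2) by simp
  also have "\<dots> = \<zero>\<^bsub>Q\<^esub>" by (rule ring_hom_zero[OF assms(5) assms(2,3)[THEN cring.axioms(1)]])
  finally show ?thesis unfolding integral_element_def using p(1) by blast
qed

lemma map_monom:
  assumes R: "cring R" and S: "cring S" and h: "h \<in> ring_hom R S" and c: "c \<in> carrier R"
  shows "h \<circ> up_ring.monom (UP R) c n = up_ring.monom (UP S) (h c) n"
  using c ring_hom_closed[OF h c] ring_hom_zero[OF h R[THEN cring.axioms(1)] S[THEN cring.axioms(1)]]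
  by (auto simp: UP_def)

lemma map_prod_linear_factors:
  assumes R: "cring R" and S: "cring S" and h: "h \<in> ring_hom R S" and c: "c \<in> {..<n::nat} \<rightarrow> carrier R"
  shows "h \<circ> (\<Otimes>\<^bsub>UP R\<^esub>i\<in>{..<n}. linear_factor R (c i)) = (\<Otimes>\<^bsub>UP S\<^esub>i\<in>{..<n}. linear_factor S (h (c i)))"
proof -
  interpret R: UP_cring R "UP R" using UP_cring_of[OF R] .
  interpret S: UP_cring S "UP S" using UP_cring_of[OF S] .
  interpret m: ring_hom_cring "UP R" "UP S" "\<lambda>p. h \<circ> p" using map_UP_hom[OF R S h] by unfold_locales
  have ci: "c i \<in> carrier R" if "i \<in> {..<n}" for i using c that by (rule funcset_mem)
  have lf: "h \<circ> linear_factor R d = linear_factor S (h d)" if d: "d \<in> carrier R" for d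
  proof -
    have mc: "up_ring.monom (UP R) \<one>\<^bsub>R\<^esub> 1 \<in> carrier (UP R)" "up_ring.monom (UP R) d 0 \<in> carrier (UP R)"
      using d by simp_all
    show ?thesis
      unfolding linear_factor_def m.hom_add[OF mc] map_monom[OF R S h d] map_monom[OF R S h R.R.one_closed]
      using ring_hom_one[OF h] by simp
  qed
  have f: "(\<lambda>i. linear_factor R (c i)) \<in> {..<n} \<rightarrow> carrier (UP R)"
    by (rule funcsetI) (rule linear_factor_closed[OF R ci])
  have "h \<circ> (\<Otimes>\<^bsub>UP R\<^esub>i\<in>{..<n}. linear_factor R (c i))
      = (\<Otimes>\<^bsub>UP S\<^esub>i\<in>{..<n}. ((\<lambda>p. h \<circ> p) \<circ> (\<lambda>i. linear_factor R (c i))) i)"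
    by (rule m.hom_finprod[OF f])
  also have "\<dots> = (\<Otimes>\<^bsub>UP S\<^esub>i\<in>{..<n}. linear_factor S (h (c i)))"
  proof (rule S.P.finprod_cong')
    fix i assume "i \<in> {..<n}"
    then show "((\<lambda>p. h \<circ> p) \<circ> (\<lambda>i. linear_factor R (c i))) i = linear_factor S (h (c i))"
      using lf[OF ci] by simp
  next
    show "(\<lambda>i. linear_factor S (h (c i))) \<in> {..<n} \<rightarrow> carrier (UP S)"
      by (rule funcsetI) (rule linear_factor_closed[OF S ring_hom_closed[OF h ci]])
  qed (rule refl)
  finally show ?thesis .
qed

lemma ai_closed_iff:
  "ai_closed S \<longleftrightarrow> (\<forall>p. monic_poly S p \<longrightarrow>
     (\<exists>(n::nat) c. c \<in> {..<n} \<rightarrow> carrier S \<and> p = (\<Otimes>\<^bsub>UP S\<^esub>i\<in>{..<n}. linear_factor S (c i))))"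
  unfolding ai_closed_def linear_factor_def ..

lemma product_ring_simps:
  "carrier (product_ring A R) = (\<Pi>\<^sub>E a\<in>A. carrier (R a))"
  "x \<otimes>\<^bsub>product_ring A R\<^esub> y = (\<lambda>a\<in>A. x a \<otimes>\<^bsub>R a\<^esub> y a)"
  "x \<oplus>\<^bsub>product_ring A R\<^esub> y = (\<lambda>a\<in>A. x a \<oplus>\<^bsub>R a\<^esub> y a)"
  "\<one>\<^bsub>product_ring A R\<^esub> = (\<lambda>a\<in>A. \<one>\<^bsub>R a\<^esub>)" "\<zero>\<^bsub>product_ring A R\<^esub> = (\<lambda>a\<in>A. \<zero>\<^bsub>R a\<^esub>)"
  by (simp_all add: product_ring_def)

lemma product_ring_ext:
  assumes "x \<in> carrier (product_ring A R)" "y \<in> carrier (product_ring A R)" "\<And>a. a \<in> A \<Longrightarrow> x a = y a"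
  shows "x = y"
  using assms unfolding product_ring_simps by (rule PiE_ext)

lemma product_ring_mem: "x \<in> carrier (product_ring A R) \<Longrightarrow> a \<in> A \<Longrightarrow> x a \<in> carrier (R a)"
  by (auto simp: product_ring_simps)

lemma product_ring_cring:
  assumes c: "\<And>a. a \<in> A \<Longrightarrow> cring (R a)" shows "cring (product_ring A R)"
proof -
  note r = c[THEN cring.axioms(1)]
  note mem = product_ring_mem
  have add: "x \<oplus>\<^bsub>product_ring A R\<^esub> y \<in> carrier (product_ring A R)"
    if "x \<in> carrier (product_ring A R)" "y \<in> carrier (product_ring A R)" for x y
    using mem[OF that(1)] mem[OF that(2)] ring.ring_simprules(1)[OF r] by (simp add: product_ring_simps)
  have mult: "x \<otimes>\<^bsub>product_ring A R\<^esub> y \<in> carrier (product_ring A R)"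
    if "x \<in> carrier (product_ring A R)" "y \<in> carrier (product_ring A R)" for x y
    using mem[OF that(1)] mem[OF that(2)] ring.ring_simprules(5)[OF r] by (simp add: product_ring_simps)
  have zero: "\<zero>\<^bsub>product_ring A R\<^esub> \<in> carrier (product_ring A R)" "\<one>\<^bsub>product_ring A R\<^esub> \<in> carrier (product_ring A R)"
    using ring.ring_simprules(2)[OF r] ring.ring_simprules(6)[OF r] by (simp_all add: product_ring_simps)
  show ?thesis
  proof (rule cringI)
    show "abelian_group (product_ring A R)"
    proof (rule abelian_groupI)
      fix x assume x: "x \<in> carrier (product_ring A R)"
      show "\<zero>\<^bsub>product_ring A R\<^esub> \<oplus>\<^bsub>product_ring A R\<^esub> x = x"
        by (rule product_ring_ext[OF add[OF zero(1) x] x])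
          (use mem[OF x] ring.ring_simprules(8)[OF r] in \<open>simp add: product_ring_simps\<close>)
      let ?y = "\<lambda>a\<in>A. \<ominus>\<^bsub>R a\<^esub> x a"
      have y: "?y \<in> carrier (product_ring A R)"
        using mem[OF x] ring.ring_simprules(3)[OF r] by (simp add: product_ring_simps)
      have "?y \<oplus>\<^bsub>product_ring A R\<^esub> x = \<zero>\<^bsub>product_ring A R\<^esub>"
        by (rule product_ring_ext[OF add[OF y x] zero(1)])
          (use mem[OF x] ring.ring_simprules(9)[OF r] in \<open>simp add: product_ring_simps\<close>)
      then show "\<exists>y\<in>carrier (product_ring A R). y \<oplus>\<^bsub>product_ring A R\<^esub> x = \<zero>\<^bsub>product_ring A R\<^esub>"
        using y by (rule bexI)
    next
      fix x y assume xy: "x \<in> carrier (product_ring A R)" "y \<in> carrier (product_ring A R)"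
      show "x \<oplus>\<^bsub>product_ring A R\<^esub> y = y \<oplus>\<^bsub>product_ring A R\<^esub> x"
        by (rule product_ring_ext[OF add[OF xy] add[OF xy(2,1)]])
          (use mem[OF xy(1)] mem[OF xy(2)] ring.ring_simprules(10)[OF r] in \<open>simp add: product_ring_simps\<close>)
      fix z assume z: "z \<in> carrier (product_ring A R)"
      show "x \<oplus>\<^bsub>product_ring A R\<^esub> y \<oplus>\<^bsub>product_ring A R\<^esub> z = x \<oplus>\<^bsub>product_ring A R\<^esub> (y \<oplus>\<^bsub>product_ring A R\<^esub> z)"
        by (rule product_ring_ext[OF add[OF add[OF xy] z] add[OF xy(1) add[OF xy(2) z]]])
          (use mem[OF xy(1)] mem[OF xy(2)] mem[OF z] ring.ring_simprules(7)[OF r] in \<open>simp add: product_ring_simps\<close>)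
    qed (fact add zero)+
    show "comm_monoid (product_ring A R)"
    proof (rule comm_monoidI)
      fix x assume x: "x \<in> carrier (product_ring A R)"
      show "\<one>\<^bsub>product_ring A R\<^esub> \<otimes>\<^bsub>product_ring A R\<^esub> x = x"
        by (rule product_ring_ext[OF mult[OF zero(2) x] x])
          (use mem[OF x] ring.ring_simprules(12)[OF r] in \<open>simp add: product_ring_simps\<close>)
    next
      fix x y assume xy: "x \<in> carrier (product_ring A R)" "y \<in> carrier (product_ring A R)"
      show "x \<otimes>\<^bsub>product_ring A R\<^esub> y = y \<otimes>\<^bsub>product_ring A R\<^esub> x"
        by (rule product_ring_ext[OF mult[OF xy] mult[OF xy(2,1)]])
          (use mem[OF xy(1)] mem[OF xy(2)] cring.cring_simprules(14)[OF c] in \<open>simp add: product_ring_simps\<close>)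
      fix z assume z: "z \<in> carrier (product_ring A R)"
      show "x \<otimes>\<^bsub>product_ring A R\<^esub> y \<otimes>\<^bsub>product_ring A R\<^esub> z = x \<otimes>\<^bsub>product_ring A R\<^esub> (y \<otimes>\<^bsub>product_ring A R\<^esub> z)"
        by (rule product_ring_ext[OF mult[OF mult[OF xy] z] mult[OF xy(1) mult[OF xy(2) z]]])
          (use mem[OF xy(1)] mem[OF xy(2)] mem[OF z] ring.ring_simprules(11)[OF r] in \<open>simp add: product_ring_simps\<close>)
    qed (fact mult zero)+
    fix x y z assume xyz: "x \<in> carrier (product_ring A R)" "y \<in> carrier (product_ring A R)" "z \<in> carrier (product_ring A R)"
    show "(x \<oplus>\<^bsub>product_ring A R\<^esub> y) \<otimes>\<^bsub>product_ring A R\<^esub> z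
        = x \<otimes>\<^bsub>product_ring A R\<^esub> z \<oplus>\<^bsub>product_ring A R\<^esub> y \<otimes>\<^bsub>product_ring A R\<^esub> z"
      by (rule product_ring_ext[OF mult[OF add[OF xyz(1,2)] xyz(3)] add[OF mult[OF xyz(1,3)] mult[OF xyz(2,3)]]])
        (use mem[OF xyz(1)] mem[OF xyz(2)] mem[OF xyz(3)] ring.ring_simprules(13)[OF r] in \<open>simp add: product_ring_simps\<close>)
  qed
qed

lemma product_ring_a_inv:
  assumes c: "\<And>a. a \<in> A \<Longrightarrow> cring (R a)" and x: "x \<in> carrier (product_ring A R)" and a: "a \<in> A"
  shows "(\<ominus>\<^bsub>product_ring A R\<^esub> x) a = \<ominus>\<^bsub>R a\<^esub> x a"
proof -
  interpret P: cring "product_ring A R" by (rule product_ring_cring[OF c])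
  interpret Ra: cring "R a" by (rule c[OF a])
  have "(\<ominus>\<^bsub>product_ring A R\<^esub> x \<oplus>\<^bsub>product_ring A R\<^esub> x) a = \<zero>\<^bsub>R a\<^esub>"
    unfolding P.l_neg[OF x] using a by (simp add: product_ring_simps)
  then have "(\<ominus>\<^bsub>product_ring A R\<^esub> x) a \<oplus>\<^bsub>R a\<^esub> x a = \<zero>\<^bsub>R a\<^esub>"
    using a by (simp add: product_ring_simps)
  then have "\<ominus>\<^bsub>R a\<^esub> x a = (\<ominus>\<^bsub>product_ring A R\<^esub> x) a"
    using product_ring_mem[OF x a] product_ring_mem[OF P.a_inv_closed[OF x] a] by (rule Ra.minus_equality)
  then show ?thesis ..
qed

lemma proj_hom:
  assumes a: "a \<in> A" shows "(\<lambda>x. x a) \<in> ring_hom (product_ring A R) (R a)"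
  by (rule ring_hom_memI) (use a product_ring_mem in \<open>auto simp: product_ring_simps\<close>)

lemma ring_hom_subring: "h \<in> ring_hom R S \<Longrightarrow> B \<subseteq> carrier R \<Longrightarrow> h \<in> ring_hom (R\<lparr>carrier := B\<rparr>) S"
  by (rule ring_hom_memI) (simp_all add: subset_iff ring_hom_closed ring_hom_mult ring_hom_add ring_hom_one)

lemma subring_hom_id: "B \<subseteq> carrier R \<Longrightarrow> id \<in> ring_hom (R\<lparr>carrier := B\<rparr>) R"
  by (auto simp: ring_hom_def)

definition single :: "'i set \<Rightarrow> ('i \<Rightarrow> ('a, 'm) ring_scheme) \<Rightarrow> 'i \<Rightarrow> 'a \<Rightarrow> 'i \<Rightarrow> 'a" where
  "single A R a x = (\<lambda>b\<in>A. if b = a then x else \<zero>\<^bsub>R b\<^esub>)"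

lemma single_apply: "b \<in> A \<Longrightarrow> single A R a x b = (if b = a then x else \<zero>\<^bsub>R b\<^esub>)"
  by (simp add: single_def)

lemma single_closed:
  assumes "\<And>b. b \<in> A \<Longrightarrow> cring (R b)" "x \<in> carrier (R a)"
  shows "single A R a x \<in> carrier (product_ring A R)"
  using assms(2) ring.ring_simprules(2)[OF cring.axioms(1)[OF assms(1)]]
  by (simp add: single_def product_ring_simps)

lemma single_mult:
  assumes c: "\<And>b. b \<in> A \<Longrightarrow> cring (R b)" and x: "x \<in> carrier (R a)" and a: "a \<in> A"
    and w: "w \<in> carrier (product_ring A R)"
  shows "single A R a x \<otimes>\<^bsub>product_ring A R\<^esub> w = single A R a (x \<otimes>\<^bsub>R a\<^esub> w a)"
proof -
  interpret P: cring "product_ring A R" by (rule product_ring_cring[OF c])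
  interpret Ra: cring "R a" by (rule c[OF a])
  show ?thesis
  proof (rule product_ring_ext)
    show "single A R a x \<otimes>\<^bsub>product_ring A R\<^esub> w \<in> carrier (product_ring A R)"
      by (rule P.m_closed[OF single_closed[of A R x a, OF c x] w])
    show "single A R a (x \<otimes>\<^bsub>R a\<^esub> w a) \<in> carrier (product_ring A R)"
      by (rule single_closed[of A R _ a, OF c Ra.m_closed[OF x product_ring_mem[OF w a]]])
    fix b assume b: "b \<in> A"
    then interpret Rb: cring "R b" by (rule c)
    show "(single A R a x \<otimes>\<^bsub>product_ring A R\<^esub> w) b = single A R a (x \<otimes>\<^bsub>R a\<^esub> w a) b"
      using b product_ring_mem[OF w b] by (simp add: single_apply product_ring_simps)
  qed
qed

text \<open>Tightness only says that an intersection differs from the zero ideal; as zero lies in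
  it, there is a nonzero element.\<close>

lemma nonzero_in_Int:
  assumes "I \<inter> Y \<noteq> {z}" "z \<in> I" "z \<in> Y" shows "\<exists>x\<in>I. x \<in> Y \<and> x \<noteq> z"
  using assms by blast

section \<open>The universal absolute integral closure\<close>

text \<open>\<open>T\<close> is the subring of the third claim; the other two claims take
  \<open>T = carrier P\<close>. The \<open>K a\<close> are abstract algebraically closed fields
  containing the \<open>R a\<close>, and integrality cuts out the relevant part of them.\<close>

locale domain_product =
  fixes A :: "'i set" and R :: "'i \<Rightarrow> 'a ring" and K :: "'i \<Rightarrow> 'k ring" and j :: "'i \<Rightarrow> 'a \<Rightarrow> 'k"
    and T :: "('i \<Rightarrow> 'a) set"
  assumes R_domain: "\<And>a. a \<in> A \<Longrightarrow> domain (R a)"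
    and K_field: "\<And>a. a \<in> A \<Longrightarrow> field (K a)" and K_roots: "\<And>a. a \<in> A \<Longrightarrow> has_roots (K a)"
    and j_hom: "\<And>a. a \<in> A \<Longrightarrow> j a \<in> ring_hom (R a) (K a)"
    and j_inj: "\<And>a. a \<in> A \<Longrightarrow> inj_on (j a) (carrier (R a))"
    and T_subring: "subring T (product_ring A R)"
    and T_integral: "integral_extension ((product_ring A R)\<lparr>carrier := T\<rparr>) (product_ring A R) id"
    and T_tight: "tight_extension ((product_ring A R)\<lparr>carrier := T\<rparr>) (product_ring A R) id"
begin

abbreviation "P \<equiv> product_ring A R"
abbreviation "W \<equiv> product_ring A K"
abbreviation "RT \<equiv> P\<lparr>carrier := T\<rparr>"

definition J :: "('i \<Rightarrow> 'a) \<Rightarrow> 'i \<Rightarrow> 'k" where "J x = (\<lambda>a\<in>A. j a (x a))"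

lemma R_cring: "a \<in> A \<Longrightarrow> cring (R a)" using R_domain by (simp add: domain_def)

lemma K_cring: "a \<in> A \<Longrightarrow> cring (K a)" using K_field by (simp add: field_def domain_def)

lemma K_domain: "a \<in> A \<Longrightarrow> domain (K a)" using K_field by (simp add: field_def)

sublocale P: cring P by (rule product_ring_cring[OF R_cring])
sublocale W: cring W by (rule product_ring_cring[OF K_cring])

lemma T_sub: "T \<subseteq> carrier P" using subringE(1)[OF T_subring] .

sublocale RT: cring RT by (rule subring_is_cring[OF P.is_cring T_subring])

lemma single_P: "x \<in> carrier (R a) \<Longrightarrow> single A R a x \<in> carrier P"
  by (rule single_closed[of A R x a, OF R_cring])

lemma single_W: "x \<in> carrier (K a) \<Longrightarrow> single A K a x \<in> carrier W"
  by (rule single_closed[of A K x a, OF K_cring])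

lemma j_zero: "a \<in> A \<Longrightarrow> j a \<zero>\<^bsub>R a\<^esub> = \<zero>\<^bsub>K a\<^esub>"
  using ring_hom_zero[OF j_hom] R_cring[THEN cring.axioms(1)] K_cring[THEN cring.axioms(1)] by blast

lemma J_closed: "x \<in> carrier P \<Longrightarrow> J x \<in> carrier W"
  unfolding J_def product_ring_simps(1)
  by (rule restrict_PiE_iff[THEN iffD2], rule ballI, rule ring_hom_closed[OF j_hom], assumption)
    (rule PiE_mem)

lemma J_apply: "a \<in> A \<Longrightarrow> J x a = j a (x a)" by (simp add: J_def)

lemma J_hom: "J \<in> ring_hom P W"
proof (rule ring_hom_memI)
  fix x y assume x: "x \<in> carrier P" and y: "y \<in> carrier P"
  show "J (x \<otimes>\<^bsub>P\<^esub> y) = J x \<otimes>\<^bsub>W\<^esub> J y"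
    by (rule product_ring_ext[OF J_closed[OF P.m_closed[OF x y]] W.m_closed[OF J_closed[OF x] J_closed[OF y]]])
      (use product_ring_mem[OF x] product_ring_mem[OF y] ring_hom_mult[OF j_hom] in \<open>simp add: J_def product_ring_simps\<close>)
  show "J (x \<oplus>\<^bsub>P\<^esub> y) = J x \<oplus>\<^bsub>W\<^esub> J y"
    by (rule product_ring_ext[OF J_closed[OF P.a_closed[OF x y]] W.a_closed[OF J_closed[OF x] J_closed[OF y]]])
      (use product_ring_mem[OF x] product_ring_mem[OF y] ring_hom_add[OF j_hom] in \<open>simp add: J_def product_ring_simps\<close>)
next
  show "J \<one>\<^bsub>P\<^esub> = \<one>\<^bsub>W\<^esub>"
    by (rule product_ring_ext[OF J_closed[OF P.one_closed] W.one_closed])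
      (use ring_hom_one[OF j_hom] in \<open>simp add: J_def product_ring_simps\<close>)
qed (rule J_closed)

sublocale J: ring_hom_cring P W J by (unfold_locales) (rule J_hom)

lemma J_inj: "inj_on J (carrier P)"
proof (rule inj_onI)
  fix x y assume x: "x \<in> carrier P" and y: "y \<in> carrier P" and e: "J x = J y"
  show "x = y"
  proof (rule product_ring_ext[OF x y])
    fix a assume a: "a \<in> A"
    have "j a (x a) = j a (y a)" using fun_cong[OF e, of a] a by (simp add: J_def)
    then show "x a = y a" by (rule inj_onD[OF j_inj[OF a] _ product_ring_mem[OF x a] product_ring_mem[OF y a]])
  qed
qed

lemma J_RT: "J \<in> ring_hom RT W" by (rule ring_hom_subring[OF J_hom T_sub])

lemma J_T_subring: "subring (J ` T) W"
  by (rule ring_hom_ring.img_is_subring[OF ring_hom_ringI2[OF P.ring_axioms W.ring_axioms J_hom] T_subring])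

section \<open>The integral closure of \<open>T\<close> in the product of the fields\<close>

text \<open>The closure is taken in the product of the fields \<open>K a\<close>. By
  \<open>coord_integral\<close> all coordinates of its elements are integral over the
  \<open>R a\<close>, so it agrees with the closure in the product of the rings of integral
  elements.\<close>

definition Uc :: "('i \<Rightarrow> 'k) set" where "Uc = {w \<in> carrier W. W.integral_over (J ` T) w}"

lemma Uc_subring: "subring Uc W" unfolding Uc_def by (rule W.integral_elements_subring[OF J_T_subring])

abbreviation "U \<equiv> W\<lparr>carrier := Uc\<rparr>"

sublocale U: cring U by (rule subring_is_cring[OF W.is_cring Uc_subring])

lemma Uc_W: "u \<in> Uc \<Longrightarrow> u \<in> carrier W" by (simp add: Uc_def)

lemmas Uc_cl = W.subring_cl[OF Uc_subring]

lemma Uc_iff: "w \<in> Uc \<longleftrightarrow> w \<in> carrier W \<and> integral_element RT W J w"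
  using integral_element_iff[OF RT.is_cring W.is_cring J_RT, of w] by (auto simp: Uc_def)

lemma J_Uc: "x \<in> carrier P \<Longrightarrow> J x \<in> Uc"
proof -
  assume x: "x \<in> carrier P"
  have "integral_element RT P id x" using T_integral x by (simp add: integral_extension_def)
  then have "integral_element RT W J (J x)"
    by (rule integral_element_image[OF RT.is_cring P.is_cring W.is_cring subring_hom_id[OF T_sub] J_hom x, rotated]) simp
  then show "J x \<in> Uc" using Uc_iff J_closed[OF x] by blast
qed

lemma eval_coord:
  assumes w: "w \<in> carrier W" and p: "p \<in> carrier (UP RT)" and a: "a \<in> A"
  shows "UnivPoly.eval RT W J w p a = UnivPoly.eval RT (K a) (\<lambda>x. j a (x a)) (w a) p"
proof -
  have "UnivPoly.eval RT W J w p a = UnivPoly.eval RT (K a) ((\<lambda>x. x a) \<circ> J) (w a) p"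
    by (rule eval_image[OF RT.is_cring W.is_cring K_cring[OF a] J_RT proj_hom[OF a] w p])
  also have "\<dots> = UnivPoly.eval RT (K a) (\<lambda>x. j a (x a)) (w a) p"
    by (rule eval_cong[OF _ p]) (simp add: J_apply[OF a])
  finally show ?thesis .
qed

lemma coord_hom: "a \<in> A \<Longrightarrow> (\<lambda>x. j a (x a)) \<in> ring_hom RT (K a)"
  using ring_hom_trans[OF ring_hom_subring[OF proj_hom T_sub] j_hom] by (simp add: o_def)

lemma coord_integral:
  assumes u: "u \<in> Uc" and a: "a \<in> A"
  shows "integral_element (R a) (K a) (j a) (u a)"
proof -
  obtain p where p: "monic_poly RT p" "UnivPoly.eval RT W J u p = \<zero>\<^bsub>W\<^esub>"
    using u unfolding Uc_iff integral_element_def by blast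
  note pc = monic_polyD(1)[OF p(1)]
  have h: "(\<lambda>x. x a) \<in> ring_hom RT (R a)" by (rule ring_hom_subring[OF proj_hom[OF a] T_sub])
  have "UnivPoly.eval (R a) (K a) (j a) (u a) ((\<lambda>x. x a) \<circ> p) = UnivPoly.eval RT (K a) (j a \<circ> (\<lambda>x. x a)) (u a) p"
    by (rule eval_comp[OF RT.is_cring R_cring[OF a] K_cring[OF a] h j_hom[OF a] product_ring_mem[OF Uc_W[OF u] a] pc, symmetric])
  also have "\<dots> = UnivPoly.eval RT W J u p a" unfolding eval_coord[OF Uc_W[OF u] pc a] by (simp add: o_def)
  also have "\<dots> = \<zero>\<^bsub>K a\<^esub>" unfolding p(2) using a by (simp add: product_ring_simps)
  finally show ?thesis
    unfolding integral_element_def using monic_poly_map(4)[OF RT.is_cring R_cring[OF a] h p(1)] by blast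
qed

text \<open>Serves twice: it makes elements supported at one coordinate integral over
  \<open>P\<close>, and it carries a monic polynomial over a single \<open>R a\<close> into any aic
  of \<open>P\<close>, where it has to split.\<close>

lemma lift_monic_poly:
  assumes a: "a \<in> A" and k: "k \<in> carrier (K a)" and p: "monic_poly (R a) p"
    and ev: "UnivPoly.eval (R a) (K a) (j a) k p = \<zero>\<^bsub>K a\<^esub>"
  shows "\<exists>q. monic_poly P q \<and> (\<lambda>x. x a) \<circ> q = p \<and> UnivPoly.eval P W J (single A K a k) q = \<zero>\<^bsub>W\<^esub>"
proof -
  note pc = monic_polyD[OF p]
  interpret Ra: cring "R a" by (rule R_cring[OF a])
  interpret Ka: domain "K a" by (rule K_domain[OF a])
  define n where "n = deg (R a) p"
  have pz: "p i = \<zero>\<^bsub>R a\<^esub>" if "n < i" for i using UP_above_deg[OF Ra.is_cring pc(1)] that by (simp add: n_def)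
  have pm: "p i \<in> carrier (R a)" for i using pc(1) carrier_UP_iff by blast
  \<comment> \<open>A monic polynomial of degree 0 is constantly \<open>\<one>\<close> and has no
    root in \<open>K a\<close>.\<close>
  have "n \<noteq> 0"
  proof
    assume n0: "n = 0"
    have "UnivPoly.eval (R a) (K a) (j a) k p = (\<Oplus>\<^bsub>K a\<^esub>i\<in>{..0}. j a (p i) \<otimes>\<^bsub>K a\<^esub> k [^]\<^bsub>K a\<^esub> i)"
      by (rule eval_eq_finsum[OF Ra.is_cring Ka.is_cring j_hom[OF a] k pc(1)]) (use pz n0 in simp)
    also have "\<dots> = j a (p 0)" using ring_hom_closed[OF j_hom[OF a] pm] by simp
    also have "p 0 = \<one>\<^bsub>R a\<^esub>" using pc(2) n0 by (simp add: n_def)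
    also have "j a \<one>\<^bsub>R a\<^esub> = \<one>\<^bsub>K a\<^esub>" by (rule ring_hom_one[OF j_hom[OF a]])
    finally show False using ev Ka.one_not_zero by simp
  qed
  \<comment> \<open>In the coordinates other than \<open>a\<close> take the polynomial \<open>X\<^sup>n\<close>; it vanishes at \<open>0\<close> because \<open>n > 0\<close>.\<close>
  define q where "q i = (\<lambda>b\<in>A. if b = a then p i else if i = n then \<one>\<^bsub>R b\<^esub> else \<zero>\<^bsub>R b\<^esub>)" for i
  have qP: "q i \<in> carrier P" for i
    unfolding q_def product_ring_simps(1)
    using pm ring.ring_simprules(2)[OF cring.axioms(1)[OF R_cring]] ring.ring_simprules(6)[OF cring.axioms(1)[OF R_cring]]
    by simp
  have qz: "q i = \<zero>\<^bsub>P\<^esub>" if "n < i" for i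
    using that pz by (auto simp: q_def product_ring_simps fun_eq_iff)
  have qn: "q n = \<one>\<^bsub>P\<^esub>" using pc(2) by (auto simp: q_def product_ring_simps fun_eq_iff n_def)
  have qc: "q \<in> carrier (UP P)" unfolding carrier_UP_iff using qP qz by blast
  have pq: "(\<lambda>x. x a) \<circ> q = p" using a by (auto simp: q_def)
  let ?w = "single A K a k"
  have w: "?w \<in> carrier W" by (rule single_W[OF k])
  have evc: "UnivPoly.eval P W J ?w q \<in> carrier W"
    by (rule ring_hom_closed[OF eval_hom[OF P.is_cring W.is_cring J_hom w] qc])
  have "UnivPoly.eval P W J ?w q = \<zero>\<^bsub>W\<^esub>"
  proof (rule product_ring_ext[OF evc W.zero_closed])
    fix b assume b: "b \<in> A"
    interpret Kb: cring "K b" by (rule K_cring[OF b])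
    have "UnivPoly.eval P W J ?w q b = UnivPoly.eval P (K b) ((\<lambda>x. x b) \<circ> J) (?w b) q"
      by (rule eval_image[OF P.is_cring W.is_cring K_cring[OF b] J_hom proj_hom[OF b] w qc])
    also have "\<dots> = UnivPoly.eval P (K b) (j b \<circ> (\<lambda>x. x b)) (?w b) q"
      by (rule eval_cong[OF _ qc]) (simp add: J_apply[OF b])
    also have "\<dots> = UnivPoly.eval (R b) (K b) (j b) (?w b) ((\<lambda>x. x b) \<circ> q)"
      by (rule eval_comp[OF P.is_cring R_cring[OF b] K_cring[OF b] proj_hom[OF b] j_hom[OF b] product_ring_mem[OF w b] qc])
    also have "\<dots> = \<zero>\<^bsub>K b\<^esub>"
    proof (cases "b = a")
      case True
      then show ?thesis using ev pq a by (simp add: single_apply)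
    next
      case False
      have c: "(\<lambda>x. x b) \<circ> q \<in> carrier (UP (R b))" by (rule map_UP_closed[OF P.is_cring R_cring[OF b] proj_hom[OF b] qc])
      have "UnivPoly.eval (R b) (K b) (j b) \<zero>\<^bsub>K b\<^esub> ((\<lambda>x. x b) \<circ> q)
          = (\<Oplus>\<^bsub>K b\<^esub>i\<in>{..n}. j b (((\<lambda>x. x b) \<circ> q) i) \<otimes>\<^bsub>K b\<^esub> \<zero>\<^bsub>K b\<^esub> [^]\<^bsub>K b\<^esub> i)"
        by (rule eval_eq_finsum[OF R_cring[OF b] Kb.is_cring j_hom[OF b] Kb.zero_closed c])
          (use qz b in \<open>simp add: product_ring_simps\<close>)
      also have "\<dots> = (\<Oplus>\<^bsub>K b\<^esub>i\<in>{..n}. \<zero>\<^bsub>K b\<^esub>)"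
      proof (rule Kb.finsum_cong')
        fix i assume "i \<in> {..n}"
        show "j b (((\<lambda>x. x b) \<circ> q) i) \<otimes>\<^bsub>K b\<^esub> \<zero>\<^bsub>K b\<^esub> [^]\<^bsub>K b\<^esub> i = \<zero>\<^bsub>K b\<^esub>"
        proof (cases "i = n")
          case True
          then show ?thesis using \<open>n \<noteq> 0\<close> ring_hom_closed[OF j_hom[OF b] product_ring_mem[OF qP b]]
            by (simp add: Kb.nat_pow_zero)
        next
          case i: False
          then have "q i b = \<zero>\<^bsub>R b\<^esub>" using False b by (simp add: q_def)
          then show ?thesis using j_zero[OF b] by simp
        qed
      qed simp_all
      also have "\<dots> = \<zero>\<^bsub>K b\<^esub>" by simp
      finally show ?thesis using False b by (simp add: single_apply)
    qed
    also have "\<dots> = \<zero>\<^bsub>W\<^esub> b" using b by (simp add: product_ring_simps)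
    finally show "UnivPoly.eval P W J ?w q b = \<zero>\<^bsub>W\<^esub> b" .
  qed
  moreover have "monic_poly P q" by (rule monic_polyI[OF P.is_cring qc qn qz])
  ultimately show ?thesis using pq by blast
qed

text \<open>The lifted polynomial gives integrality over \<open>P\<close>, and transitivity gives it
  over \<open>T\<close>, since \<open>P\<close> is integral over \<open>T\<close>.\<close>

lemma single_integral:
  assumes a: "a \<in> A" and k: "k \<in> carrier (K a)" and int: "integral_element (R a) (K a) (j a) k"
  shows "single A K a k \<in> Uc"
proof -
  obtain p where "monic_poly (R a) p" "UnivPoly.eval (R a) (K a) (j a) k p = \<zero>\<^bsub>K a\<^esub>"
    using int unfolding integral_element_def by blast
  from lift_monic_poly[OF a k this] have "integral_element P W J (single A K a k)"
    unfolding integral_element_def by blast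
  moreover have w: "single A K a k \<in> carrier W" by (rule single_W[OF k])
  ultimately have "W.integral_over (J ` carrier P) (single A K a k)"
    using integral_element_iff[OF P.is_cring W.is_cring J_hom w] by simp
  then have "W.integral_over (J ` T) (single A K a k)"
  proof (rule W.integral_over_trans[OF J_T_subring, rotated])
    fix e assume "e \<in> J ` carrier P"
    then show "W.integral_over (J ` T) e" using J_Uc by (auto simp: Uc_def)
  qed
  then show ?thesis using w by (simp add: Uc_def)
qed

lemma J_single: "a \<in> A \<Longrightarrow> J (single A R a x) = single A K a (j a x)"
  using j_zero by (auto simp: J_def single_def fun_eq_iff)

text \<open>Tightness applied to the principal ideal of \<open>single A R a c\<close>. The
  idempotents of \<open>P\<close> may be missing from \<open>T\<close>; these nonzero elements
  supported at \<open>a\<close> take their place.\<close>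

lemma T_support:
  assumes a: "a \<in> A" and c: "c \<in> carrier (R a)" "c \<noteq> \<zero>\<^bsub>R a\<^esub>"
  shows "\<exists>t\<in>T. \<exists>r\<in>carrier P. t = r \<otimes>\<^bsub>P\<^esub> single A R a c \<and> t \<noteq> \<zero>\<^bsub>P\<^esub>"
proof -
  let ?s = "single A R a c"
  have s: "?s \<in> carrier P" by (rule single_P[OF c(1)])
  have "?s \<noteq> \<zero>\<^bsub>P\<^esub>"
  proof
    assume "?s = \<zero>\<^bsub>P\<^esub>"
    from fun_cong[OF this, of a] show False using a c(2) by (simp add: single_apply product_ring_simps)
  qed
  then have "PIdl\<^bsub>P\<^esub> ?s \<noteq> {\<zero>\<^bsub>P\<^esub>}" using P.cgenideal_self[OF s] by blast
  then have "PIdl\<^bsub>P\<^esub> ?s \<inter> T \<noteq> {\<zero>\<^bsub>P\<^esub>}"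
    using T_tight P.cgenideal_ideal[OF s] by (simp add: tight_extension_def)
  moreover have "\<zero>\<^bsub>P\<^esub> \<in> PIdl\<^bsub>P\<^esub> ?s"
    using additive_subgroup.zero_closed[OF ideal.axioms(1)[OF P.cgenideal_ideal[OF s]]] .
  ultimately obtain t where "t \<in> PIdl\<^bsub>P\<^esub> ?s" "t \<in> T" "t \<noteq> \<zero>\<^bsub>P\<^esub>"
    using nonzero_in_Int subringE(2)[OF T_subring] by blast
  then show ?thesis unfolding cgenideal_def by blast
qed

text \<open>At a nonzero coordinate \<open>a\<close>, the constant term argument multiplies
  \<open>u a\<close> into \<open>R a\<close>. The multiplier placed at \<open>a\<close> alone turns
  \<open>u\<close> into a singly supported element of the image of \<open>P\<close>, and
  \<open>T_support\<close> leads from there into \<open>T\<close>.\<close>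

lemma multiple_in_T:
  assumes u: "u \<in> Uc" "u \<noteq> \<zero>\<^bsub>W\<^esub>"
  shows "\<exists>v\<in>Uc. \<exists>t\<in>T. t \<noteq> \<zero>\<^bsub>P\<^esub> \<and> v \<otimes>\<^bsub>W\<^esub> u = J t"
proof -
  have uW: "u \<in> carrier W" by (rule Uc_W[OF u(1)])
  obtain a where a: "a \<in> A" "u a \<noteq> \<zero>\<^bsub>K a\<^esub>"
  proof (rule ccontr)
    assume *: "\<not> thesis"
    have "u = \<zero>\<^bsub>W\<^esub>"
      by (rule product_ring_ext[OF uW W.zero_closed]) (use * that in \<open>auto simp: product_ring_simps\<close>)
    then show False using u(2) by simp
  qed
  interpret Ka: field "K a" by (rule K_field[OF a(1)])
  interpret Ra: cring "R a" by (rule R_cring[OF a(1)])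
  interpret ja: ring_hom_ring "R a" "K a" "j a"
    by (rule ring_hom_ringI2[OF Ra.ring_axioms Ka.ring_axioms j_hom[OF a(1)]])
  define x where "x = u a"
  have x: "x \<in> carrier (K a)" "x \<noteq> \<zero>\<^bsub>K a\<^esub>" using product_ring_mem[OF uW a(1)] a(2) by (simp_all add: x_def)
  let ?B = "j a ` carrier (R a)"
  have B: "subring ?B (K a)" by (rule ja.img_is_subring[OF Ra.carrier_is_subring])
  have xint: "Ka.integral_over ?B x"
    using coord_integral[OF u(1) a(1)] integral_element_iff[OF Ra.is_cring Ka.is_cring j_hom[OF a(1)] x(1)]
    by (simp add: x_def)
  obtain z b where z: "Ka.integral_over ?B z" and zx: "z \<otimes>\<^bsub>K a\<^esub> x = b" and b: "b \<in> ?B" "b \<noteq> \<zero>\<^bsub>K a\<^esub>"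
    using Ka.integral_multiple_in_subring[OF B xint x(2)] by auto
  have zc: "z \<in> carrier (K a)" using z by (simp add: Ka.integral_over_def)
  have "integral_element (R a) (K a) (j a) z"
    using integral_element_iff[OF Ra.is_cring Ka.is_cring j_hom[OF a(1)] zc] z by simp
  then have sz: "single A K a z \<in> Uc" by (rule single_integral[OF a(1) zc])
  obtain c where c: "c \<in> carrier (R a)" "b = j a c" using b(1) by blast
  have "c \<noteq> \<zero>\<^bsub>R a\<^esub>" using b(2) c(2) j_zero[OF a(1)] by auto
  from T_support[OF a(1) c(1) this] obtain t q where t: "t \<in> T" "q \<in> carrier P"
    "t = q \<otimes>\<^bsub>P\<^esub> single A R a c" "t \<noteq> \<zero>\<^bsub>P\<^esub>" by blast
  have "J t = J q \<otimes>\<^bsub>W\<^esub> single A K a b" unfolding t(3) J.hom_mult[OF t(2) single_P[OF c(1)]] J_single[OF a(1)] c(2) ..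
  also have "single A K a b = single A K a z \<otimes>\<^bsub>W\<^esub> u"
    using single_mult[of A K z a, OF K_cring zc a(1) uW] zx by (simp add: x_def)
  also have "J q \<otimes>\<^bsub>W\<^esub> (single A K a z \<otimes>\<^bsub>W\<^esub> u) = (J q \<otimes>\<^bsub>W\<^esub> single A K a z) \<otimes>\<^bsub>W\<^esub> u"
    by (rule W.m_assoc[OF J_closed[OF t(2)] single_W[OF zc] uW, symmetric])
  finally have "(J q \<otimes>\<^bsub>W\<^esub> single A K a z) \<otimes>\<^bsub>W\<^esub> u = J t" by (rule sym)
  moreover have "J q \<otimes>\<^bsub>W\<^esub> single A K a z \<in> Uc" by (rule Uc_cl(5)[OF J_Uc[OF t(2)] sz])
  ultimately show ?thesis using t(1,4) by blast
qed

section \<open>\<open>U\<close> is an absolute integral closure of \<open>T\<close>\<close>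

lemma J_U: "J \<in> ring_hom RT U"
  by (rule ring_hom_memI)
    (use T_sub J_Uc J.hom_mult J.hom_add J.hom_one in \<open>auto simp: subset_iff\<close>)

lemma U_extension: "ring_extension RT U J"
  unfolding ring_extension_def
  using RT.is_cring U.is_cring J_U inj_on_subset[OF J_inj T_sub] by simp

lemma U_integral: "integral_extension RT U J"
  unfolding integral_extension_def
proof (intro conjI ballI U_extension)
  fix s assume "s \<in> carrier U"
  then have s: "s \<in> Uc" by simp
  then obtain p where p: "monic_poly RT p" "UnivPoly.eval RT W J s p = \<zero>\<^bsub>W\<^esub>"
    unfolding Uc_iff integral_element_def by blast
  have "UnivPoly.eval RT U J s p = UnivPoly.eval RT W J s p"
    using eval_image[OF RT.is_cring U.is_cring W.is_cring J_U subring_hom_id[OF Uc_cl(1)] _ monic_polyD(1)[OF p(1)], of s] s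
    by simp
  then show "integral_element RT U J s" unfolding integral_element_def using p by auto
qed

lemma U_tight: "tight_extension RT U J"
  unfolding tight_extension_def
proof (intro conjI allI impI U_extension)
  fix I assume I: "ideal I U \<and> I \<noteq> {\<zero>\<^bsub>U\<^esub>}"
  then interpret I: ideal I U by simp
  have z: "\<zero>\<^bsub>W\<^esub> \<in> I" using I.zero_closed by simp
  then obtain u where u: "u \<in> I" "u \<noteq> \<zero>\<^bsub>W\<^esub>" using I by auto
  then have "u \<in> Uc" using I.a_subset by auto
  from multiple_in_T[OF this u(2)] obtain v t where v: "v \<in> Uc" "t \<in> T" "t \<noteq> \<zero>\<^bsub>P\<^esub>" "v \<otimes>\<^bsub>W\<^esub> u = J t" by blast
  have "J t \<in> I" using I.I_l_closed[OF u(1), of v] v by simp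
  moreover have "J t \<noteq> \<zero>\<^bsub>W\<^esub>"
  proof
    assume "J t = \<zero>\<^bsub>W\<^esub>"
    then have "J t = J \<zero>\<^bsub>P\<^esub>" by simp
    then show False using inj_onD[OF J_inj _ subsetD[OF T_sub v(2)] P.zero_closed] v(3) by blast
  qed
  ultimately have "J t \<in> I \<inter> J ` T" "J t \<notin> {\<zero>\<^bsub>U\<^esub>}" using v(2) by simp_all
  then show "I \<inter> J ` carrier RT \<noteq> {\<zero>\<^bsub>U\<^esub>}" by auto
qed

text \<open>The splittings over the \<open>K a\<close> have the same number \<open>n\<close> of
  factors, so their \<open>i\<close>-th constants form an element \<open>C i\<close> of
  \<open>W\<close>. It lies in \<open>Uc\<close> because its negative is a root of \<open>p\<close>,
  hence integral over \<open>Uc\<close> and by transitivity over \<open>T\<close>.\<close>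

lemma U_ai_closed: "ai_closed U"
  unfolding ai_closed_iff
proof (intro allI impI)
  fix p assume p: "monic_poly U p"
  note pc = monic_polyD[OF p]
  define n where "n = deg U p"
  have idh: "id \<in> ring_hom U W" by (rule subring_hom_id[OF Uc_cl(1)])
  have ph: "(\<lambda>w. w a) \<in> ring_hom U (K a)" if "a \<in> A" for a by (rule ring_hom_subring[OF proj_hom[OF that] Uc_cl(1)])
  have "\<exists>c. c \<in> {..<n} \<rightarrow> carrier (K a) \<and> (\<lambda>w. w a) \<circ> p = (\<Otimes>\<^bsub>UP (K a)\<^esub>i\<in>{..<n}. linear_factor (K a) (c i))"
    if a: "a \<in> A" for a
    unfolding n_def
    by (rule monic_splits[OF K_field[OF a] K_roots[OF a]])
      (fact monic_poly_map[OF U.is_cring K_cring[OF a] ph[OF a] p])+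
  then obtain c where c: "\<And>a. a \<in> A \<Longrightarrow> c a \<in> {..<n} \<rightarrow> carrier (K a)"
    and cp: "\<And>a. a \<in> A \<Longrightarrow> (\<lambda>w. w a) \<circ> p = (\<Otimes>\<^bsub>UP (K a)\<^esub>i\<in>{..<n}. linear_factor (K a) (c a i))"
    by metis
  define C where "C i = (\<lambda>a\<in>A. c a i)" for i
  have CW: "C i \<in> carrier W" if i: "i < n" for i
    unfolding C_def product_ring_simps(1) using funcset_mem[OF c] i by simp
  have CU: "C i \<in> Uc" if i: "i < n" for i
  proof -
    let ?w = "\<ominus>\<^bsub>W\<^esub> C i"
    have w: "?w \<in> carrier W" using CW[OF i] by simp
    have ev: "UnivPoly.eval U W id ?w p \<in> carrier W"
      by (rule ring_hom_closed[OF eval_hom[OF U.is_cring W.is_cring idh w] pc(1)])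
    have "UnivPoly.eval U W id ?w p = \<zero>\<^bsub>W\<^esub>"
    proof (rule product_ring_ext[OF ev W.zero_closed])
      fix a assume a: "a \<in> A"
      have wa: "?w a = \<ominus>\<^bsub>K a\<^esub> id (c a i)"
        using product_ring_a_inv[of A K, OF K_cring CW[OF i] a] a by (simp add: C_def)
      have wc: "?w a \<in> carrier (K a)" by (rule product_ring_mem[OF w a])
      have "UnivPoly.eval U W id ?w p a = UnivPoly.eval U (K a) ((\<lambda>w. w a) \<circ> id) (?w a) p"
        by (rule eval_image[OF U.is_cring W.is_cring K_cring[OF a] idh proj_hom[OF a] w pc(1)])
      also have "\<dots> = UnivPoly.eval U (K a) (id \<circ> (\<lambda>w. w a)) (?w a) p" by (simp add: o_def)
      also have "\<dots> = UnivPoly.eval (K a) (K a) id (?w a) ((\<lambda>w. w a) \<circ> p)"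
        by (rule eval_comp[OF U.is_cring K_cring[OF a] K_cring[OF a] ph[OF a] id_ring_hom wc pc(1)])
      also have "\<dots> = \<zero>\<^bsub>K a\<^esub>"
        unfolding wa cp[OF a] by (rule prod_linear_factors_root[OF K_cring[OF a] K_cring[OF a] id_ring_hom c[OF a] i])
      also have "\<dots> = \<zero>\<^bsub>W\<^esub> a" using a by (simp add: product_ring_simps)
      finally show "UnivPoly.eval U W id ?w p a = \<zero>\<^bsub>W\<^esub> a" .
    qed
    then have "integral_element U W id ?w" unfolding integral_element_def using p by blast
    then have "W.integral_over Uc ?w" using integral_element_iff[OF U.is_cring W.is_cring idh w] by simp
    then have "W.integral_over (J ` T) ?w"
      by (rule W.integral_over_trans[OF J_T_subring, rotated]) (simp add: Uc_def)
    then have "?w \<in> Uc" using w by (simp add: Uc_def)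
    then have "\<ominus>\<^bsub>W\<^esub> ?w \<in> Uc" by (rule Uc_cl(6))
    then show ?thesis using CW[OF i] by simp
  qed
  have Cf: "C \<in> {..<n} \<rightarrow> carrier U" using CU by simp
  have lf: "(\<lambda>i. linear_factor U (C i)) \<in> {..<n} \<rightarrow> carrier (UP U)"
    by (rule funcsetI, rule linear_factor_closed[OF U.is_cring]) (use CU in simp)
  interpret UPU: cring "UP U" by (rule UP_is_cring[OF U.is_cring])
  let ?q = "\<Otimes>\<^bsub>UP U\<^esub>i\<in>{..<n}. linear_factor U (C i)"
  have qc: "?q \<in> carrier (UP U)" by (rule UPU.finprod_closed[OF lf])
  have "p = ?q"
  proof (rule ext, rule product_ring_ext)
    fix i
    have "p i \<in> carrier U" "?q i \<in> carrier U" using pc(1) qc carrier_UP_iff by blast+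
    then show "p i \<in> carrier W" "?q i \<in> carrier W" using Uc_W by simp_all
    fix a assume a: "a \<in> A"
    have "(\<lambda>w. w a) \<circ> ?q = (\<Otimes>\<^bsub>UP (K a)\<^esub>i\<in>{..<n}. linear_factor (K a) (C i a))"
      by (rule map_prod_linear_factors[OF U.is_cring K_cring[OF a] ph[OF a] Cf])
    also have "\<dots> = (\<lambda>w. w a) \<circ> p" unfolding cp[OF a] using a by (simp add: C_def)
    finally have "((\<lambda>w. w a) \<circ> ?q) i = ((\<lambda>w. w a) \<circ> p) i" by simp
    then show "p i a = ?q i a" by simp
  qed
  then show "\<exists>n c. c \<in> {..<n::nat} \<rightarrow> carrier U \<and> p = (\<Otimes>\<^bsub>UP U\<^esub>i\<in>{..<n}. linear_factor U (c i))"
    using Cf by blast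
qed

lemma U_aic: "aic RT U J"
  unfolding aic_def using U_ai_closed U_integral U_tight by simp

section \<open>Embedding integral tight extensions\<close>

lemma embeds_into_U:
  fixes S :: "('s, 'n) ring_scheme"
  assumes int: "integral_extension RT S k" and tight: "tight_extension RT S k"
  shows "\<exists>g\<in>ring_hom S U. inj_on g (carrier S) \<and> (\<forall>t\<in>T. g (k t) = J t)"
proof -
  have S: "cring S" and k: "k \<in> ring_hom RT S" "inj_on k T"
    using int by (simp_all add: integral_extension_def ring_extension_def)
  interpret S: cring S by (rule S)
  interpret k: ring_hom_ring RT S k by (rule ring_hom_ringI2[OF RT.ring_axioms S.ring_axioms k(1)])
  have kT: "k t \<in> carrier S" if "t \<in> T" for t using k.hom_closed[of t] that by simp
  have B: "subring (k ` T) S" using k.img_is_subring[OF RT.carrier_is_subring] by simp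
  \<comment> \<open>The extension theorem starts from a map on an actual subring of
    \<open>S\<close>; \<open>k'\<close> pulls the coordinate maps back from \<open>T\<close> to its
    image there.\<close>
  define k' where "k' = the_inv_into T k"
  have k': "k' (k t) = t" if "t \<in> T" for t unfolding k'_def by (rule the_inv_into_f_f[OF k(2) that])
  have Sint: "cring.integral_over S (k ` T) s" if "s \<in> carrier S" for s
    using int that integral_element_iff[OF RT.is_cring S k(1) that] by (simp add: integral_extension_def)
  have "\<exists>\<psi>\<in>ring_hom S (K a). \<forall>t\<in>T. \<psi> (k t) = j a (t a)" if a: "a \<in> A" for a
  proof -
    have h: "(\<lambda>x. j a (k' x a)) \<in> ring_hom (S\<lparr>carrier := k ` T\<rparr>) (K a)"
    proof (rule ring_hom_memI)
      fix x assume "x \<in> carrier (S\<lparr>carrier := k ` T\<rparr>)"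
      then obtain t where t: "t \<in> T" "x = k t" by auto
      then show "j a (k' x a) \<in> carrier (K a)" using ring_hom_closed[OF coord_hom[OF a], of t] k' by simp
    next
      fix x y assume "x \<in> carrier (S\<lparr>carrier := k ` T\<rparr>)" "y \<in> carrier (S\<lparr>carrier := k ` T\<rparr>)"
      then obtain t t' where t: "t \<in> T" "x = k t" "t' \<in> T" "y = k t'" by auto
      have m: "x \<otimes>\<^bsub>S\<^esub> y = k (t \<otimes>\<^bsub>P\<^esub> t')" "x \<oplus>\<^bsub>S\<^esub> y = k (t \<oplus>\<^bsub>P\<^esub> t')"
        using k.hom_mult[of t t'] k.hom_add[of t t'] t by simp_all
      show "j a (k' (x \<otimes>\<^bsub>S\<lparr>carrier := k ` T\<rparr>\<^esub> y) a) = j a (k' x a) \<otimes>\<^bsub>K a\<^esub> j a (k' y a)"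
        using m(1) k'[OF subringE(6)[OF T_subring t(1,3)]] k'[OF t(1)] k'[OF t(3)] t
          ring_hom_mult[OF coord_hom[OF a], of t t'] by simp
      show "j a (k' (x \<oplus>\<^bsub>S\<lparr>carrier := k ` T\<rparr>\<^esub> y) a) = j a (k' x a) \<oplus>\<^bsub>K a\<^esub> j a (k' y a)"
        using m(2) k'[OF subringE(7)[OF T_subring t(1,3)]] k'[OF t(1)] k'[OF t(3)] t
          ring_hom_add[OF coord_hom[OF a], of t t'] by simp
    next
      have "\<one>\<^bsub>S\<^esub> = k \<one>\<^bsub>P\<^esub>" using k.hom_one by simp
      then show "j a (k' \<one>\<^bsub>S\<lparr>carrier := k ` T\<rparr>\<^esub> a) = \<one>\<^bsub>K a\<^esub>"
        using k'[OF subringE(3)[OF T_subring]] ring_hom_one[OF coord_hom[OF a]] by simp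
    qed
    obtain \<psi> where "\<psi> \<in> ring_hom S (K a)" "\<forall>x\<in>k ` T. \<psi> x = j a (k' x a)"
      using integral_extension_hom_extends[OF S K_field[OF a] K_roots[OF a] B Sint h] by blast
    then show ?thesis using k' by (intro bexI[of _ \<psi>]) auto
  qed
  then obtain \<psi> where \<psi>: "\<And>a. a \<in> A \<Longrightarrow> \<psi> a \<in> ring_hom S (K a)"
    and \<psi>k: "\<And>a t. a \<in> A \<Longrightarrow> t \<in> T \<Longrightarrow> \<psi> a (k t) = j a (t a)" by metis
  define g where "g s = (\<lambda>a\<in>A. \<psi> a s)" for s
  have gW: "g s \<in> carrier W" if "s \<in> carrier S" for s
    unfolding g_def product_ring_simps(1) using ring_hom_closed[OF \<psi> that] by simp
  have gk: "g (k t) = J t" if "t \<in> T" for t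
    unfolding g_def J_def using \<psi>k[OF _ that] by (simp cong: restrict_cong)
  have g_hom: "g \<in> ring_hom S W"
  proof (rule ring_hom_memI)
    fix x y assume x: "x \<in> carrier S" and y: "y \<in> carrier S"
    show "g (x \<otimes>\<^bsub>S\<^esub> y) = g x \<otimes>\<^bsub>W\<^esub> g y"
      by (rule product_ring_ext[OF gW[OF S.m_closed[OF x y]] W.m_closed[OF gW[OF x] gW[OF y]]])
        (use ring_hom_mult[OF \<psi> x y] in \<open>simp add: g_def product_ring_simps\<close>)
    show "g (x \<oplus>\<^bsub>S\<^esub> y) = g x \<oplus>\<^bsub>W\<^esub> g y"
      by (rule product_ring_ext[OF gW[OF S.a_closed[OF x y]] W.a_closed[OF gW[OF x] gW[OF y]]])
        (use ring_hom_add[OF \<psi> x y] in \<open>simp add: g_def product_ring_simps\<close>)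
  next
    show "g \<one>\<^bsub>S\<^esub> = \<one>\<^bsub>W\<^esub>"
      by (rule product_ring_ext[OF gW[OF S.one_closed] W.one_closed])
        (use ring_hom_one[OF \<psi>] in \<open>simp add: g_def product_ring_simps\<close>)
  qed (rule gW)
  have gU: "g s \<in> Uc" if s: "s \<in> carrier S" for s
  proof -
    have "integral_element RT S k s" using int s by (simp add: integral_extension_def)
    then have "integral_element RT W J (g s)"
      by (rule integral_element_image[OF RT.is_cring S W.is_cring k(1) g_hom s, rotated]) (simp add: gk)
    then show ?thesis using Uc_iff gW[OF s] by blast
  qed
  have g_homU: "g \<in> ring_hom S U"
    by (rule ring_hom_memI)
      (simp_all add: gU ring_hom_mult[OF g_hom] ring_hom_add[OF g_hom] ring_hom_one[OF g_hom])
  interpret g: ring_hom_ring S U g by (rule ring_hom_ringI2[OF S.ring_axioms U.ring_axioms g_homU])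
  have "a_kernel S U g = {\<zero>\<^bsub>S\<^esub>}"
  proof (rule ccontr)
    assume "a_kernel S U g \<noteq> {\<zero>\<^bsub>S\<^esub>}"
    then have ne: "a_kernel S U g \<inter> k ` T \<noteq> {\<zero>\<^bsub>S\<^esub>}"
      using tight g.kernel_is_ideal by (simp add: tight_extension_def)
    have z: "\<zero>\<^bsub>S\<^esub> \<in> a_kernel S U g"
      using additive_subgroup.zero_closed[OF ideal.axioms(1)[OF g.kernel_is_ideal]] .
    have "\<zero>\<^bsub>S\<^esub> \<in> k ` T" using subringE(2)[OF B] .
    from nonzero_in_Int[OF ne z this] obtain t where t: "t \<in> T" "k t \<in> a_kernel S U g" "k t \<noteq> \<zero>\<^bsub>S\<^esub>" by blast
    then have "J t = J \<zero>\<^bsub>P\<^esub>" using gk[OF t(1)] unfolding a_kernel_def' by simp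
    then have "t = \<zero>\<^bsub>P\<^esub>" by (rule inj_onD[OF J_inj _ subsetD[OF T_sub t(1)] P.zero_closed])
    then show False using t(3) k.hom_zero by simp
  qed
  then have "inj_on g (carrier S)" by (rule g.trivial_ker_imp_inj)
  then show ?thesis using g_homU gk by blast
qed

section \<open>Endomorphisms of \<open>U\<close> over \<open>T\<close>\<close>

definition idem :: "'i \<Rightarrow> 'i \<Rightarrow> 'k" where "idem a = single A K a \<one>\<^bsub>K a\<^esub>"

lemma idem_eq: "a \<in> A \<Longrightarrow> idem a = J (single A R a \<one>\<^bsub>R a\<^esub>)"
  unfolding idem_def using J_single[of a "\<one>\<^bsub>R a\<^esub>"] ring_hom_one[OF j_hom] by simp

lemma one_in_R: "a \<in> A \<Longrightarrow> \<one>\<^bsub>R a\<^esub> \<in> carrier (R a)"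
  using ring.ring_simprules(6)[OF cring.axioms(1)[OF R_cring]] .

lemma one_in_K: "a \<in> A \<Longrightarrow> \<one>\<^bsub>K a\<^esub> \<in> carrier (K a)"
  using ring.ring_simprules(6)[OF cring.axioms(1)[OF K_cring]] .

lemma idem_Uc: "a \<in> A \<Longrightarrow> idem a \<in> Uc"
  using J_Uc[OF single_P[OF one_in_R]] by (simp add: idem_eq)

lemma idem_mult:
  assumes a: "a \<in> A" and w: "w \<in> carrier W" shows "idem a \<otimes>\<^bsub>W\<^esub> w = single A K a (w a)"
  using single_mult[of A K "\<one>\<^bsub>K a\<^esub>" a, OF K_cring one_in_K[OF a] a w]
    ring.ring_simprules(12)[OF cring.axioms(1)[OF K_cring[OF a]] product_ring_mem[OF w a]]
  by (simp add: idem_def)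

text \<open>Multiplying by an element of \<open>T\<close> that is supported at \<open>b\<close> determines the coordinate at \<open>b\<close>.\<close>

lemma endomorphism_fixes_idem:
  assumes e: "e \<in> ring_hom U U" and eJ: "\<And>t. t \<in> T \<Longrightarrow> e (J t) = J t" and a: "a \<in> A"
  shows "e (idem a) = idem a"
proof -
  have eU: "e u \<in> Uc" if "u \<in> Uc" for u using ring_hom_closed[OF e, of u] that by simp
  have em: "e (u \<otimes>\<^bsub>W\<^esub> v) = e u \<otimes>\<^bsub>W\<^esub> e v" if "u \<in> Uc" "v \<in> Uc" for u v
    using ring_hom_mult[OF e, of u v] that by simp
  have e0: "e \<zero>\<^bsub>W\<^esub> = \<zero>\<^bsub>W\<^esub>" using ring_hom_zero[OF e U.ring_axioms U.ring_axioms] by simp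
  note da = idem_Uc[OF a]
  show ?thesis
  proof (rule product_ring_ext[OF Uc_W[OF eU[OF da]] Uc_W[OF da]])
    fix b assume b: "b \<in> A"
    interpret Kb: domain "K b" by (rule K_domain[OF b])
    have nz: "\<one>\<^bsub>R b\<^esub> \<noteq> \<zero>\<^bsub>R b\<^esub>" using domain.one_not_zero[OF R_domain[OF b]] .
    obtain t r where t: "t \<in> T" "r \<in> carrier P" "t = r \<otimes>\<^bsub>P\<^esub> single A R b \<one>\<^bsub>R b\<^esub>" "t \<noteq> \<zero>\<^bsub>P\<^esub>"
      using T_support[OF b one_in_R[OF b] nz] by blast
    define x where "x = J r b"
    have JrW: "J r \<in> carrier W" by (rule J_closed[OF t(2)])
    have x: "x \<in> carrier (K b)" unfolding x_def by (rule product_ring_mem[OF JrW b])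
    have "J t = J r \<otimes>\<^bsub>W\<^esub> idem b"
      unfolding t(3) idem_eq[OF b] by (rule J.hom_mult[OF t(2) single_P[OF one_in_R[OF b]]])
    also have "\<dots> = idem b \<otimes>\<^bsub>W\<^esub> J r" by (rule W.m_comm[OF JrW Uc_W[OF idem_Uc[OF b]]])
    also have "\<dots> = single A K b x" unfolding x_def by (rule idem_mult[OF b JrW])
    finally have Jt: "J t = single A K b x" .
    have x0: "x \<noteq> \<zero>\<^bsub>K b\<^esub>"
    proof
      assume "x = \<zero>\<^bsub>K b\<^esub>"
      then have "J t = \<zero>\<^bsub>W\<^esub>" unfolding Jt by (auto simp: single_def product_ring_simps)
      then have "J t = J \<zero>\<^bsub>P\<^esub>" by simp
      then have "t = \<zero>\<^bsub>P\<^esub>" by (rule inj_onD[OF J_inj _ subsetD[OF T_sub t(1)] P.zero_closed])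
      then show False using t(4) by contradiction
    qed
    have JtU: "J t \<in> Uc" by (rule J_Uc[OF subsetD[OF T_sub t(1)]])
    have eaW: "e (idem a) \<in> carrier W" by (rule Uc_W[OF eU[OF da]])
    have eab: "e (idem a) b \<in> carrier (K b)" by (rule product_ring_mem[OF eaW b])
    have prod: "J t \<otimes>\<^bsub>W\<^esub> e (idem a) = e (J t \<otimes>\<^bsub>W\<^esub> idem a)" using em[OF JtU da] eJ[OF t(1)] by simp
    have "J t \<otimes>\<^bsub>W\<^esub> idem a = idem a \<otimes>\<^bsub>W\<^esub> J t" by (rule W.m_comm[OF Uc_W[OF JtU] Uc_W[OF da]])
    also have "\<dots> = single A K a (J t a)" by (rule idem_mult[OF a Uc_W[OF JtU]])
    finally have Jt_idem: "J t \<otimes>\<^bsub>W\<^esub> idem a = single A K a (J t a)" .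
    have lhs: "(J t \<otimes>\<^bsub>W\<^esub> e (idem a)) b = x \<otimes>\<^bsub>K b\<^esub> e (idem a) b"
      unfolding Jt using b by (simp add: product_ring_simps single_apply)
    show "e (idem a) b = idem a b"
    proof (cases "b = a")
      case True
      have z: "J t \<otimes>\<^bsub>W\<^esub> idem a = J t"
        unfolding Jt_idem using a True by (simp add: Jt single_apply)
      have "J t \<otimes>\<^bsub>W\<^esub> e (idem a) = J t" unfolding prod z by (rule eJ[OF t(1)])
      then have "x \<otimes>\<^bsub>K b\<^esub> e (idem a) b = J t b" using lhs by (simp only:)
      also have "J t b = x" unfolding Jt using b by (simp add: single_apply)
      also have "x = x \<otimes>\<^bsub>K b\<^esub> \<one>\<^bsub>K b\<^esub>" using x by simp
      finally have "e (idem a) b = \<one>\<^bsub>K b\<^esub>" by (rule Kb.m_lcancel[OF x0 x eab Kb.one_closed, THEN iffD1])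
      then show ?thesis using True b by (simp add: idem_def single_apply)
    next
      case False
      have z: "J t \<otimes>\<^bsub>W\<^esub> idem a = \<zero>\<^bsub>W\<^esub>"
        unfolding Jt_idem using a False by (auto simp: Jt single_def product_ring_simps)
      have "J t \<otimes>\<^bsub>W\<^esub> e (idem a) = \<zero>\<^bsub>W\<^esub>" unfolding prod z by (rule e0)
      then have "x \<otimes>\<^bsub>K b\<^esub> e (idem a) b = \<zero>\<^bsub>W\<^esub> b" using lhs by (simp only:)
      then have "x \<otimes>\<^bsub>K b\<^esub> e (idem a) b = \<zero>\<^bsub>K b\<^esub>" using b by (simp add: product_ring_simps)
      from Kb.integral[OF this x eab] have "e (idem a) b = \<zero>\<^bsub>K b\<^esub>" using x0 by (elim disjE) simp_all
      then show ?thesis using False b by (simp add: idem_def single_apply)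
    qed
  qed
qed

text \<open>Because \<open>e\<close> fixes \<open>idem a\<close>, the coordinate of
  \<open>e v\<close> at \<open>a\<close> depends on \<open>v a\<close> alone. On the finite root set
  \<open>V a\<close> of one equation of \<open>u\<close> this is an injective self-map, hence onto,
  and preimages found coordinate by coordinate can be joined.\<close>

lemma injective_endomorphism_surj:
  assumes e: "e \<in> ring_hom U U" and inj: "inj_on e Uc" and eJ: "\<And>t. t \<in> T \<Longrightarrow> e (J t) = J t"
  shows "Uc \<subseteq> e ` Uc"
proof
  fix u assume u: "u \<in> Uc"
  have eU: "e v \<in> Uc" if "v \<in> Uc" for v using ring_hom_closed[OF e, of v] that by simp
  have em: "e (v \<otimes>\<^bsub>W\<^esub> w) = e v \<otimes>\<^bsub>W\<^esub> e w" if "v \<in> Uc" "w \<in> Uc" for v w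
    using ring_hom_mult[OF e, of v w] that by simp
  obtain p where p: "monic_poly RT p" "UnivPoly.eval RT W J u p = \<zero>\<^bsub>W\<^esub>"
    using u unfolding Uc_iff integral_element_def by blast
  note pc = monic_polyD(1)[OF p(1)]
  define V where "V a = {x \<in> carrier (K a). UnivPoly.eval RT (K a) (\<lambda>x. j a (x a)) x p = \<zero>\<^bsub>K a\<^esub>}" for a
  have root_iff: "UnivPoly.eval RT W J w p = \<zero>\<^bsub>W\<^esub> \<longleftrightarrow> (\<forall>a\<in>A. w a \<in> V a)" if w: "w \<in> carrier W" for w
  proof
    assume "UnivPoly.eval RT W J w p = \<zero>\<^bsub>W\<^esub>"
    then show "\<forall>a\<in>A. w a \<in> V a"
      using eval_coord[OF w pc] product_ring_mem[OF w] by (simp add: V_def product_ring_simps)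
  next
    assume r: "\<forall>a\<in>A. w a \<in> V a"
    show "UnivPoly.eval RT W J w p = \<zero>\<^bsub>W\<^esub>"
      by (rule product_ring_ext[OF ring_hom_closed[OF eval_hom[OF RT.is_cring W.is_cring J_RT w] pc] W.zero_closed])
        (use r eval_coord[OF w pc] in \<open>simp add: V_def product_ring_simps\<close>)
  qed
  \<comment> \<open>The same \<open>p\<close> serves every coordinate, so any choice of roots, even
    at infinitely many coordinates, is integral over \<open>T\<close>.\<close>
  have rootU: "w \<in> Uc" if "w \<in> carrier W" "\<forall>a\<in>A. w a \<in> V a" for w
    unfolding Uc_iff integral_element_def using that root_iff[OF that(1)] p(1) by blast
  have root_e: "e w a \<in> V a" if w: "w \<in> carrier W" "\<forall>a\<in>A. w a \<in> V a" and a: "a \<in> A" for w a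
  proof -
    have wU: "w \<in> Uc" by (rule rootU[OF w])
    have c: "id \<in> ring_hom U W" by (rule subring_hom_id[OF Uc_cl(1)])
    have e': "e \<in> ring_hom U W" using ring_hom_trans[OF e c] by simp
    have "UnivPoly.eval RT U J w p = UnivPoly.eval RT W J w p"
      using eval_image[OF RT.is_cring U.is_cring W.is_cring J_U c _ pc, of w] wU by simp
    then have z: "UnivPoly.eval RT U J w p = \<zero>\<^bsub>U\<^esub>" using root_iff[OF w(1)] w(2) by simp
    have "UnivPoly.eval RT W J (e w) p = UnivPoly.eval RT W (e \<circ> J) (e w) p"
      by (rule eval_cong[OF _ pc]) (simp add: eJ)
    also have "\<dots> = e (UnivPoly.eval RT U J w p)"
      using eval_image[OF RT.is_cring U.is_cring W.is_cring J_U e' _ pc, of w] wU by simp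
    also have "\<dots> = \<zero>\<^bsub>W\<^esub>" unfolding z using ring_hom_zero[OF e U.ring_axioms U.ring_axioms] by simp
    finally show ?thesis using root_iff[OF Uc_W[OF eU[OF wU]]] a by blast
  qed
  have uV: "u a \<in> V a" if "a \<in> A" for a using root_iff[OF Uc_W[OF u]] p(2) that by blast
  \<comment> \<open>Replacing the coordinate \<open>u a\<close> by another root keeps \<open>u\<close> a root of \<open>p\<close>, so \<open>e\<close> acts on the finite set \<open>V a\<close>.\<close>
  have "\<exists>x\<in>V a. e (u(a := x)) a = u a" if a: "a \<in> A" for a
  proof -
    have finV: "finite (V a)"
    proof -
      let ?q = "(\<lambda>x. j a (x a)) \<circ> p"
      have "UnivPoly.eval RT (K a) (id \<circ> (\<lambda>x. j a (x a))) x p = UnivPoly.eval (K a) (K a) id x ?q"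
        if "x \<in> carrier (K a)" for x
        by (rule eval_comp[OF RT.is_cring K_cring[OF a] K_cring[OF a] coord_hom[OF a] id_ring_hom that pc])
      then have "V a = {x \<in> carrier (K a). UnivPoly.eval (K a) (K a) id x ?q = \<zero>\<^bsub>K a\<^esub>}"
        unfolding V_def by (auto simp: o_def)
      also have "finite \<dots>"
        by (rule finite_roots_monic[OF K_field[OF a] K_roots[OF a]])
          (fact monic_poly_map[OF RT.is_cring K_cring[OF a] coord_hom[OF a] p(1)])+
      finally show ?thesis .
    qed
    interpret Ka: cring "K a" by (rule K_cring[OF a])
    define f where "f x = e (u(a := x)) a" for x
    have wW: "u(a := x) \<in> carrier W" if "x \<in> V a" for x
      using Uc_W[OF u] that a unfolding product_ring_simps(1) V_def by (auto simp: PiE_iff extensional_def)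
    have wV: "\<forall>b\<in>A. (u(a := x)) b \<in> V b" if "x \<in> V a" for x using uV that by simp
    have wU: "u(a := x) \<in> Uc" if "x \<in> V a" for x by (rule rootU[OF wW[OF that] wV[OF that]])
    have fV: "f x \<in> V a" if "x \<in> V a" for x unfolding f_def by (rule root_e[OF wW[OF that] wV[OF that] a])
    have "inj_on f (V a)"
    proof (rule inj_onI)
      fix x y assume x: "x \<in> V a" and y: "y \<in> V a" and xy: "f x = f y"
      \<comment> \<open>Multiplication by the idempotent isolates coordinate \<open>a\<close> and
        commutes with \<open>e\<close>; thus \<open>f x = f y\<close> becomes an equality of two
        values of \<open>e\<close> on \<open>Uc\<close>, to which injectivity applies.\<close>
      have ie: "idem a \<otimes>\<^bsub>W\<^esub> e v = e (idem a \<otimes>\<^bsub>W\<^esub> v)" if "v \<in> Uc" for v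
        using em[OF idem_Uc[OF a] that] endomorphism_fixes_idem[OF e eJ a] by simp
      have "idem a \<otimes>\<^bsub>W\<^esub> e (u(a := x)) = idem a \<otimes>\<^bsub>W\<^esub> e (u(a := y))"
        unfolding idem_mult[OF a Uc_W[OF eU[OF wU[OF x]]]] idem_mult[OF a Uc_W[OF eU[OF wU[OF y]]]]
        using xy by (simp add: f_def)
      then have "e (idem a \<otimes>\<^bsub>W\<^esub> u(a := x)) = e (idem a \<otimes>\<^bsub>W\<^esub> u(a := y))"
        unfolding ie[OF wU[OF x]] ie[OF wU[OF y]] .
      then have "idem a \<otimes>\<^bsub>W\<^esub> u(a := x) = idem a \<otimes>\<^bsub>W\<^esub> u(a := y)"
        by (rule inj_onD[OF inj _ Uc_cl(5)[OF idem_Uc[OF a] wU[OF x]] Uc_cl(5)[OF idem_Uc[OF a] wU[OF y]]])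
      then have "single A K a x = single A K a y"
        unfolding idem_mult[OF a wW[OF x]] idem_mult[OF a wW[OF y]] by simp
      from fun_cong[OF this, of a] show "x = y" using a by (simp add: single_apply)
    qed
    then have "f ` V a = V a" using finV fV by (intro endo_inj_surj) auto
    then have "u a \<in> f ` V a" using uV[OF a] by simp
    then obtain x where "x \<in> V a" "f x = u a" by (rule imageE) simp
    then show ?thesis unfolding f_def by (intro bexI)
  qed
  then obtain x where x: "\<And>a. a \<in> A \<Longrightarrow> x a \<in> V a" "\<And>a. a \<in> A \<Longrightarrow> e (u(a := x a)) a = u a" by metis
  \<comment> \<open>The preimages are chosen independently in all coordinates; the result is a root
    of \<open>p\<close>, and therefore stays in \<open>Uc\<close>.\<close>
  define u' where "u' = (\<lambda>a\<in>A. x a)"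
  have u'W: "u' \<in> carrier W" unfolding u'_def product_ring_simps(1) using x(1) by (simp add: V_def)
  have u': "u' \<in> Uc" by (rule rootU[OF u'W]) (simp add: u'_def x(1))
  have "e u' = u"
  proof (rule product_ring_ext[OF Uc_W[OF eU[OF u']] Uc_W[OF u]])
    fix a assume a: "a \<in> A"
    have wW: "u(a := x a) \<in> carrier W"
      using Uc_W[OF u] x(1)[OF a] a unfolding product_ring_simps(1) V_def by (auto simp: PiE_iff extensional_def)
    have wU: "u(a := x a) \<in> Uc" by (rule rootU[OF wW]) (use uV x(1)[OF a] in simp)
    have coord: "e v a = (e (idem a \<otimes>\<^bsub>W\<^esub> v)) a" if v: "v \<in> Uc" for v
    proof -
      have "e (idem a \<otimes>\<^bsub>W\<^esub> v) = idem a \<otimes>\<^bsub>W\<^esub> e v"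
        using em[OF idem_Uc[OF a] v] endomorphism_fixes_idem[OF e eJ a] by simp
      also have "\<dots> = single A K a (e v a)" by (rule idem_mult[OF a Uc_W[OF eU[OF v]]])
      finally show ?thesis using a by (simp add: single_apply)
    qed
    have "idem a \<otimes>\<^bsub>W\<^esub> u' = idem a \<otimes>\<^bsub>W\<^esub> u(a := x a)"
      unfolding idem_mult[OF a u'W] idem_mult[OF a wW] using a by (simp add: u'_def)
    then have "e u' a = e (u(a := x a)) a" using coord[OF u'] coord[OF wU] by simp
    then show "e u' a = u a" using x(2)[OF a] by simp
  qed
  then show "u \<in> e ` Uc" using u' by blast
qed

section \<open>Universality and uniqueness\<close>

lemma algebra_iso_of_embedding:
  fixes S :: "('s, 'n) ring_scheme"
  assumes S: "cring S" and k: "\<And>t. t \<in> T \<Longrightarrow> k t \<in> carrier S" and g: "g \<in> ring_hom S U"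
    and inj: "inj_on g (carrier S)" and surj: "Uc \<subseteq> g ` carrier S" and gk: "\<And>t. t \<in> T \<Longrightarrow> g (k t) = J t"
  shows "algebra_iso RT U J S k"
proof -
  have "g ` carrier S = carrier U" using surj ring_hom_closed[OF g] by auto
  then have giso: "g \<in> ring_iso S U" using g inj by (simp add: ring_iso_def bij_betw_def)
  have "inv_into (carrier S) g \<in> ring_iso U S"
    by (rule ring_iso_set_sym[OF cring.axioms(1)[OF S] giso])
  moreover have "inv_into (carrier S) g (J t) = k t" if "t \<in> T" for t
    using inv_into_f_f[OF inj k[OF that]] gk[OF that] by simp
  ultimately show ?thesis unfolding algebra_iso_def by (intro bexI[of _ "inv_into (carrier S) g"]) simp_all
qed

lemma aic_closed: "aic RT S k \<Longrightarrow> cring S" "aic RT S k \<Longrightarrow> t \<in> T \<Longrightarrow> k t \<in> carrier S"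
  using ring_hom_closed[of k RT S t] by (simp_all add: aic_def integral_extension_def ring_extension_def)

lemma aic_embedding:
  fixes S :: "('s, 'n) ring_scheme"
  assumes "aic RT S k"
  obtains g where "g \<in> ring_hom S U" "inj_on g (carrier S)" "\<And>t. t \<in> T \<Longrightarrow> g (k t) = J t"
proof -
  have "integral_extension RT S k" "tight_extension RT S k" using assms by (simp_all add: aic_def)
  from embeds_into_U[OF this] obtain g where g: "g \<in> ring_hom S U" "inj_on g (carrier S) \<and> (\<forall>t\<in>T. g (k t) = J t)"
    by (elim bexE)
  show thesis by (rule that[OF g(1)]) (use g(2) in simp_all)
qed

lemma U_universal: "universal_aic TYPE('s) RT U J"
  unfolding universal_aic_def algebra_embeds_def
proof (intro conjI allI impI U_aic)
  fix S :: "'s ring" and k assume "aic RT S k"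
  then have "integral_extension RT S k" "tight_extension RT S k" by (simp_all add: aic_def)
  from embeds_into_U[OF this] show "\<exists>f\<in>ring_hom S U. inj_on f (carrier S) \<and> (\<forall>r\<in>carrier RT. f (k r) = J r)"
    by simp
qed

text \<open>Universality of \<open>V\<close> for rings on the type of \<open>U\<close> gives an
  embedding of \<open>U\<close> into \<open>V\<close>, and \<open>V\<close> embeds into
  \<open>U\<close>. The composite is an injective endomorphism of \<open>U\<close> over
  \<open>T\<close>, hence surjective; so the embedding of \<open>V\<close> is onto.\<close>

lemma U_unique_universal: "unique_universal_aic TYPE('s) TYPE('v) RT U J"
  unfolding unique_universal_aic_def
proof (intro conjI allI impI U_universal)
  fix V :: "'v ring" and k assume V: "universal_aic TYPE('i \<Rightarrow> 'k) RT V k"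
  then have Va: "aic RT V k" and "algebra_embeds RT U J V k" using U_aic by (simp_all add: universal_aic_def)
  then obtain f where f: "f \<in> ring_hom U V" "inj_on f (carrier U) \<and> (\<forall>t\<in>carrier RT. f (J t) = k t)"
    unfolding algebra_embeds_def by (elim bexE)
  then have f_inj: "inj_on f Uc" by simp
  have fJ: "f (J t) = k t" if "t \<in> T" for t using f(2) that by simp
  obtain g where g: "g \<in> ring_hom V U" "inj_on g (carrier V)" and gk: "\<And>t. t \<in> T \<Longrightarrow> g (k t) = J t"
    by (rule aic_embedding[OF Va], rule that, assumption+)
  have fV: "f ` Uc \<subseteq> carrier V" using ring_hom_closed[OF f(1)] by auto
  have "Uc \<subseteq> (g \<circ> f) ` Uc"
    by (rule injective_endomorphism_surj[OF ring_hom_trans[OF f(1) g(1)] comp_inj_on[OF f_inj inj_on_subset[OF g(2) fV]]])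
      (simp add: fJ gk)
  also have "\<dots> \<subseteq> g ` carrier V" using fV by auto
  finally have surj: "Uc \<subseteq> g ` carrier V" .
  show "algebra_iso RT U J V k"
    by (rule algebra_iso_of_embedding[OF aic_closed(1)[OF Va] aic_closed(2)[OF Va] g surj gk])
qed

section \<open>The case of a finite index set\<close>

text \<open>Finiteness of \<open>A\<close> enters here: \<open>w\<close> is the sum of its singly
  supported parts, and a subring is closed under finite sums.\<close>

lemma finite_sum_of_singles:
  assumes "finite A" and B: "subring B W" and w: "w \<in> carrier W"
    and s: "\<And>a. a \<in> A \<Longrightarrow> single A K a (w a) \<in> B"
  shows "w \<in> B"
proof -
  note cl = W.subring_cl[OF B]
  have "F \<subseteq> A \<Longrightarrow> (\<lambda>a\<in>A. if a \<in> F then w a else \<zero>\<^bsub>K a\<^esub>) \<in> B" if "finite F" for F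
    using that
  proof (induction F rule: finite_induct)
    case empty
    have "(\<lambda>a\<in>A. if a \<in> {} then w a else \<zero>\<^bsub>K a\<^esub>) = \<zero>\<^bsub>W\<^esub>"
      by (simp add: product_ring_simps)
    then show ?case using cl(2) by (simp only:)
  next
    case (insert a F)
    let ?v = "\<lambda>a\<in>A. if a \<in> F then w a else \<zero>\<^bsub>K a\<^esub>"
    have a: "a \<in> A" and F: "F \<subseteq> A" using insert.prems by simp_all
    have v: "?v \<in> B" by (rule insert.IH[OF F])
    have sum: "single A K a (w a) \<oplus>\<^bsub>W\<^esub> ?v \<in> B" by (rule cl(4)[OF s[OF a] v])
    have "(\<lambda>b\<in>A. if b \<in> insert a F then w b else \<zero>\<^bsub>K b\<^esub>) = single A K a (w a) \<oplus>\<^bsub>W\<^esub> ?v"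
    proof (rule ext)
      fix b
      show "(\<lambda>b\<in>A. if b \<in> insert a F then w b else \<zero>\<^bsub>K b\<^esub>) b = (single A K a (w a) \<oplus>\<^bsub>W\<^esub> ?v) b"
      proof (cases "b \<in> A")
        case True
        interpret Kb: cring "K b" by (rule K_cring[OF True])
        interpret Ka: cring "K a" by (rule K_cring[OF a])
        show ?thesis
        proof (cases "b = a")
          case ba: True
          then show ?thesis using a product_ring_mem[OF w a] insert.hyps(2)
            by (simp add: product_ring_simps single_apply)
        next
          case False
          then show ?thesis using True product_ring_mem[OF w True]
            by (simp add: product_ring_simps single_apply)
        qed
      qed (simp add: product_ring_simps)
    qed
    then show ?case using sum by (simp only:)
  qed
  from this[OF \<open>finite A\<close> subset_refl] have "(\<lambda>a\<in>A. if a \<in> A then w a else \<zero>\<^bsub>K a\<^esub>) \<in> B" .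
  moreover have "(\<lambda>a\<in>A. if a \<in> A then w a else \<zero>\<^bsub>K a\<^esub>) = w"
  proof (rule ext)
    fix a
    show "(\<lambda>a\<in>A. if a \<in> A then w a else \<zero>\<^bsub>K a\<^esub>) a = w a"
      using PiE_arb[OF w[unfolded product_ring_simps(1)], of a] by (cases "a \<in> A") simp_all
  qed
  ultimately show ?thesis by (simp only:)
qed

text \<open>The embedding of an aic \<open>S\<close> into \<open>U\<close> must be shown onto. An
  \<open>x\<close> integral over \<open>R a\<close> is a root of a monic polynomial that lifts to
  \<open>P\<close> and splits over \<open>S\<close>; so \<open>x\<close> is the coordinate at
  \<open>a\<close> of some element of the image, and the idempotent of \<open>P\<close> removes the
  other coordinates.\<close>

lemma finite_unique_aic:
  assumes fin: "finite A" and T: "T = carrier P"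
  shows "unique_aic TYPE('s) P U J"
proof -
  have RT: "RT = P" unfolding T by simp
  show ?thesis
    unfolding unique_aic_def
  proof (intro conjI allI impI)
    show "aic P U J" using U_aic unfolding RT .
    fix S :: "'s ring" and k assume Sk: "aic P S k"
    then have aRT: "aic RT S k" unfolding RT .
    obtain g where g: "g \<in> ring_hom S U" "inj_on g (carrier S)" "\<And>t. t \<in> T \<Longrightarrow> g (k t) = J t"
      by (rule aic_embedding[OF aRT], rule that, assumption+)
    interpret S: cring S using aic_closed(1)[OF aRT] .
    interpret g: ring_hom_ring S U g by (rule ring_hom_ringI2[OF S.ring_axioms U.ring_axioms g(1)])
    have k: "k \<in> ring_hom P S" using Sk by (simp add: aic_def integral_extension_def ring_extension_def)
    have gW: "g \<in> ring_hom S W" using ring_hom_trans[OF g(1) subring_hom_id[OF Uc_cl(1)]] by simp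
    have B: "subring (g ` carrier S) W"
      by (rule ring_hom_ring.img_is_subring[OF ring_hom_ringI2[OF S.ring_axioms W.ring_axioms gW] S.carrier_is_subring])
    have sing: "single A K a x \<in> g ` carrier S" if a: "a \<in> A" and x: "x \<in> carrier (K a)"
      and int: "integral_element (R a) (K a) (j a) x" for a x
    proof -
      obtain p where p: "monic_poly (R a) p" "UnivPoly.eval (R a) (K a) (j a) x p = \<zero>\<^bsub>K a\<^esub>"
        using int unfolding integral_element_def by blast
      from lift_monic_poly[OF a x p] obtain q where q: "monic_poly P q" "(\<lambda>x. x a) \<circ> q = p" by blast
      note qc = monic_polyD(1)[OF q(1)]
      obtain n :: nat and c where c: "c \<in> {..<n} \<rightarrow> carrier S" "k \<circ> q = (\<Otimes>\<^bsub>UP S\<^esub>i\<in>{..<n}. linear_factor S (c i))"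
        using Sk monic_poly_map(4)[OF P.is_cring S.is_cring k q(1)] unfolding aic_def ai_closed_iff by blast
      have h: "(\<lambda>s. g s a) \<in> ring_hom S (K a)"
        using ring_hom_trans[OF gW proj_hom[OF a]] by (simp add: o_def)
      have "UnivPoly.eval S (K a) (\<lambda>s. g s a) x (k \<circ> q) = UnivPoly.eval P (K a) ((\<lambda>s. g s a) \<circ> k) x q"
        by (rule eval_comp[OF P.is_cring S.is_cring K_cring[OF a] k h x qc, symmetric])
      also have "\<dots> = UnivPoly.eval P (K a) (j a \<circ> (\<lambda>x. x a)) x q"
        by (rule eval_cong[OF _ qc]) (simp add: g(3) T J_apply[OF a])
      also have "\<dots> = UnivPoly.eval (R a) (K a) (j a) x ((\<lambda>x. x a) \<circ> q)"
        by (rule eval_comp[OF P.is_cring R_cring[OF a] K_cring[OF a] proj_hom[OF a] j_hom[OF a] x qc])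
      also have "\<dots> = \<zero>\<^bsub>K a\<^esub>" unfolding q(2) by (rule p(2))
      finally have "\<exists>i<n. x = \<ominus>\<^bsub>K a\<^esub> g (c i) a"
        unfolding c(2) by (rule root_of_prod_linear_factors[OF S.is_cring K_domain[OF a] h x c(1)])
      then obtain i where i: "i < n" "x = \<ominus>\<^bsub>K a\<^esub> g (c i) a" by blast
      have ci: "c i \<in> carrier S" using funcset_mem[OF c(1)] i(1) by simp
      define s where "s = \<ominus>\<^bsub>S\<^esub> c i"
      have s: "s \<in> carrier S" using ci by (simp add: s_def)
      interpret h: ring_hom_cring S "K a" "\<lambda>s. g s a"
        using h S.is_cring K_cring[OF a] by (simp add: ring_hom_cring_def ring_hom_cring_axioms_def)
      have "g s a = \<ominus>\<^bsub>K a\<^esub> g (c i) a" unfolding s_def by (rule h.hom_a_inv[OF ci])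
      then have gs: "g s a = x" using i(2) by simp
      \<comment> \<open>In this case the idempotent belongs to \<open>P\<close>, so \<open>k\<close>
        makes it available in \<open>S\<close>.\<close>
      let ?e = "k (single A R a \<one>\<^bsub>R a\<^esub>)"
      have ec: "?e \<in> carrier S" by (rule ring_hom_closed[OF k single_P[OF one_in_R[OF a]]])
      have "g (?e \<otimes>\<^bsub>S\<^esub> s) = g ?e \<otimes>\<^bsub>W\<^esub> g s" by (rule ring_hom_mult[OF gW ec s])
      also have "g ?e = idem a" using g(3) single_P[OF one_in_R[OF a]] idem_eq[OF a] by (simp add: T)
      also have "idem a \<otimes>\<^bsub>W\<^esub> g s = single A K a x" using idem_mult[OF a ring_hom_closed[OF gW s]] gs by simp
      finally have "single A K a x = g (?e \<otimes>\<^bsub>S\<^esub> s)" by (rule sym)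
      then show ?thesis using S.m_closed[OF ec s] by blast
    qed
    have surj: "Uc \<subseteq> g ` carrier S"
    proof
      fix u assume u: "u \<in> Uc"
      show "u \<in> g ` carrier S"
        by (rule finite_sum_of_singles[OF fin B Uc_W[OF u]])
          (rule sing[OF _ product_ring_mem[OF Uc_W[OF u]] coord_integral[OF u]])
    qed
    have "algebra_iso RT U J S k"
      by (rule algebra_iso_of_embedding[OF aic_closed(1)[OF aRT] aic_closed(2)[OF aRT] g(1,2) surj g(3)])
    then show "algebra_iso P U J S k" unfolding RT .
  qed
qed

section \<open>Comparison with the product of the rings of integral elements\<close>

text \<open>For the fields \<open>K a\<close> of \<^const>\<open>domain_plus\<close> this is the carrier of \<^const>\<open>product_plus\<close>.\<close>

definition integral_product where
  "integral_product = (\<Pi>\<^sub>E a\<in>A. {x \<in> carrier (K a). integral_element (R a) (K a) (j a) x})"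

lemma Uc_integral_product: "Uc \<subseteq> integral_product"
proof
  fix u assume u: "u \<in> Uc"
  have "u \<in> (\<Pi>\<^sub>E a\<in>A. carrier (K a))" using Uc_W[OF u] by (simp add: product_ring_simps)
  then show "u \<in> integral_product"
    unfolding integral_product_def using coord_integral[OF u] by (simp add: PiE_iff)
qed

lemma integral_product_W: "w \<in> integral_product \<Longrightarrow> w \<in> carrier W"
  by (simp add: integral_product_def product_ring_simps PiE_iff)

lemma integral_product_subring: "subring integral_product W"
proof -
  have I: "subring {x \<in> carrier (K a). integral_element (R a) (K a) (j a) x} (K a)" if a: "a \<in> A" for a
  proof -
    interpret Ka: cring "K a" by (rule K_cring[OF a])
    interpret Ra: cring "R a" by (rule R_cring[OF a])
    have "subring (j a ` carrier (R a)) (K a)"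
      by (rule ring_hom_ring.img_is_subring[OF ring_hom_ringI2[OF Ra.ring_axioms Ka.ring_axioms j_hom[OF a]] Ra.carrier_is_subring])
    from Ka.integral_elements_subring[OF this]
    have "subring {x \<in> carrier (K a). Ka.integral_over (j a ` carrier (R a)) x} (K a)" .
    moreover have "{x \<in> carrier (K a). Ka.integral_over (j a ` carrier (R a)) x}
        = {x \<in> carrier (K a). integral_element (R a) (K a) (j a) x}"
    proof (intro Collect_cong conj_cong refl)
      fix x assume "x \<in> carrier (K a)"
      then show "Ka.integral_over (j a ` carrier (R a)) x \<longleftrightarrow> integral_element (R a) (K a) (j a) x"
        by (rule integral_element_iff[OF Ra.is_cring Ka.is_cring j_hom[OF a], symmetric])
    qed
    ultimately show ?thesis by (simp only:)
  qed
  note I_cl = subringE[OF I]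
  have mem: "w \<in> integral_product \<longleftrightarrow> w \<in> carrier W \<and> (\<forall>a\<in>A. w a \<in> {x \<in> carrier (K a). integral_element (R a) (K a) (j a) x})" for w
    by (auto simp: integral_product_def product_ring_simps PiE_iff)
  show ?thesis
  proof (rule W.subringI)
    show "integral_product \<subseteq> carrier W" using integral_product_W by blast
    show "\<one>\<^bsub>W\<^esub> \<in> integral_product" unfolding mem using I_cl(3) by (simp add: product_ring_simps)
  next
    fix w assume "w \<in> integral_product"
    then have w: "w \<in> carrier W" "\<And>a. a \<in> A \<Longrightarrow> w a \<in> {x \<in> carrier (K a). integral_element (R a) (K a) (j a) x}"
      unfolding mem by simp_all
    show "\<ominus>\<^bsub>W\<^esub> w \<in> integral_product"
      unfolding mem
    proof (intro conjI ballI W.a_inv_closed[OF w(1)])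
      fix a assume a: "a \<in> A"
      show "(\<ominus>\<^bsub>W\<^esub> w) a \<in> {x \<in> carrier (K a). integral_element (R a) (K a) (j a) x}"
        using I_cl(5)[OF a w(2)[OF a]] product_ring_a_inv[of A K w a, OF K_cring w(1) a] by (simp only:)
    qed
  next
    fix v w assume "v \<in> integral_product" "w \<in> integral_product"
    then have v: "v \<in> carrier W" "\<And>a. a \<in> A \<Longrightarrow> v a \<in> {x \<in> carrier (K a). integral_element (R a) (K a) (j a) x}"
      and w: "w \<in> carrier W" "\<And>a. a \<in> A \<Longrightarrow> w a \<in> {x \<in> carrier (K a). integral_element (R a) (K a) (j a) x}"
      unfolding mem by simp_all
    show "v \<otimes>\<^bsub>W\<^esub> w \<in> integral_product"
      unfolding mem
    proof (intro conjI ballI W.m_closed[OF v(1) w(1)])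
      fix a assume a: "a \<in> A"
      have "(v \<otimes>\<^bsub>W\<^esub> w) a = v a \<otimes>\<^bsub>K a\<^esub> w a" using a by (simp add: product_ring_simps)
      then show "(v \<otimes>\<^bsub>W\<^esub> w) a \<in> {x \<in> carrier (K a). integral_element (R a) (K a) (j a) x}"
        using I_cl(6)[OF a v(2)[OF a] w(2)[OF a]] by (simp only:)
    qed
    show "v \<oplus>\<^bsub>W\<^esub> w \<in> integral_product"
      unfolding mem
    proof (intro conjI ballI W.a_closed[OF v(1) w(1)])
      fix a assume a: "a \<in> A"
      have "(v \<oplus>\<^bsub>W\<^esub> w) a = v a \<oplus>\<^bsub>K a\<^esub> w a" using a by (simp add: product_ring_simps)
      then show "(v \<oplus>\<^bsub>W\<^esub> w) a \<in> {x \<in> carrier (K a). integral_element (R a) (K a) (j a) x}"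
        using I_cl(7)[OF a v(2)[OF a] w(2)[OF a]] by (simp only:)
    qed
  qed
qed

text \<open>\<open>Uc\<close> already lies in the smaller product, and evaluation gives the same
  value there as in \<open>W\<close>.\<close>

lemma integral_closure_in_integral_product:
  "integral_closure RT (W\<lparr>carrier := integral_product\<rparr>) J = U"
proof -
  let ?Q = "W\<lparr>carrier := integral_product\<rparr>"
  have Q: "cring ?Q" by (rule subring_is_cring[OF W.is_cring integral_product_subring])
  have idh: "id \<in> ring_hom ?Q W" by (rule subring_hom_id) (use integral_product_W in blast)
  have JQ: "J \<in> ring_hom RT ?Q"
    by (rule ring_hom_memI)
      (use T_sub J_Uc Uc_integral_product J.hom_mult J.hom_add J.hom_one in \<open>auto simp: subset_iff\<close>)
  have "integral_element RT ?Q J w \<longleftrightarrow> integral_element RT W J w" if w: "w \<in> integral_product" for w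
  proof -
    have "UnivPoly.eval RT ?Q J w p = UnivPoly.eval RT W J w p" if "monic_poly RT p" for p
      using eval_image[OF RT.is_cring Q W.is_cring JQ idh _ monic_polyD(1)[OF that], of w] w by simp
    then show ?thesis unfolding integral_element_def by auto
  qed
  then have "{w \<in> integral_product. integral_element RT ?Q J w} = Uc"
    using Uc_iff Uc_integral_product integral_product_W by blast
  then show ?thesis by (simp add: integral_closure_def)
qed

text \<open>The singly supported parts of an element of the product are integral over
  \<open>T\<close> by \<open>single_integral\<close>, and there are only finitely many of
  them.\<close>

lemma finite_integral_product:
  assumes "finite A" shows "integral_product = Uc"
proof
  show "integral_product \<subseteq> Uc"
  proof
    fix w assume w: "w \<in> integral_product"
    show "w \<in> Uc"
    proof (rule finite_sum_of_singles[OF assms Uc_subring integral_product_W[OF w]])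
      fix a assume a: "a \<in> A"
      show "single A K a (w a) \<in> Uc"
        using w a by (intro single_integral) (auto simp: integral_product_def)
    qed
  qed
qed (rule Uc_integral_product)

end

section \<open>The three claims\<close>

theorem proposition2:
  fixes A :: "'i set" and R :: "'i \<Rightarrow> 'a ring"
  assumes "\<And>a. a \<in> A \<Longrightarrow> domain (R a)"
  shows
    "(finite A \<longrightarrow>
        unique_aic TYPE('s) (product_ring A R) (product_plus A R) (product_plus_map A R)) \<and>
     (infinite A \<longrightarrow>
        (\<exists>(U :: ('i \<Rightarrow> 'a plus_elem) ring) h.
           unique_universal_aic TYPE('s) TYPE('v) (product_ring A R) U h)) \<and>
     (\<forall>T. subring T (product_ring A R) \<and>
          integral_extension ((product_ring A R)\<lparr>carrier := T\<rparr>) (product_ring A R) id \<and>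
          tight_extension ((product_ring A R)\<lparr>carrier := T\<rparr>) (product_ring A R) id \<longrightarrow>
        unique_universal_aic TYPE('s) TYPE('v) ((product_ring A R)\<lparr>carrier := T\<rparr>)
          (integral_closure ((product_ring A R)\<lparr>carrier := T\<rparr>)
             (product_plus A R) (product_plus_map A R))
          (product_plus_map A R))"
proof -
  let ?P = "product_ring A R"
  let ?K = "\<lambda>a. field.alg_closure (fraction_field (R a))"
  let ?j = "\<lambda>a. domain_plus_map (R a)"
  interpret P: cring ?P by (rule product_ring_cring) (use assms in \<open>simp add: domain_def\<close>)
  have loc: "domain_product A R ?K ?j T"
    if "subring T ?P" "integral_extension (?P\<lparr>carrier := T\<rparr>) ?P id" "tight_extension (?P\<lparr>carrier := T\<rparr>) ?P id" for T
    using assms domain.domain_plus_map_hom[OF assms] that by (intro domain_product.intro)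
  have J: "domain_product.J A ?j = product_plus_map A R"
    if "domain_product A R ?K ?j T" for T
    by (rule ext) (simp only: domain_product.J_def[OF that] product_plus_map_def)
  \<comment> \<open>\<open>domain_plus\<close> shrinks the carrier of the algebraic closure and
    keeps its operations, so the product of the closures is a subring of the product of the
    fields.\<close>
  have plus: "product_plus A R = (product_ring A ?K)\<lparr>carrier := domain_product.integral_product A R ?K ?j\<rparr>"
    if "domain_product A R ?K ?j T" for T
    unfolding domain_product.integral_product_def[OF that]
    by (simp add: product_plus_def domain_plus_def integral_closure_def product_ring_def)
  have part3: "unique_universal_aic TYPE('s) TYPE('v) (?P\<lparr>carrier := T\<rparr>)
      (integral_closure (?P\<lparr>carrier := T\<rparr>) (product_plus A R) (product_plus_map A R)) (product_plus_map A R)"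
    if T: "subring T ?P" "integral_extension (?P\<lparr>carrier := T\<rparr>) ?P id" "tight_extension (?P\<lparr>carrier := T\<rparr>) ?P id" for T
  proof -
    interpret domain_product A R ?K ?j T by (rule loc[OF T])
    show ?thesis
      unfolding plus[OF loc[OF T]] J[OF loc[OF T], symmetric] integral_closure_in_integral_product
      by (rule U_unique_universal)
  qed
  \<comment> \<open>The first two claims are the case \<open>T = carrier ?P\<close>, for which
    \<open>?P\<close> has to be integral and tight over itself.\<close>
  have PP: "?P\<lparr>carrier := carrier ?P\<rparr> = ?P" by simp
  have ext: "ring_extension ?P ?P id" using P.is_cring by (simp add: ring_extension_def)
  have int: "integral_extension ?P ?P id"
    unfolding integral_extension_def
  proof (intro conjI ballI ext)
    fix s assume s: "s \<in> carrier ?P"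
    show "integral_element ?P ?P id s"
      using integral_element_iff[OF P.is_cring P.is_cring id_ring_hom s]
        P.integral_over_self[OF P.carrier_is_subring s] by simp
  qed
  have tight: "tight_extension ?P ?P id"
    unfolding tight_extension_def
  proof (intro conjI allI impI ext)
    fix I assume I: "ideal I ?P \<and> I \<noteq> {\<zero>\<^bsub>?P\<^esub>}"
    then have "I \<subseteq> carrier ?P" using additive_subgroup.a_subset[OF ideal.axioms(1)] by blast
    then have "I \<inter> id ` carrier ?P = I" by auto
    then show "I \<inter> id ` carrier ?P \<noteq> {\<zero>\<^bsub>?P\<^esub>}" using I by simp
  qed
  have self': "subring (carrier ?P) ?P" "integral_extension (?P\<lparr>carrier := carrier ?P\<rparr>) ?P id"
    "tight_extension (?P\<lparr>carrier := carrier ?P\<rparr>) ?P id"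
    using P.carrier_is_subring int tight by simp_all
  have part1: "unique_aic TYPE('s) ?P (product_plus A R) (product_plus_map A R)" if fin: "finite A"
  proof -
    interpret domain_product A R ?K ?j "carrier ?P" by (rule loc[OF self'])
    show ?thesis
      unfolding plus[OF loc[OF self']] J[OF loc[OF self'], symmetric] finite_integral_product[OF fin]
      by (rule finite_unique_aic[OF fin refl])
  qed
  have part2: "\<exists>(U :: ('i \<Rightarrow> 'a plus_elem) ring) h. unique_universal_aic TYPE('s) TYPE('v) ?P U h"
    using part3[OF self'] unfolding PP by (intro exI)
  show ?thesis
  proof (intro conjI allI impI)
    fix T assume T: "subring T ?P \<and> integral_extension (?P\<lparr>carrier := T\<rparr>) ?P id \<and>
      tight_extension (?P\<lparr>carrier := T\<rparr>) ?P id"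
    show "unique_universal_aic TYPE('s) TYPE('v) (?P\<lparr>carrier := T\<rparr>)
      (integral_closure (?P\<lparr>carrier := T\<rparr>) (product_plus A R) (product_plus_map A R)) (product_plus_map A R)"
      by (rule part3) (use T in simp_all)
  next
    assume "finite A"
    then show "unique_aic TYPE('s) ?P (product_plus A R) (product_plus_map A R)" by (rule part1)
  next
    show "\<exists>(U :: ('i \<Rightarrow> 'a plus_elem) ring) h. unique_universal_aic TYPE('s) TYPE('v) ?P U h" by (rule part2)
  qed
qed

end
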